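(* Let $\mathcal{G}$ be an amenable measured groupoid and let $E$ be a measurable coefficient $\mathcal{G}$-module. Then $\mathrm{H}^k_{mb}(\mathcal{G},E)=0$ for every $k\ge1$.
   Context: **Measured groupoids.** A groupoid $\mathcal{G}$ is a small category with all morphisms invertible, identified with its set of arrows; $s(g)=g^{-1}g$, $t(g)=gg^{-1}$, unit space $\mathcal{G}^{(0)}$, $gh$ is defined iff $s(g)=t(h)$, $\mathcal{G}^{[2]}$ is the set of composable pairs, $\mathcal{G}^x=t^{-1}(x)$. A Borel groupoid carries a standard Borel structure making composition and inverse Borel. A measured groupoid is a Borel groupoid with a measure class that is symmetric (preserved by $g\mapsto g^{-1}$) and contains a (symmetric) probability measure $\nu$ whose disintegration $\nu=\int\nu^x\,d\mu(x)$ along $t$ ($\mu=t_*\nu$, $\nu^x$ supported on $\mathcal{G}^x$) satisfies $g\nu^{s(g)}\sim\nu^{t(g)}$ for $\nu$-a.e. $g$. Such a $\nu$ is fixed. **Amenability.** An invariant measurable system of means is a family $\{\mathfrak{m}^x\}_{x\in\mathcal{G}^{(0)}}$ of means (positive linear functionals with $\mathfrak{m}^x(1)=1$) $\mathfrak{m}^x:L^\infty(\mathcal{G},\nu^x)\to\mathbb{R}$ such that, for every $\lambda\in L^\infty(\mathcal{G})$, writing $\lambda^x$ for the restriction of $\lambda$ to $\mathcal{G}^x$ (extended by zero), the map $x\mapsto\mathfrak{m}^x(\lambda^x)$ is Borel measurable, and for $\nu$-a.e. $g\in\mathcal{G}$ one has $\mathfrak{m}^{t(g)}(\lambda^{t(g)})=\mathfrak{m}^{s(g)}(g^{-1}\lambda^{t(g)})$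 for all $\lambda$, where $(g^{-1}\lambda^{t(g)})(h)=\lambda(gh)$ for $t(h)=s(g)$ and $0$ otherwise. $\mathcal{G}$ is amenable if it admits an invariant measurable system of means. **Coefficients.** A measurable coefficient $\mathcal{G}$-module $(E,L)$: $E=(E^\flat)^*$ with $E^\flat$ a separable Banach space, together with $L^\flat:\mathcal{G}\to\mathrm{Isom}(E^\flat)$ such that $L^\flat(gh)=L^\flat(g)L^\flat(h)$ for almost every $(g,h)\in\mathcal{G}^{[2]}$ and $g\mapsto L^\flat(g)v$ is measurable for every $v\in E^\flat$; $L$ is the contragredient: $\langle L(g)\lambda,v\rangle=\langle\lambda,L^\flat(g^{-1})v\rangle$. **Measurable bounded cohomology.** $\mathcal{G}^{(n)}$ is the set of $n$-tuples in $\mathcal{G}$ with common target, with measure $\nu^{(n)}=\int(\nu^x)^{\otimes n}d\mu(x)$. $L^\infty_{w^*}(\mathcal{G}^{(n)},E)$ is the space of weak$^*$ measurable essentially bounded functions $\mathcal{G}^{(n)}\to E$ modulo a.e. equality; $\lambda$ is $\mathcal{G}$-invariant if $L(g)\lambda(g^{-1}g_1,\dots,g^{-1}g_n)=\lambda(g_1,\dots,g_n)$ for $\nu^{(n+1)}$-a.e. $(g,g_1,\dots,g_n)\in\mathcal{G}^{(n+1)}$. $\mathrm{H}^k_{mb}(\mathcal{G},E)$ is the $k$-th cohomology of $\big(L^\infty_{w^*}(\mathcal{G}^{(k+1)},E)^{\mathcal{G}}\big)_{k\ge0}$ with the homogeneous coboundary $\delta\lambda(g_1,\dots,g_{k+2})=\sum_{i}(-1)^{i-1}\lambda(g_1,\dots,\widehat{g_i},\dots,g_{k+2})$.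 *)

theory Defs
  imports "HOL-Probability.Probability" "HOL-Algebra.Elementary_Groups"
begin

section \<open>Groupoids, identified with their sets of arrows\<close>

record 'a groupoid =
  arrows :: "'a set"
  gmult :: "'a \<Rightarrow> 'a \<Rightarrow> 'a"
  ginv :: "'a \<Rightarrow> 'a"

definition src :: "('a, 'b) groupoid_scheme \<Rightarrow> 'a \<Rightarrow> 'a" where
  "src G g = gmult G (ginv G g) g"

definition tgt :: "('a, 'b) groupoid_scheme \<Rightarrow> 'a \<Rightarrow> 'a" where
  "tgt G g = gmult G g (ginv G g)"

definition unit_space :: "('a, 'b) groupoid_scheme \<Rightarrow> 'a set" where
  "unit_space G = tgt G ` arrows G"

definition fibre :: "('a, 'b) groupoid_scheme \<Rightarrow> 'a \<Rightarrow> 'a set" where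
  "fibre G x = {g \<in> arrows G. tgt G g = x}"

definition composable :: "('a, 'b) groupoid_scheme \<Rightarrow> ('a \<times> 'a) set" where
  "composable G = {(g, h). g \<in> arrows G \<and> h \<in> arrows G \<and> src G g = tgt G h}"

locale groupoid =
  fixes G :: "('a, 'b) groupoid_scheme"
  assumes inv_closed: "g \<in> arrows G \<Longrightarrow> ginv G g \<in> arrows G"
    and src_inv: "g \<in> arrows G \<Longrightarrow> src G (ginv G g) = tgt G g"
    and tgt_inv: "g \<in> arrows G \<Longrightarrow> tgt G (ginv G g) = src G g"
    and mult_closed: "(g, h) \<in> composable G \<Longrightarrow> gmult G g h \<in> arrows G"
    and src_mult: "(g, h) \<in> composable G \<Longrightarrow> src G (gmult G g h) = src G h"
    and tgt_mult: "(g, h) \<in> composable G \<Longrightarrow> tgt G (gmult G g h) = tgt G g"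
    and mult_assoc: "(g, h) \<in> composable G \<Longrightarrow> (h, k) \<in> composable G \<Longrightarrow>
      gmult G (gmult G g h) k = gmult G g (gmult G h k)"
    and tgt_unit: "g \<in> arrows G \<Longrightarrow> gmult G (tgt G g) g = g"
    and src_unit: "g \<in> arrows G \<Longrightarrow> gmult G g (src G g) = g"


section \<open>Measured groupoids\<close>

text \<open>Only the Borel structure of the measure matters here, that is, its space and its sigma-algebra.\<close>

definition standard_borel :: "'a measure \<Rightarrow> bool" where
  "standard_borel M \<longleftrightarrow> (\<exists>X. completely_metrizable_space X \<and> second_countable X \<and>
     topspace X = space M \<and> sets M = sigma_sets (topspace X) {U. openin X U})"

locale borel_groupoid = groupoid G for G :: "('a, 'b) groupoid_scheme" +
  fixes M :: "'a measure"
  assumes space_eq: "space M = arrows G"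
    and standard: "standard_borel M"
    and mult_borel: "(\<lambda>(g, h). gmult G g h) \<in> restrict_space (M \<Otimes>\<^sub>M M) (composable G) \<rightarrow>\<^sub>M M"
    and inv_borel: "ginv G \<in> M \<rightarrow>\<^sub>M M"

text \<open>The measure \<open>nu\<close> also carries the Borel structure; \<open>nufib x\<close> is the fibre measure
  over the unit \<open>x\<close> in the disintegration of \<open>nu\<close> along the target map. The measure class of the
  groupoid is the class of \<open>nu\<close>.\<close>

record 'a measured_groupoid_data = "'a groupoid" +
  nu :: "'a measure"
  nufib :: "'a \<Rightarrow> 'a measure"

definition unit_borel :: "'a measured_groupoid_data \<Rightarrow> 'a measure" where
  "unit_borel G = restrict_space (nu G) (unit_space G)"

definition mu :: "'a measured_groupoid_data \<Rightarrow> 'a measure" where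
  "mu G = distr (nu G) (unit_borel G) (tgt G)"

text \<open>Left multiplication by \<open>g\<close> is only meaningful on the fibre over \<open>src G g\<close>, whence the
  restriction before pushing forward.\<close>

definition translate :: "'a measured_groupoid_data \<Rightarrow> 'a \<Rightarrow> 'a measure" where
  "translate G g =
     distr (restrict_space (nufib G (src G g)) (fibre G (src G g))) (nu G) (gmult G g)"

definition equivalent_measures :: "'a measure \<Rightarrow> 'a measure \<Rightarrow> bool" where
  "equivalent_measures M N \<longleftrightarrow> absolutely_continuous M N \<and> absolutely_continuous N M"

locale measured_groupoid = borel_groupoid G "nu G" for G :: "'a measured_groupoid_data" +
  assumes nu_prob: "prob_space (nu G)"
    and nu_symmetric: "distr (nu G) (nu G) (ginv G) = nu G"
    and nufib_kernel: "nufib G \<in> unit_borel G \<rightarrow>\<^sub>M prob_algebra (nu G)"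
    and nufib_support: "x \<in> unit_space G \<Longrightarrow> emeasure (nufib G x) (fibre G x) = 1"
    and disintegration: "nu G = mu G \<bind> nufib G"
    and quasi_invariant: "AE g in nu G. equivalent_measures (translate G g) (nufib G (tgt G g))"


section \<open>Amenability\<close>

definition ess_bounded_fun :: "'a measure \<Rightarrow> ('a \<Rightarrow> real) set" where
  "ess_bounded_fun N = {f \<in> borel_measurable N. \<exists>C. AE x in N. \<bar>f x\<bar> \<le> C}"

text \<open>A mean on the space of essentially bounded functions modulo null functions, given as a
  functional on representatives that respects almost everywhere equality.\<close>

definition is_mean :: "'a measure \<Rightarrow> (('a \<Rightarrow> real) \<Rightarrow> real) \<Rightarrow> bool" where
  "is_mean N m \<longleftrightarrow>
     (\<forall>f\<in>ess_bounded_fun N. \<forall>f'\<in>ess_bounded_fun N. (AE x in N. f x = f' x) \<longrightarrow> m f = m f') \<and>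
     (\<forall>f\<in>ess_bounded_fun N. \<forall>f'\<in>ess_bounded_fun N. m (\<lambda>x. f x + f' x) = m f + m f') \<and>
     (\<forall>c. \<forall>f\<in>ess_bounded_fun N. m (\<lambda>x. c * f x) = c * m f) \<and>
     (\<forall>f\<in>ess_bounded_fun N. (AE x in N. 0 \<le> f x) \<longrightarrow> 0 \<le> m f) \<and>
     m (\<lambda>_. 1) = 1"

text \<open>Bounded Borel functions represent all classes of essentially bounded functions on the
  groupoid, and unlike the latter they restrict to every single fibre.\<close>

definition bounded_borel_fun :: "'a measure \<Rightarrow> ('a \<Rightarrow> real) set" where
  "bounded_borel_fun M = {f \<in> borel_measurable M. \<exists>C. \<forall>x\<in>space M. \<bar>f x\<bar> \<le> C}"

definition fibre_restrict ::
  "('a, 'b) groupoid_scheme \<Rightarrow> ('a \<Rightarrow> real) \<Rightarrow> 'a \<Rightarrow> 'a \<Rightarrow> real" where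
  "fibre_restrict G l x = (\<lambda>h. if h \<in> fibre G x then l h else 0)"

text \<open>The function \<open>g\<inverse> l\<^bsup>t(g)\<^esup>\<close>, supported on the fibre over \<open>s(g)\<close>.\<close>

definition fibre_shift ::
  "('a, 'b) groupoid_scheme \<Rightarrow> 'a \<Rightarrow> ('a \<Rightarrow> real) \<Rightarrow> 'a \<Rightarrow> real" where
  "fibre_shift G g l = (\<lambda>h. if h \<in> fibre G (src G g) then l (gmult G g h) else 0)"

definition invariant_system_of_means ::
  "'a measured_groupoid_data \<Rightarrow> ('a \<Rightarrow> ('a \<Rightarrow> real) \<Rightarrow> real) \<Rightarrow> bool" where
  "invariant_system_of_means G m \<longleftrightarrow>
     (\<forall>x\<in>unit_space G. is_mean (nufib G x) (m x)) \<and>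
     (\<forall>l\<in>bounded_borel_fun (nu G).
        (\<lambda>x. m x (fibre_restrict G l x)) \<in> borel_measurable (unit_borel G)) \<and>
     (AE g in nu G. \<forall>l\<in>bounded_borel_fun (nu G).
        m (tgt G g) (fibre_restrict G l (tgt G g)) = m (src G g) (fibre_shift G g l))"

definition amenable :: "'a measured_groupoid_data \<Rightarrow> bool" where
  "amenable G \<longleftrightarrow> (\<exists>m. invariant_system_of_means G m)"


section \<open>Coefficient modules\<close>

text \<open>The measure on composable pairs: \<open>g\<close> is distributed according to \<open>nu\<close> and then \<open>h\<close>
  according to the fibre measure over \<open>s(g)\<close>. By symmetry of \<open>nu\<close> this is the image of the measure
  on pairs with common target under \<open>(g\<^sub>1, g\<^sub>2) \<mapsto> (g\<^sub>1\<inverse>, g\<^sub>2)\<close>.\<close>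

definition nu_composable :: "'a measured_groupoid_data \<Rightarrow> ('a \<times> 'a) measure" where
  "nu_composable G = restrict_space
     (nu G \<bind> (\<lambda>g. distr (nufib G (src G g)) (nu G \<Otimes>\<^sub>M nu G) (Pair g))) (composable G)"

text \<open>The predual is the type \<open>'v\<close> (a separable real Banach space), the coefficient module is
  its dual \<open>'v \<Rightarrow>\<^sub>L real\<close>, and \<open>Lb\<close> is the action on the predual.\<close>

locale coefficient_module = measured_groupoid G for G :: "'a measured_groupoid_data" +
  fixes Lb :: "'a \<Rightarrow> ('v::{banach, second_countable_topology} \<Rightarrow>\<^sub>L 'v)"
  assumes Lb_isometry: "g \<in> arrows G \<Longrightarrow> norm (blinfun_apply (Lb g) v) = norm v"
    and Lb_surj: "g \<in> arrows G \<Longrightarrow> surj (blinfun_apply (Lb g))"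
    and Lb_mult: "AE (g, h) in nu_composable G. Lb (gmult G g h) = Lb g o\<^sub>L Lb h"
    and Lb_measurable: "(\<lambda>g. blinfun_apply (Lb g) v) \<in> borel_measurable (nu G)"

definition contragredient ::
  "('a, 'b) groupoid_scheme \<Rightarrow> ('a \<Rightarrow> ('v::real_normed_vector \<Rightarrow>\<^sub>L 'v)) \<Rightarrow>
    'a \<Rightarrow> ('v \<Rightarrow>\<^sub>L real) \<Rightarrow> ('v \<Rightarrow>\<^sub>L real)" where
  "contragredient G Lb g l = l o\<^sub>L Lb (ginv G g)"


section \<open>Measurable bounded cohomology\<close>

text \<open>An \<open>n\<close>-tuple is an extensional function on \<open>{..<n}\<close>, so entries are numbered from 0.\<close>

definition tuples :: "('a, 'b) groupoid_scheme \<Rightarrow> nat \<Rightarrow> (nat \<Rightarrow> 'a) set" where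
  "tuples G n = {w \<in> {..<n} \<rightarrow>\<^sub>E arrows G. \<forall>i<n. \<forall>j<n. tgt G (w i) = tgt G (w j)}"

definition nu_tuples :: "'a measured_groupoid_data \<Rightarrow> nat \<Rightarrow> (nat \<Rightarrow> 'a) measure" where
  "nu_tuples G n =
     restrict_space (mu G \<bind> (\<lambda>x. PiM {..<n} (\<lambda>_. nufib G x))) (tuples G n)"

text \<open>The additive group of weak-* measurable essentially bounded functions on \<open>n\<close>-tuples, before
  passing to classes.\<close>

definition wstar_fun :: "'a measured_groupoid_data \<Rightarrow> nat \<Rightarrow>
    ((nat \<Rightarrow> 'a) \<Rightarrow> ('v::real_normed_vector \<Rightarrow>\<^sub>L real)) monoid" where
  "wstar_fun G n =
     \<lparr>carrier = {f. (\<forall>v. (\<lambda>w. blinfun_apply (f w) v) \<in> borel_measurable (nu_tuples G n)) \<and>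
                   (\<exists>C. AE w in nu_tuples G n. norm (f w) \<le> C)},
      monoid.mult = (\<lambda>f f' w. f w + f' w),
      one = (\<lambda>_. 0)\<rparr>"

definition null_fun :: "'a measured_groupoid_data \<Rightarrow> nat \<Rightarrow>
    ((nat \<Rightarrow> 'a) \<Rightarrow> ('v::real_normed_vector \<Rightarrow>\<^sub>L real)) set" where
  "null_fun G n = {f \<in> carrier (wstar_fun G n). AE w in nu_tuples G n. f w = 0}"

definition Linf_wstar :: "'a measured_groupoid_data \<Rightarrow> nat \<Rightarrow>
    ((nat \<Rightarrow> 'a) \<Rightarrow> ('v::real_normed_vector \<Rightarrow>\<^sub>L real)) set monoid" where
  "Linf_wstar G n = wstar_fun G n Mod null_fun G n"

definition ae_class :: "'a measured_groupoid_data \<Rightarrow> nat \<Rightarrow>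
    ((nat \<Rightarrow> 'a) \<Rightarrow> ('v::real_normed_vector \<Rightarrow>\<^sub>L real)) \<Rightarrow>
    ((nat \<Rightarrow> 'a) \<Rightarrow> ('v \<Rightarrow>\<^sub>L real)) set" where
  "ae_class G n f = null_fun G n #>\<^bsub>wstar_fun G n\<^esub> f"

text \<open>In the condition below, \<open>w\<close> is the tuple \<open>(g, g\<^sub>1, \<dots>, g\<^sub>n)\<close>.\<close>

definition invariant_fun :: "'a measured_groupoid_data \<Rightarrow>
    ('a \<Rightarrow> ('v::real_normed_vector \<Rightarrow>\<^sub>L 'v)) \<Rightarrow> nat \<Rightarrow>
    ((nat \<Rightarrow> 'a) \<Rightarrow> ('v \<Rightarrow>\<^sub>L real)) \<Rightarrow> bool" where
  "invariant_fun G Lb n f \<longleftrightarrow>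
     (AE w in nu_tuples G (Suc n).
        contragredient G Lb (w 0) (f (\<lambda>i\<in>{..<n}. gmult G (ginv G (w 0)) (w (Suc i)))) =
        f (\<lambda>i\<in>{..<n}. w (Suc i)))"

definition cochains :: "'a measured_groupoid_data \<Rightarrow>
    ('a \<Rightarrow> ('v::real_normed_vector \<Rightarrow>\<^sub>L 'v)) \<Rightarrow> nat \<Rightarrow>
    ((nat \<Rightarrow> 'a) \<Rightarrow> ('v \<Rightarrow>\<^sub>L real)) set monoid" where
  "cochains G Lb k = (Linf_wstar G (Suc k))
     \<lparr>carrier := {ae_class G (Suc k) f | f.
        f \<in> carrier (wstar_fun G (Suc k)) \<and> invariant_fun G Lb (Suc k) f}\<rparr>"

text \<open>\<open>omit k i\<close> deletes the entry with index \<open>i\<close> of a \<open>(k+2)\<close>-tuple.\<close>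

definition omit :: "nat \<Rightarrow> nat \<Rightarrow> (nat \<Rightarrow> 'a) \<Rightarrow> (nat \<Rightarrow> 'a)" where
  "omit k i w = (\<lambda>j\<in>{..<Suc k}. if j < i then w j else w (Suc j))"

definition coboundary_fun :: "nat \<Rightarrow>
    ((nat \<Rightarrow> 'a) \<Rightarrow> ('v::real_normed_vector \<Rightarrow>\<^sub>L real)) \<Rightarrow>
    (nat \<Rightarrow> 'a) \<Rightarrow> ('v \<Rightarrow>\<^sub>L real)" where
  "coboundary_fun k f = (\<lambda>w. \<Sum>i<Suc (Suc k). (-1) ^ i *\<^sub>R f (omit k i w))"

text \<open>The induced map on classes; all representatives of a class give the same contribution to the
  union.\<close>

definition coboundary :: "'a measured_groupoid_data \<Rightarrow> nat \<Rightarrow>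
    ((nat \<Rightarrow> 'a) \<Rightarrow> ('v::real_normed_vector \<Rightarrow>\<^sub>L real)) set \<Rightarrow>
    ((nat \<Rightarrow> 'a) \<Rightarrow> ('v \<Rightarrow>\<^sub>L real)) set" where
  "coboundary G k X = (\<Union>f\<in>X. ae_class G (Suc (Suc k)) (coboundary_fun k f))"

definition cocycles :: "'a measured_groupoid_data \<Rightarrow>
    ('a \<Rightarrow> ('v::real_normed_vector \<Rightarrow>\<^sub>L 'v)) \<Rightarrow> nat \<Rightarrow>
    ((nat \<Rightarrow> 'a) \<Rightarrow> ('v \<Rightarrow>\<^sub>L real)) set set" where
  "cocycles G Lb k = kernel (cochains G Lb k) (cochains G Lb (Suc k)) (coboundary G k)"

fun coboundaries :: "'a measured_groupoid_data \<Rightarrow>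
    ('a \<Rightarrow> ('v::real_normed_vector \<Rightarrow>\<^sub>L 'v)) \<Rightarrow> nat \<Rightarrow>
    ((nat \<Rightarrow> 'a) \<Rightarrow> ('v \<Rightarrow>\<^sub>L real)) set set" where
  "coboundaries G Lb 0 = {\<one>\<^bsub>cochains G Lb 0\<^esub>}"
| "coboundaries G Lb (Suc k) = coboundary G k ` carrier (cochains G Lb k)"

definition Hmb :: "'a measured_groupoid_data \<Rightarrow>
    ('a \<Rightarrow> ('v::real_normed_vector \<Rightarrow>\<^sub>L 'v)) \<Rightarrow> nat \<Rightarrow>
    ((nat \<Rightarrow> 'a) \<Rightarrow> ('v \<Rightarrow>\<^sub>L real)) set set monoid" where
  "Hmb G Lb k = (cochains G Lb k)\<lparr>carrier := cocycles G Lb k\<rparr> Mod coboundaries G Lb k"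

end

theory Submission
  imports Defs
begin

text \<open>
  The contracting homotopy integrates the first variable of a cocycle against the means \<open>m x\<close>. Since
  \<open>w \<mapsto> m x (\<lambda>g. f (g, w))\<close> need not be measurable, the homotopy is defined by duality: on the fibre
  over \<open>x\<close>, the set function \<open>A \<mapsto> m x (\<lambda>g. \<integral>w\<in>A. f (g, w))\<close> is dominated by the product measure,
  hence is countably additive although \<open>m x\<close> is not, and it depends measurably on \<open>x\<close> because it is the mean of
  a bounded Borel function on the groupoid. Its Radon--Nikodym density, taken jointly in \<open>x\<close> and \<open>w\<close>,
  is the value of the homotopy at \<open>w\<close>. A dual-valued cochain is treated in this way for each vector of a
  countable dense subset of the predual. The homotopy identity and the equivariance are then checked
  against test functions on almost every fibre: the former uses that \<open>m x\<close> preserves constants, the latter the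
  invariance of the means together with the density of the translated fibre measures.
\<close>

subsection \<open>Standard Borel spaces\<close>

text \<open>Four points shape the argument. Forgetting an entry of a tuple and translating by an
  arrow both turn the indicator of a set into a general integrable function, so the duality that
  defines the homotopy must be extended from sets to all of L1 before either identity can be tested.
  The density produced over \<open>x\<close> depends on \<open>x\<close>, whereas a cochain is a
  function of the tuple alone; the base point is recovered as the target of the first remaining
  entry. In degree at least 1 such an entry remains after the first variable is integrated out, and
  this is where positive degree enters. Densities chosen one vector at a time are not linear in the
  vector; linearity and the norm bound hold off a null set because both are encoded in countably
  many inequalities with rational coefficients. Finally, cochains are classes while means act on
  single fibres: a bounded Borel representative on all tuples is fixed first, and almost-everywhere
  statements are then moved between the measure on tuples, the fibre over almost every
  \<open>x\<close>, and pairs of an arrow \<open>g\<close> with a tuple over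
  \<open>tgt G g\<close>.\<close>

lemma standard_borel_countable_base:
  assumes "standard_borel M"
  obtains B where "countable B" "B \<subseteq> Pow (space M)" "sets M = sigma_sets (space M) B"
    "\<And>x y. x \<in> space M \<Longrightarrow> y \<in> space M \<Longrightarrow> x \<noteq> y \<Longrightarrow> \<exists>U\<in>B. \<exists>V\<in>B. x \<in> U \<and> y \<in> V \<and> U \<inter> V = {}"
proof -
  obtain X where X: "completely_metrizable_space X" "second_countable X"
    "topspace X = space M" "sets M = sigma_sets (topspace X) {U. openin X U}"
    using assms by (auto simp: standard_borel_def)
  obtain B where B: "countable B" "\<And>V. V \<in> B \<Longrightarrow> openin X V"
    "\<And>U x. openin X U \<Longrightarrow> x \<in> U \<Longrightarrow> \<exists>V\<in>B. x \<in> V \<and> V \<subseteq> U"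
    using X(2) unfolding second_countable_def by (metis (no_types, lifting))
  have sub: "B \<subseteq> Pow (space M)"
    using B(2) X(3) openin_subset by fastforce
  have "U \<in> sigma_sets (topspace X) B" if "openin X U" for U
  proof -
    have "U = \<Union>{V\<in>B. V \<subseteq> U}" using B(3)[OF that] by auto
    moreover have "countable {V\<in>B. V \<subseteq> U}" using B(1) by (rule countable_subset[rotated]) auto
    ultimately show ?thesis
      by (metis (mono_tags, lifting) mem_Collect_eq sigma_sets.Basic sigma_sets_UNION)
  qed
  then have "sigma_sets (topspace X) {U. openin X U} = sigma_sets (topspace X) B"
    using B(2) by (intro sigma_sets_eqI) auto
  then have gen: "sets M = sigma_sets (space M) B"
    using X by auto
  have haus: "Hausdorff_space X"
    using X(1) completely_metrizable_imp_metrizable_space metrizable_imp_Hausdorff_space by blast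
  have "\<exists>U\<in>B. \<exists>V\<in>B. x \<in> U \<and> y \<in> V \<and> U \<inter> V = {}"
    if xy: "x \<in> space M" "y \<in> space M" "x \<noteq> y" for x y
  proof -
    obtain U V where "openin X U" "openin X V" "x \<in> U" "y \<in> V" "disjnt U V"
      using haus xy X(3) unfolding Hausdorff_space_def by metis
    then show ?thesis
      using B(3)[of U x] B(3)[of V y] unfolding disjnt_def by blast
  qed
  with B(1) sub gen show thesis by (rule that)
qed

text \<open>Disjoint basic neighbourhoods cover the complement of the diagonal by countably many
  measurable rectangles. Equations between arrows, such as equality of targets, become measurable
  conditions in this way.\<close>

lemma standard_borel_diagonal:
  assumes "standard_borel M"
  shows "{p \<in> space (M \<Otimes>\<^sub>M M). fst p = snd p} \<in> sets (M \<Otimes>\<^sub>M M)"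
proof -
  obtain B where B: "countable B" "B \<subseteq> Pow (space M)" "sets M = sigma_sets (space M) B"
    "\<And>x y. x \<in> space M \<Longrightarrow> y \<in> space M \<Longrightarrow> x \<noteq> y \<Longrightarrow> \<exists>U\<in>B. \<exists>V\<in>B. x \<in> U \<and> y \<in> V \<and> U \<inter> V = {}"
    using standard_borel_countable_base[OF assms] by blast
  let ?I = "{(U, V) \<in> B \<times> B. U \<inter> V = {}}"
  have "p \<in> {p \<in> space (M \<Otimes>\<^sub>M M). fst p = snd p}"
    if "p \<in> space (M \<Otimes>\<^sub>M M) - (\<Union>(U, V)\<in>?I. U \<times> V)" for p
    using that B(4)[of "fst p" "snd p"] by (cases p) (auto simp: space_pair_measure)
  then have eq: "{p \<in> space (M \<Otimes>\<^sub>M M). fst p = snd p} = space (M \<Otimes>\<^sub>M M) - (\<Union>(U, V)\<in>?I. U \<times> V)"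
    by (intro equalityI subsetI) auto
  have "countable ?I"
    using B(1) by (intro countable_subset[OF _ countable_SIGMA[OF B(1), of "\<lambda>_. B"]]) auto
  moreover have "U \<in> sets M" if "U \<in> B" for U
    using that unfolding B(3) by (rule sigma_sets.Basic)
  then have "(case p of (U, V) \<Rightarrow> U \<times> V) \<in> sets (M \<Otimes>\<^sub>M M)" if "p \<in> ?I" for p
    using that by (cases p) (simp add: pair_measureI)
  ultimately have "(\<Union>(U, V)\<in>?I. U \<times> V) \<in> sets (M \<Otimes>\<^sub>M M)"
    by (intro sets.countable_UN') blast+
  then show ?thesis unfolding eq by (rule sets.compl_sets)
qed

text \<open>A countable generator closed under intersections lets finite measures be compared on
  countably many sets, so that countably many null sets suffice for a whole family of
  measures.\<close>

lemma standard_borel_countable_pi_system: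
  assumes "standard_borel M"
  obtains B where "countable B" "Int_stable B" "B \<subseteq> Pow (space M)" "space M \<in> B"
    "sets M = sigma_sets (space M) B"
proof -
  obtain B where B: "countable B" "B \<subseteq> Pow (space M)" "sets M = sigma_sets (space M) B"
    by (rule standard_borel_countable_base[OF assms])
  \<comment> \<open>The factor \<open>space M\<close> turns the intersection of the empty family
    into the whole space instead of \<open>UNIV\<close>.\<close>
  let ?C = "(\<lambda>F. space M \<inter> \<Inter>F) ` {F. finite F \<and> F \<subseteq> B}"
  have sub: "?C \<subseteq> sets M"
  proof clarify
    fix F assume F: "finite F" "F \<subseteq> B"
    have mem: "A \<in> sets M" if "A \<in> F" for A
      using that F(2) unfolding B(3) by (auto intro: sigma_sets.Basic)
    show "space M \<inter> \<Inter>F \<in> sets M"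
      using F(1) mem
    proof (induction F rule: finite_induct)
      case (insert A F)
      then have "space M \<inter> \<Inter>(insert A F) = A \<inter> (space M \<inter> \<Inter>F)" by auto
      with insert show ?case by (metis insert_iff sets.Int)
    qed simp
  qed
  show thesis
  proof (rule that)
    show "countable ?C"
      using B(1) by (intro countable_image) (simp add: countable_Collect_finite_subset)
    show "Int_stable ?C"
    proof (rule Int_stableI, clarify)
      fix F F' assume "finite F" "F \<subseteq> B" "finite F'" "F' \<subseteq> B"
      then show "space M \<inter> \<Inter>F \<inter> (space M \<inter> \<Inter>F') \<in> ?C"
        by (intro image_eqI[of _ _ "F \<union> F'"]) auto
    qed
    show "?C \<subseteq> Pow (space M)" by auto
    show "space M \<in> ?C" by (intro image_eqI[of _ _ "{}"]) auto
    have "A \<in> ?C" if "A \<in> B" for A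
      using that B(2) by (intro image_eqI[of _ _ "{A}"]) auto
    then have "sets M \<subseteq> sigma_sets (space M) ?C"
      unfolding B(3) by (intro sigma_sets_mono') auto
    moreover have "sigma_sets (space M) ?C \<subseteq> sets M"
      using sub sets.sigma_sets_subset by blast
    ultimately show "sets M = sigma_sets (space M) ?C" by (rule equalityI)
  qed
qed

text \<open>The boxes with sides in \<open>B\<close> work: they intersect coordinatewise, and every
  cylinder is a box because \<open>space M\<close> is an admissible side.\<close>

lemma countable_pi_system_PiM:
  assumes "countable B" "Int_stable B" "B \<subseteq> Pow (space M)" "space M \<in> B"
    "sets M = sigma_sets (space M) B" and I: "finite I"
  obtains C where "countable C" "Int_stable C" "C \<subseteq> Pow (space (PiM I (\<lambda>_. M)))"
    "space (PiM I (\<lambda>_. M)) \<in> C" "sets (PiM I (\<lambda>_. M)) = sigma_sets (space (PiM I (\<lambda>_. M))) C"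
proof -
  let ?C = "{Pi\<^sub>E I F | F. \<forall>i\<in>I. F i \<in> B}"
  show thesis
  proof (rule that)
    \<comment> \<open>A box depends only on the sides indexed by \<open>I\<close>, so the
      extensional choices of sides, of which there are countably many, give all boxes.\<close>
    have "?C \<subseteq> Pi\<^sub>E I ` (Pi\<^sub>E I (\<lambda>_. B))"
    proof clarify
      fix F assume "\<forall>i\<in>I. F i \<in> B"
      then show "Pi\<^sub>E I F \<in> Pi\<^sub>E I ` (Pi\<^sub>E I (\<lambda>_. B))"
        by (intro image_eqI[of _ _ "restrict F I"]) (auto cong: PiE_cong)
    qed
    then show "countable ?C"
      by (rule countable_subset) (intro countable_image countable_PiE I assms(1))
    show "Int_stable ?C"
    proof (rule Int_stableI, clarify)
      fix F F' assume "\<forall>i\<in>I. F i \<in> B" "\<forall>i\<in>I. F' i \<in> B"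
      then show "\<exists>H. Pi\<^sub>E I F \<inter> Pi\<^sub>E I F' = Pi\<^sub>E I H \<and> (\<forall>i\<in>I. H i \<in> B)"
        using assms(2) by (intro exI[of _ "\<lambda>i. F i \<inter> F' i"]) (auto simp: PiE_Int Int_stable_def)
    qed
    show sub: "?C \<subseteq> Pow (space (PiM I (\<lambda>_. M)))"
    proof clarify
      fix F x assume F: "\<forall>i\<in>I. F i \<in> B" and x: "x \<in> Pi\<^sub>E I F"
      then show "x \<in> space (PiM I (\<lambda>_. M))"
        using assms(3) unfolding space_PiM by (auto simp: PiE_iff)
    qed
    show "space (PiM I (\<lambda>_. M)) \<in> ?C"
      using assms(4) by (auto simp: space_PiM intro!: exI[of _ "\<lambda>_. space M"])
    have eq: "{{f \<in> \<Pi>\<^sub>E i\<in>I. space M. \<forall>i\<in>j. f i \<in> A i} | A j. j \<in> {I} \<and> A \<in> Pi j (\<lambda>_. B)} = ?C"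
    proof -
      have "{f \<in> \<Pi>\<^sub>E i\<in>I. space M. \<forall>i\<in>I. f i \<in> A i} = Pi\<^sub>E I A" if "A \<in> Pi I (\<lambda>_. B)" for A
      proof (intro equalityI subsetI)
        fix f assume f: "f \<in> Pi\<^sub>E I A"
        then have "f i \<in> A i \<and> A i \<subseteq> space M" if "i \<in> I" for i
          using that \<open>A \<in> Pi I (\<lambda>_. B)\<close> assms(3) by blast
        with f show "f \<in> {f \<in> \<Pi>\<^sub>E i\<in>I. space M. \<forall>i\<in>I. f i \<in> A i}"
          by (auto simp: PiE_def)
      qed (auto simp: PiE_def)
      then have *: "{f \<in> \<Pi>\<^sub>E i\<in>I. space M. \<forall>i\<in>I. f i \<in> A i} = Pi\<^sub>E I A" if "\<forall>i\<in>I. A i \<in> B" for A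
        using that by blast
      show ?thesis
      proof (intro equalityI subsetI)
        fix X assume "X \<in> {{f \<in> \<Pi>\<^sub>E i\<in>I. space M. \<forall>i\<in>j. f i \<in> A i} | A j. j \<in> {I} \<and> A \<in> Pi j (\<lambda>_. B)}"
        then obtain A where "X = {f \<in> \<Pi>\<^sub>E i\<in>I. space M. \<forall>i\<in>I. f i \<in> A i}" "\<forall>i\<in>I. A i \<in> B"
          by (auto simp: Pi_iff)
        then show "X \<in> ?C" using *[of A] by blast
      next
        fix X assume "X \<in> ?C"
        then obtain A where "X = Pi\<^sub>E I A" "\<forall>i\<in>I. A i \<in> B" by blast
        then show "X \<in> {{f \<in> \<Pi>\<^sub>E i\<in>I. space M. \<forall>i\<in>j. f i \<in> A i} | A j. j \<in> {I} \<and> A \<in> Pi j (\<lambda>_. B)}"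
          using *[of A] by (auto simp: Pi_iff intro!: exI[of _ A])
      qed
    qed
    have "sets (PiM I (\<lambda>_. M)) = sets (PiM I (\<lambda>_. sigma (space M) B))"
      using assms(3,5) by (intro sets_PiM_cong refl) (simp only: sets_measure_of)
    also have "\<dots> = sets (sigma (\<Pi>\<^sub>E i\<in>I. space M) ?C)"
    proof -
      \<comment> \<open>\<open>sets_PiM_sigma\<close> asks each factor to be a countable union of
        generators; the single set \<open>space M\<close> does it.\<close>
      have "\<exists>S\<subseteq>B. countable S \<and> space M = \<Union>S"
        using assms(4) by (intro exI[of _ "{space M}"]) auto
      then show ?thesis
        unfolding eq[symmetric] using assms(3) I by (intro sets_PiM_sigma) auto
    qed
    also have "\<dots> = sigma_sets (space (PiM I (\<lambda>_. M))) ?C"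
      using sub unfolding space_PiM by (simp only: sets_measure_of)
    finally show "sets (PiM I (\<lambda>_. M)) = sigma_sets (space (PiM I (\<lambda>_. M))) ?C" .
  qed
qed

subsection \<open>Means and their integrals over a parameter space\<close>

lemma ess_bounded_fun_add:
  assumes "f \<in> ess_bounded_fun N" "g \<in> ess_bounded_fun N"
  shows "(\<lambda>x. f x + g x) \<in> ess_bounded_fun N"
proof -
  obtain C D where b: "AE x in N. \<bar>f x\<bar> \<le> C" "AE x in N. \<bar>g x\<bar> \<le> D"
    and m: "f \<in> borel_measurable N" "g \<in> borel_measurable N"
    using assms unfolding ess_bounded_fun_def by blast
  from b have "AE x in N. \<bar>f x + g x\<bar> \<le> C + D" by eventually_elim linarith
  with m show ?thesis unfolding ess_bounded_fun_def by auto
qed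

lemma ess_bounded_fun_cmult:
  assumes "f \<in> ess_bounded_fun N"
  shows "(\<lambda>x. c * f x) \<in> ess_bounded_fun N"
proof -
  obtain C where b: "AE x in N. \<bar>f x\<bar> \<le> C" and m: "f \<in> borel_measurable N"
    using assms unfolding ess_bounded_fun_def by blast
  from b have "AE x in N. \<bar>c * f x\<bar> \<le> \<bar>c\<bar> * C"
    by eventually_elim (simp add: abs_mult mult_left_mono)
  with m show ?thesis unfolding ess_bounded_fun_def by auto
qed

lemma ess_bounded_fun_const: "(\<lambda>x. c) \<in> ess_bounded_fun N"
  unfolding ess_bounded_fun_def by auto

lemma integrable_bounded_mult:
  fixes u \<phi> :: "'a \<Rightarrow> real"
  assumes u: "u \<in> borel_measurable M" "\<And>w. \<bar>u w\<bar> \<le> c" and \<phi>: "integrable M \<phi>"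
  shows "integrable M (\<lambda>w. u w * \<phi> w)"
    and "\<bar>\<integral>w. u w * \<phi> w \<partial>M\<bar> \<le> c * (\<integral>w. \<bar>\<phi> w\<bar> \<partial>M)"
proof -
  have c: "0 \<le> c" using u(2)[of undefined] by linarith
  show int: "integrable M (\<lambda>w. u w * \<phi> w)"
  proof (rule Bochner_Integration.integrable_bound)
    show "integrable M (\<lambda>w. c * \<phi> w)" using \<phi> by simp
    show "(\<lambda>w. u w * \<phi> w) \<in> borel_measurable M"
      by (intro borel_measurable_times u borel_measurable_integrable \<phi>)
    show "AE w in M. norm (u w * \<phi> w) \<le> norm (c * \<phi> w)"
      using c by (intro AE_I2) (simp add: abs_mult u mult_right_mono)
  qed
  have "\<bar>\<integral>w. u w * \<phi> w \<partial>M\<bar> \<le> (\<integral>w. \<bar>u w * \<phi> w\<bar> \<partial>M)" by (rule integral_abs_bound)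
  also have "\<dots> \<le> (\<integral>w. c * \<bar>\<phi> w\<bar> \<partial>M)"
    using int \<phi> by (intro integral_mono integrable_abs integrable_mult_right)
      (simp_all add: abs_mult mult_right_mono u)
  finally show "\<bar>\<integral>w. u w * \<phi> w \<partial>M\<bar> \<le> c * (\<integral>w. \<bar>\<phi> w\<bar> \<partial>M)" by simp
qed

locale mean_space = prob_space N for N :: "'a measure" +
  fixes m :: "('a \<Rightarrow> real) \<Rightarrow> real"
  assumes mean: "is_mean N m"
begin

lemma mean_cong:
  assumes "f \<in> ess_bounded_fun N" "g \<in> ess_bounded_fun N" "AE x in N. f x = g x"
  shows "m f = m g"
  using mean assms unfolding is_mean_def by blast

lemma mean_add:
  assumes "f \<in> ess_bounded_fun N" "g \<in> ess_bounded_fun N"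
  shows "m (\<lambda>x. f x + g x) = m f + m g"
  using mean assms unfolding is_mean_def by blast

lemma mean_cmult:
  assumes "f \<in> ess_bounded_fun N"
  shows "m (\<lambda>x. c * f x) = c * m f"
  using mean assms unfolding is_mean_def by blast

lemma mean_const: "m (\<lambda>_. c) = c"
  using mean_cmult[OF ess_bounded_fun_const, of c 1] mean unfolding is_mean_def by simp

lemma mean_nonneg:
  assumes "f \<in> ess_bounded_fun N" "AE x in N. 0 \<le> f x"
  shows "0 \<le> m f"
  using mean assms unfolding is_mean_def by blast

text \<open>Essential boundedness is carried along because the induction step applies additivity of
  the mean to a partial sum.\<close>

lemma mean_sum:
  assumes "\<And>i. i \<in> I \<Longrightarrow> f i \<in> ess_bounded_fun N"
  shows "(\<lambda>x. \<Sum>i\<in>I. f i x) \<in> ess_bounded_fun N \<and> m (\<lambda>x. \<Sum>i\<in>I. f i x) = (\<Sum>i\<in>I. m (f i))"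
  using assms
proof (induction I rule: infinite_finite_induct)
  case (insert i I)
  then show ?case by (simp add: ess_bounded_fun_add mean_add)
qed (simp_all add: ess_bounded_fun_const mean_const)

lemma mean_diff:
  assumes "f \<in> ess_bounded_fun N" "g \<in> ess_bounded_fun N"
  shows "m (\<lambda>x. f x - g x) = m f - m g"
  using mean_add[OF assms(1) ess_bounded_fun_cmult[OF assms(2), of "-1"]]
    mean_cmult[OF assms(2), of "-1"] by simp

lemma mean_le:
  assumes "f \<in> ess_bounded_fun N" "AE x in N. f x \<le> c"
  shows "m f \<le> c"
proof -
  have "(\<lambda>x. c + (-1) * f x) \<in> ess_bounded_fun N"
    by (intro ess_bounded_fun_add ess_bounded_fun_cmult ess_bounded_fun_const assms)
  then have "0 \<le> m (\<lambda>x. c - f x)"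
    using assms(2) by (intro mean_nonneg) auto
  then show ?thesis
    by (simp add: mean_diff ess_bounded_fun_const assms mean_const)
qed

lemma mean_abs_le:
  assumes "f \<in> ess_bounded_fun N" "AE x in N. \<bar>f x\<bar> \<le> c"
  shows "\<bar>m f\<bar> \<le> c"
proof -
  have "m f \<le> c"
    using assms by (intro mean_le) auto
  moreover have "m (\<lambda>x. (-1) * f x) \<le> c"
    using assms(2) by (intro mean_le ess_bounded_fun_cmult assms(1)) auto
  ultimately show ?thesis
    using mean_cmult[OF assms(1), of "-1"] by linarith
qed

end

text \<open>The mean lives on the first variable and \<open>Q\<close> governs the remaining ones.
  The bound holds everywhere, so every section of \<open>f\<close> is bounded and not merely almost
  every one.\<close>

locale mean_product = mean_space N m + Q: prob_space Q
  for N :: "'a measure" and m and Q :: "'b measure" +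
  fixes f :: "'a \<times> 'b \<Rightarrow> real" and c :: real
  assumes f_meas [measurable]: "f \<in> borel_measurable (N \<Otimes>\<^sub>M Q)"
    and f_bound: "\<And>p. \<bar>f p\<bar> \<le> c"
begin

text \<open>For fixed \<open>\<phi>\<close> this is the function of the first variable that is
  handed to the mean. The functional \<open>\<phi> \<mapsto> m (pairing \<phi>)\<close> on L1 is the
  one whose density is sought.\<close>

definition pairing :: "('b \<Rightarrow> real) \<Rightarrow> 'a \<Rightarrow> real" where
  "pairing \<phi> h = (\<integral>w. f (h, w) * \<phi> w \<partial>Q)"

lemma c_nonneg: "0 \<le> c"
  using f_bound[of undefined] by linarith

lemma
  assumes "h \<in> space N" "integrable Q \<phi>"
  shows section_integrable: "integrable Q (\<lambda>w. f (h, w) * \<phi> w)"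
    and pairing_bound: "\<bar>pairing \<phi> h\<bar> \<le> c * (\<integral>w. \<bar>\<phi> w\<bar> \<partial>Q)"
proof -
  have "(\<lambda>w. f (h, w)) \<in> borel_measurable Q" using assms(1) by measurable
  from integrable_bounded_mult[OF this f_bound assms(2)]
  show "integrable Q (\<lambda>w. f (h, w) * \<phi> w)" "\<bar>pairing \<phi> h\<bar> \<le> c * (\<integral>w. \<bar>\<phi> w\<bar> \<partial>Q)"
    by (simp_all add: pairing_def)
qed

lemma pairing_ess_bounded:
  assumes "integrable Q \<phi>"
  shows "pairing \<phi> \<in> ess_bounded_fun N"
proof -
  have [measurable]: "\<phi> \<in> borel_measurable Q" using assms by auto
  have "(\<lambda>h. \<integral>w. f (h, w) * \<phi> w \<partial>Q) \<in> borel_measurable N"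
    by (rule Q.borel_measurable_lebesgue_integral) simp
  then show ?thesis
    using pairing_bound[OF _ assms] unfolding ess_bounded_fun_def pairing_def[abs_def] by auto
qed

text \<open>Continuity in the L1 norm: it dominates the set function by \<open>Q\<close> and allows
  passage to limits even though the mean itself does not commute with limits.\<close>

lemma mean_pairing_bound:
  assumes "integrable Q \<phi>"
  shows "\<bar>m (pairing \<phi>)\<bar> \<le> c * (\<integral>w. \<bar>\<phi> w\<bar> \<partial>Q)"
  using pairing_bound[OF _ assms] by (intro mean_abs_le pairing_ess_bounded assms) auto

lemma mean_pairing_add:
  assumes "integrable Q \<phi>" "integrable Q \<psi>"
  shows "m (pairing (\<lambda>w. \<phi> w + \<psi> w)) = m (pairing \<phi>) + m (pairing \<psi>)"
proof -
  have "m (pairing (\<lambda>w. \<phi> w + \<psi> w)) = m (\<lambda>h. pairing \<phi> h + pairing \<psi> h)"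
    using assms section_integrable
    by (intro mean_cong ess_bounded_fun_add pairing_ess_bounded) (auto simp: pairing_def distrib_left)
  then show ?thesis
    by (simp add: mean_add pairing_ess_bounded assms)
qed

lemma mean_pairing_cmult:
  assumes "integrable Q \<phi>"
  shows "m (pairing (\<lambda>w. a * \<phi> w)) = a * m (pairing \<phi>)"
proof -
  have "pairing (\<lambda>w. a * \<phi> w) = (\<lambda>h. a * pairing \<phi> h)"
    unfolding pairing_def by (simp add: mult.left_commute)
  then show ?thesis
    by (simp add: mean_cmult pairing_ess_bounded assms)
qed

lemma mean_pairing_diff:
  assumes "integrable Q \<phi>" "integrable Q \<psi>"
  shows "m (pairing (\<lambda>w. \<phi> w - \<psi> w)) = m (pairing \<phi>) - m (pairing \<psi>)"
  using mean_pairing_add[OF assms(1), of "\<lambda>w. (-1) * \<psi> w"] mean_pairing_cmult[OF assms(2), of "-1"]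
    assms by simp

text \<open>Both sides are linear and L1-continuous in \<open>\<phi>\<close>, so agreement on
  indicators extends first to simple functions and then to their limits.\<close>

lemma mean_pairing_L1:
  assumes H [measurable]: "H \<in> borel_measurable Q" and H_bound: "\<And>w. \<bar>H w\<bar> \<le> d"
    and eq: "\<And>A. A \<in> sets Q \<Longrightarrow> m (pairing (indicator A)) = (\<integral>w. H w * indicator A w \<partial>Q)"
    and \<phi>: "integrable Q \<phi>"
  shows "m (pairing \<phi>) = (\<integral>w. H w * \<phi> w \<partial>Q)"
proof -
  note int = integrable_bounded_mult[OF H H_bound]
  show ?thesis
    using \<phi>
  proof (induction rule: integrable_induct)
    case (base A a)
    then have "m (pairing (\<lambda>w. a * indicator A w)) = a * (\<integral>w. H w * indicator A w \<partial>Q)"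
      by (subst mean_pairing_cmult) (auto simp: eq)
    then show ?case by (simp add: mult.commute mult.left_commute)
  next
    case (add \<phi> \<psi>)
    then show ?case by (simp add: mean_pairing_add int(1) distrib_left)
  next
    case (lim \<phi> s)
    have int_s: "integrable Q (s i)" for i by (rule lim)
    have [measurable]: "\<phi> \<in> borel_measurable Q" "s i \<in> borel_measurable Q" for i
      using lim(1) lim(4) by auto
    have conv: "(\<lambda>i. \<integral>w. \<bar>s i w - \<phi> w\<bar> \<partial>Q) \<longlonglongrightarrow> (\<integral>w. 0 \<partial>Q)"
    proof (rule integral_dominated_convergence)
      \<comment> \<open>The approximants of \<open>integrable_induct\<close> satisfy
        \<open>\<bar>s i w\<bar> \<le> 2 * \<bar>\<phi> w\<bar>\<close>, and subtracting
        \<open>\<phi>\<close> adds one more multiple.\<close>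
      show "integrable Q (\<lambda>w. 3 * \<bar>\<phi> w\<bar>)" using lim by simp
      show "AE w in Q. (\<lambda>i. \<bar>s i w - \<phi> w\<bar>) \<longlonglongrightarrow> 0"
      proof (rule AE_I2)
        fix w assume "w \<in> space Q"
        then have "(\<lambda>i. s i w - \<phi> w) \<longlonglongrightarrow> 0" using lim(2) LIM_zero by blast
        then show "(\<lambda>i. \<bar>s i w - \<phi> w\<bar>) \<longlonglongrightarrow> 0" by (rule tendsto_rabs_zero)
      qed
      show "AE w in Q. norm \<bar>s i w - \<phi> w\<bar> \<le> 3 * \<bar>\<phi> w\<bar>" for i
        using lim(3) by (intro AE_I2) (smt (verit) real_norm_def)
    qed measurable
    have approx: "\<bar>T (s i) - T \<phi>\<bar> \<le> k * (\<integral>w. \<bar>s i w - \<phi> w\<bar> \<partial>Q)"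
      if "\<And>\<psi>. integrable Q \<psi> \<Longrightarrow> \<bar>T \<psi>\<bar> \<le> k * (\<integral>w. \<bar>\<psi> w\<bar> \<partial>Q)"
        "\<And>\<psi> \<psi>'. integrable Q \<psi> \<Longrightarrow> integrable Q \<psi>' \<Longrightarrow> T (\<lambda>w. \<psi> w - \<psi>' w) = T \<psi> - T \<psi>'"
      for T k i
      using that(1)[of "\<lambda>w. s i w - \<phi> w"] that(2)[of "s i" \<phi>] int_s[of i] lim(4) by simp
    \<comment> \<open>\<open>T\<close> is used for both functionals, the one given by the mean and
      the one given by integration against \<open>H\<close>.\<close>
    have tendsto: "(\<lambda>i. T (s i)) \<longlonglongrightarrow> T \<phi>"
      if "\<And>\<psi>. integrable Q \<psi> \<Longrightarrow> \<bar>T \<psi>\<bar> \<le> k * (\<integral>w. \<bar>\<psi> w\<bar> \<partial>Q)"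
        "\<And>\<psi> \<psi>'. integrable Q \<psi> \<Longrightarrow> integrable Q \<psi>' \<Longrightarrow> T (\<lambda>w. \<psi> w - \<psi>' w) = T \<psi> - T \<psi>'"
      for T k
    proof (rule LIM_zero_cancel, rule Lim_null_comparison)
      show "\<forall>\<^sub>F i in sequentially. norm (T (s i) - T \<phi>) \<le> k * (\<integral>w. \<bar>s i w - \<phi> w\<bar> \<partial>Q)"
        using approx[of T k] that by (intro always_eventually) simp
      show "(\<lambda>i. k * (\<integral>w. \<bar>s i w - \<phi> w\<bar> \<partial>Q)) \<longlonglongrightarrow> 0"
        using tendsto_mult_left[OF conv, of k] by simp
    qed
    have "(\<lambda>i. \<integral>w. H w * s i w \<partial>Q) \<longlonglongrightarrow> (\<integral>w. H w * \<phi> w \<partial>Q)"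
      by (intro tendsto[of "\<lambda>\<psi>. \<integral>w. H w * \<psi> w \<partial>Q" d] int(2)) (simp_all add: right_diff_distrib int(1))
    moreover have "(\<lambda>i. m (pairing (s i))) \<longlonglongrightarrow> m (pairing \<phi>)"
      by (intro tendsto[of "\<lambda>\<psi>. m (pairing \<psi>)" c] mean_pairing_bound mean_pairing_diff)
    ultimately show ?case
      using lim(5) LIMSEQ_unique by simp
  qed
qed

text \<open>The range 0 to 1 makes the set function positive and bounded by \<open>Q\<close>; finite
  additivity comes from the mean, continuity at the empty set from \<open>Q\<close>.\<close>

lemma kernel_measure:
  assumes f01: "\<And>p. 0 \<le> f p" and c1: "c = 1"
  obtains \<kappa> where "sets \<kappa> = sets Q"
    "\<And>A. A \<in> sets Q \<Longrightarrow> emeasure \<kappa> A = ennreal (m (pairing (indicator A)))"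
    "\<And>A. A \<in> sets Q \<Longrightarrow> emeasure \<kappa> A \<le> emeasure Q A"
proof -
  let ?K = "\<lambda>A. m (pairing (indicator A))"
  have ind: "integrable Q (indicator A :: 'b \<Rightarrow> real)" if "A \<in> sets Q" for A
    using that by (simp add: Q.emeasure_eq_measure)
  have nonneg: "0 \<le> ?K A" if "A \<in> sets Q" for A
    using f01 by (intro mean_nonneg pairing_ess_bounded ind that) (auto simp: pairing_def)
  have le: "?K A \<le> measure Q A" if "A \<in> sets Q" for A
  proof -
    have "?K A \<le> \<bar>?K A\<bar>" by simp
    also have "\<dots> \<le> c * (\<integral>w. \<bar>indicator A w\<bar> \<partial>Q)" by (intro mean_pairing_bound ind that)
    also have "\<dots> = measure Q A" using that c1 by simp
    finally show ?thesis .
  qed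
  have add: "?K (A \<union> B) = ?K A + ?K B" if "A \<in> sets Q" "B \<in> sets Q" "A \<inter> B = {}" for A B
  proof -
    have "(indicator (A \<union> B) :: 'b \<Rightarrow> real) = (\<lambda>w. indicator A w + indicator B w)"
      using that(3) by (auto simp: indicator_def fun_eq_iff)
    then show ?thesis by (simp add: mean_pairing_add ind that)
  qed
  have "pairing (\<lambda>_. 0) = (\<lambda>_. 0)" by (auto simp: pairing_def)
  moreover have "(indicator {} :: 'b \<Rightarrow> real) = (\<lambda>_. 0)" by (simp add: fun_eq_iff)
  ultimately have empty: "?K {} = 0" by (simp add: mean_const)
  have ca: "countably_additive (sets Q) (\<lambda>A. ennreal (?K A))"
  \<comment> \<open>For a decreasing sequence with empty intersection the values are squeezed
    between 0 and the \<open>Q\<close>-measures, which tend to 0.\<close>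
  proof (rule sets.empty_continuous_imp_countably_additive)
    show "positive (sets Q) (\<lambda>A. ennreal (?K A))" by (simp add: positive_def empty)
    show "additive (sets Q) (\<lambda>A. ennreal (?K A))"
      by (auto simp: additive_def add nonneg ennreal_plus)
    fix A :: "nat \<Rightarrow> 'b set" assume A: "range A \<subseteq> sets Q" "decseq A" "(\<Inter>i. A i) = {}"
    have "(\<lambda>i. emeasure Q (A i)) \<longlonglongrightarrow> emeasure Q (\<Inter>i. A i)"
      using A by (intro Lim_emeasure_decseq) auto
    then have "(\<lambda>i. emeasure Q (A i)) \<longlonglongrightarrow> 0" using A by simp
    then show "(\<lambda>i. ennreal (?K (A i))) \<longlonglongrightarrow> 0"
    proof (rule tendsto_sandwich[OF _ _ tendsto_const, rotated 2])
      show "\<forall>\<^sub>F i in sequentially. ennreal (?K (A i)) \<le> emeasure Q (A i)"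
        using A by (intro always_eventually) (auto simp: Q.emeasure_eq_measure intro!: ennreal_leI le)
    qed auto
  qed auto
  define \<kappa> where "\<kappa> = measure_of (space Q) (sets Q) (\<lambda>A. ennreal (?K A))"
  have em: "emeasure \<kappa> A = ennreal (?K A)" if "A \<in> sets Q" for A
    unfolding \<kappa>_def
    by (rule emeasure_measure_of_sigma[OF _ _ ca that])
      (auto simp: positive_def empty sets.sigma_algebra_axioms)
  show thesis
  proof (rule that)
    show "sets \<kappa> = sets Q" unfolding \<kappa>_def by simp
    show "emeasure \<kappa> A \<le> emeasure Q A" if "A \<in> sets Q" for A
      using le[OF that] by (simp add: em that Q.emeasure_eq_measure ennreal_leI)
  qed (rule em)
qed

end

subsection \<open>Radon--Nikodym theorem for kernels\<close>

text \<open>Joint measurability of the densities comes from comparing the two measures that the kernels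
  induce on the product space; the countable generator \<open>C\<close> makes the exceptional null set uniform.\<close>

lemma kernel_Radon_Nikodym:
  assumes fin: "finite_measure M"
    and Q [measurable]: "Q \<in> M \<rightarrow>\<^sub>M subprob_algebra N"
    and K [measurable]: "K \<in> M \<rightarrow>\<^sub>M subprob_algebra N"
    and le: "\<And>x A. x \<in> space M \<Longrightarrow> A \<in> sets N \<Longrightarrow> emeasure (K x) A \<le> emeasure (Q x) A"
    and C: "countable C" "Int_stable C" "C \<subseteq> Pow (space N)" "space N \<in> C"
      "sets N = sigma_sets (space N) C"
  obtains H :: "'a \<times> 'b \<Rightarrow> ennreal" where "H \<in> borel_measurable (M \<Otimes>\<^sub>M N)"
    "AE x in M. K x = density (Q x) (\<lambda>w. H (x, w))"
\<comment> \<open>The sigma-algebra of a \<open>bind\<close> is known only over a nonempty space, so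
  the empty case is set apart.\<close>
proof (cases "space M = {}")
  case True
  then show thesis
    by (intro that[of "\<lambda>_. 0"]) (auto intro!: AE_I2)
next
  case False
  interpret M: finite_measure M by (rule fin)
  define lift where "lift R = M \<bind> (\<lambda>x. distr (R x) (M \<Otimes>\<^sub>M N) (Pair x))" for R :: "'a \<Rightarrow> 'b measure"
  have lift_kernel: "(\<lambda>x. distr (R x) (M \<Otimes>\<^sub>M N) (Pair x)) \<in> M \<rightarrow>\<^sub>M subprob_algebra (M \<Otimes>\<^sub>M N)"
    if "R \<in> M \<rightarrow>\<^sub>M subprob_algebra N" for R
    using that by (intro measurable_distr2) simp_all
  have sets_lift: "sets (lift R) = sets (M \<Otimes>\<^sub>M N)" if "R \<in> M \<rightarrow>\<^sub>M subprob_algebra N" for R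
    unfolding lift_def by (rule sets_bind[OF sets_kernel[OF lift_kernel[OF that]] False])
  have sets_R: "sets (R x) = sets N" "space (R x) = space N"
    if "R \<in> M \<rightarrow>\<^sub>M subprob_algebra N" "x \<in> space M" for R x
    using sets_kernel[OF that] sets_eq_imp_space_eq by auto
  have nn_lift: "(\<integral>\<^sup>+p. f p \<partial>lift R) = (\<integral>\<^sup>+x. \<integral>\<^sup>+w. f (x, w) \<partial>R x \<partial>M)"
    if R: "R \<in> M \<rightarrow>\<^sub>M subprob_algebra N" and f: "f \<in> borel_measurable (M \<Otimes>\<^sub>M N)" for R f
  proof -
    have "(\<integral>\<^sup>+p. f p \<partial>lift R) = (\<integral>\<^sup>+x. \<integral>\<^sup>+p. f p \<partial>distr (R x) (M \<Otimes>\<^sub>M N) (Pair x) \<partial>M)"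
      unfolding lift_def by (rule nn_integral_bind[OF f lift_kernel[OF R]])
    also have "\<dots> = (\<integral>\<^sup>+x. \<integral>\<^sup>+w. f (x, w) \<partial>R x \<partial>M)"
    proof (rule nn_integral_cong)
      fix x assume x: "x \<in> space M"
      have "Pair x \<in> R x \<rightarrow>\<^sub>M M \<Otimes>\<^sub>M N"
        unfolding measurable_cong_sets[OF sets_R(1)[OF R x] refl] using x by (rule measurable_Pair1')
      then show "(\<integral>\<^sup>+p. f p \<partial>distr (R x) (M \<Otimes>\<^sub>M N) (Pair x)) = (\<integral>\<^sup>+w. f (x, w) \<partial>R x)"
        using f by (simp add: nn_integral_distr)
    qed
    finally show ?thesis .
  qed
  have em_lift: "emeasure (lift R) S = (\<integral>\<^sup>+x. \<integral>\<^sup>+w. indicator S (x, w) \<partial>R x \<partial>M)"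
    if R: "R \<in> M \<rightarrow>\<^sub>M subprob_algebra N" and S: "S \<in> sets (M \<Otimes>\<^sub>M N)" for R S
    using nn_lift[OF R, of "indicator S"] S sets_lift[OF R] by simp
  have lift_le: "emeasure (lift K) S \<le> emeasure (lift Q) S" if S: "S \<in> sets (M \<Otimes>\<^sub>M N)" for S
  proof -
    have "(\<integral>\<^sup>+w. indicator S (x, w) \<partial>K x) \<le> (\<integral>\<^sup>+w. indicator S (x, w) \<partial>Q x)" if x: "x \<in> space M" for x
    proof -
      have A: "Pair x -` S \<in> sets N" using S by (rule sets_Pair1)
      have "(\<lambda>w. indicator S (x, w)) = (indicator (Pair x -` S) :: 'b \<Rightarrow> ennreal)"
        by (auto simp: indicator_def)
      then show ?thesis using le[OF x A] A sets_R[OF K x] sets_R[OF Q x] by simp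
    qed
    then show ?thesis by (simp add: em_lift K Q S nn_integral_mono)
  qed
  have fin_lift: "finite_measure (lift Q)"
  proof
    have "emeasure (lift Q) (space (lift Q)) \<le> (\<integral>\<^sup>+x. 1 \<partial>M)"
    proof -
      have "(\<integral>\<^sup>+w. indicator (space (lift Q)) (x, w) \<partial>Q x) \<le> 1" if x: "x \<in> space M" for x
      proof -
        have "(\<integral>\<^sup>+w. indicator (space (lift Q)) (x, w) \<partial>Q x) \<le> (\<integral>\<^sup>+w. 1 \<partial>Q x)"
          by (intro nn_integral_mono) (auto simp: indicator_def)
        also have "\<dots> \<le> 1"
          using subprob_space.emeasure_space_le_1[OF subprob_space_kernel[OF Q x]] by simp
        finally show ?thesis .
      qed
      then show ?thesis
        using sets.top[of "lift Q"] by (simp only: em_lift[OF Q] sets_lift[OF Q]) (rule nn_integral_mono)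
    qed
    then show "emeasure (lift Q) (space (lift Q)) \<noteq> \<infinity>"
      using M.emeasure_finite[of "space M"] by (auto simp: top_unique)
  qed
  interpret P: finite_measure "lift Q" by (rule fin_lift)
  have "absolutely_continuous (lift Q) (lift K)"
    unfolding absolutely_continuous_def
  proof
    fix S assume "S \<in> null_sets (lift Q)"
    then show "S \<in> null_sets (lift K)"
      using lift_le[of S] sets_lift[OF Q] sets_lift[OF K] by (auto simp: null_sets_def)
  qed
  then obtain H where "H \<in> borel_measurable (lift Q)" and dens: "density (lift Q) H = lift K"
    using P.Radon_Nikodym[of "lift K"] sets_lift[OF Q] sets_lift[OF K] by auto
  then have H [measurable]: "H \<in> borel_measurable (M \<Otimes>\<^sub>M N)"
    using measurable_cong_sets[OF sets_lift[OF Q] refl] by blast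
  \<comment> \<open>For fixed \<open>A\<close> both functions of \<open>x\<close> have the same
    integral over every measurable \<open>B\<close>, as one sees by evaluating the two joint
    measures on the rectangle \<open>B \<times> A\<close>.\<close>
  have ae: "AE x in M. emeasure (K x) A = (\<integral>\<^sup>+w. H (x, w) * indicator A w \<partial>Q x)" if "A \<in> sets N" for A
  proof (rule M.density_unique2)
    note that [measurable]
    show "(\<lambda>x. emeasure (K x) A) \<in> borel_measurable M"
      by (rule measurable_emeasure_kernel[OF K that])
    show "(\<lambda>x. \<integral>\<^sup>+w. H (x, w) * indicator A w \<partial>Q x) \<in> borel_measurable M"
      by (rule nn_integral_measurable_subprob_algebra2[OF _ Q]) measurable
    fix B assume B: "B \<in> sets M"
    note B [measurable]
    have BA: "B \<times> A \<in> sets (M \<Otimes>\<^sub>M N)" by measurable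
    have "(\<integral>\<^sup>+x\<in>B. emeasure (K x) A \<partial>M) = emeasure (lift K) (B \<times> A)"
    proof -
      have "(\<integral>\<^sup>+w. indicator (B \<times> A) (x, w) \<partial>K x) = emeasure (K x) A * indicator B x"
        if x: "x \<in> space M" for x
        using \<open>A \<in> sets N\<close> sets_R[OF K x] by (cases "x \<in> B") (auto simp: indicator_times)
      then show ?thesis by (simp add: em_lift[OF K BA] cong: nn_integral_cong)
    qed
    also have "\<dots> = (\<integral>\<^sup>+p. H p * indicator (B \<times> A) p \<partial>lift Q)"
      using BA sets_lift[OF Q] H \<open>H \<in> borel_measurable (lift Q)\<close> by (subst dens[symmetric]) (simp add: emeasure_density)
    also have "\<dots> = (\<integral>\<^sup>+x. \<integral>\<^sup>+w. H (x, w) * indicator (B \<times> A) (x, w) \<partial>Q x \<partial>M)"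
      by (rule nn_lift[OF Q]) (use BA in measurable)
    also have "\<dots> = (\<integral>\<^sup>+x\<in>B. (\<integral>\<^sup>+w. H (x, w) * indicator A w \<partial>Q x) \<partial>M)"
      by (intro nn_integral_cong) (auto simp: indicator_def)
    finally show "(\<integral>\<^sup>+x\<in>B. emeasure (K x) A \<partial>M) = (\<integral>\<^sup>+x\<in>B. (\<integral>\<^sup>+w. H (x, w) * indicator A w \<partial>Q x) \<partial>M)" .
  qed
  have C_sets: "A \<in> sets N" if "A \<in> C" for A
    using that unfolding C(5) by (rule sigma_sets.Basic)
  have "AE x in M. \<forall>A\<in>C. emeasure (K x) A = (\<integral>\<^sup>+w. H (x, w) * indicator A w \<partial>Q x)"
    by (subst AE_ball_countable[OF C(1)]) (simp add: ae C_sets)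
  then have "AE x in M. K x = density (Q x) (\<lambda>w. H (x, w))"
  proof (rule AE_mp, intro AE_I2 impI)
    fix x assume x: "x \<in> space M"
      and eq: "\<forall>A\<in>C. emeasure (K x) A = (\<integral>\<^sup>+w. H (x, w) * indicator A w \<partial>Q x)"
    have Hx: "(\<lambda>w. H (x, w)) \<in> borel_measurable (Q x)"
      unfolding measurable_cong_sets[OF sets_R(1)[OF Q x] refl] using x by measurable
    show "K x = density (Q x) (\<lambda>w. H (x, w))"
    \<comment> \<open>The kernels are finite and \<open>space N\<close> belongs to the generator, so
      a constant sequence exhausts the space.\<close>
    proof (rule measure_eqI_generator_eq[where E=C and \<Omega>="space N" and A="\<lambda>_. space N"])
      show "emeasure (K x) A = emeasure (density (Q x) (\<lambda>w. H (x, w))) A" if "A \<in> C" for A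
        using eq that C_sets[OF that] Hx sets_R[OF Q x] by (simp add: emeasure_density)
      show "emeasure (K x) (space N) \<noteq> \<infinity>"
        using subprob_space.emeasure_space_le_1[OF subprob_space_kernel[OF K x]] sets_R[OF K x]
        by (auto simp: top_unique)
    qed (use C sets_R[OF K x] sets_R[OF Q x] in auto)
  qed
  with H show thesis by (rule that)
qed

subsection \<open>Dual-valued functions\<close>

lemma countable_dense_subset:
  obtains D :: "'v::{metric_space, second_countable_topology} set"
  where "countable D" "closure D = UNIV"
proof -
  obtain D :: "'v set" where D: "countable D" "\<And>U. open U \<Longrightarrow> U \<noteq> {} \<Longrightarrow> \<exists>d\<in>D. d \<in> U"
    using countable_dense_exists by blast
  have "x \<in> closure D" for x
    using D(2)[of "ball x e" for e] unfolding closure_approachable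
    by (metis centre_in_ball dist_commute empty_iff mem_ball open_ball)
  then show thesis using D(1) that by blast
qed

lemma pred_Ball_countable:
  assumes "countable X" "\<And>i. i \<in> X \<Longrightarrow> Measurable.pred M (P i)"
  shows "Measurable.pred M (\<lambda>x. \<forall>i\<in>X. P i x)"
proof (cases "X = {}")
  case False
  have "{x \<in> space M. \<forall>i\<in>X. P i x} = (\<Inter>i\<in>X. {x \<in> space M. P i x})"
    using False by auto
  moreover have "(\<Inter>i\<in>X. {x \<in> space M. P i x}) \<in> sets M"
    using assms False by (intro sets.countable_INT') (auto simp: pred_def)
  ultimately show ?thesis unfolding pred_def by simp
qed simp

lemma abs_blinfun_apply_le:
  fixes F :: "'v::real_normed_vector \<Rightarrow>\<^sub>L real"
  shows "norm F \<le> C \<Longrightarrow> \<bar>F v\<bar> \<le> C * norm v"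
  using norm_blinfun[of F v] by (metis mult_right_mono norm_ge_zero order_trans real_norm_def)

lemma blinfun_le_dense:
  fixes F :: "'v::real_normed_vector \<Rightarrow>\<^sub>L real"
  assumes "closure D = UNIV" "\<And>d. d \<in> D \<Longrightarrow> \<bar>F d\<bar> \<le> C * norm d" "0 \<le> C"
  shows "norm F \<le> C"
proof (rule norm_blinfun_bound[OF assms(3)])
  fix v
  obtain s where s: "\<And>n. s n \<in> D" "s \<longlonglongrightarrow> v"
    using assms(1) closure_sequential[of v D] by auto
  have "(\<lambda>n. \<bar>F (s n)\<bar>) \<longlonglongrightarrow> \<bar>F v\<bar>" "(\<lambda>n. C * norm (s n)) \<longlonglongrightarrow> C * norm v"
    by (intro tendsto_intros s)+
  then show "norm (F v) \<le> C * norm v"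
    using s(1) assms(2) by (simp add: LIMSEQ_le)
qed

lemma blinfun_eq_dense:
  fixes F G :: "'v::real_normed_vector \<Rightarrow>\<^sub>L real"
  assumes "closure D = UNIV" "\<And>d. d \<in> D \<Longrightarrow> F d = G d"
  shows "F = G"
proof -
  have "norm (F - G) \<le> 0"
    using assms(2) by (intro blinfun_le_dense[OF assms(1)]) (simp_all add: minus_blinfun.rep_eq)
  then show ?thesis by simp
qed

text \<open>\<open>D\<close> is only a dense set, not a subspace, so linearity cannot be stated on
  it. The three-vector inequality says instead that \<open>u\<close> is linear up to an error
  controlled by the distance of a combination from \<open>D\<close>; it contains the Lipschitz bound
  as well. Rational coefficients keep the condition countable.\<close>

lemma dense_functional_extension:
  fixes u :: "'v::real_normed_vector \<Rightarrow> real"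
  assumes D: "closure D = UNIV" and C: "0 \<le> C"
    and bd: "\<And>a b v1 v2 v3. a \<in> \<rat> \<Longrightarrow> b \<in> \<rat> \<Longrightarrow> v1 \<in> D \<Longrightarrow> v2 \<in> D \<Longrightarrow> v3 \<in> D \<Longrightarrow>
      \<bar>a * u v1 + b * u v2 - u v3\<bar> \<le> C * norm (a *\<^sub>R v1 + b *\<^sub>R v2 - v3)"
  obtains F :: "'v \<Rightarrow>\<^sub>L real" where "\<And>d. d \<in> D \<Longrightarrow> F d = u d" "norm F \<le> C"
proof -
  have "\<exists>s. (\<forall>n. s n \<in> D) \<and> s \<longlonglongrightarrow> v" for v
    using D closure_sequential[of v D] by auto
  then obtain s where s: "\<And>v n. s v n \<in> D" "\<And>v. s v \<longlonglongrightarrow> v"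
    by metis
  have lip: "\<bar>u v - u v'\<bar> \<le> C * norm (v - v')" if "v \<in> D" "v' \<in> D" for v v'
    using bd[of 1 0 v v v'] that by simp
  have "convergent (\<lambda>n. u (s v n))" for v
  proof (rule real_Cauchy_convergent, rule metric_CauchyI)
    fix e :: real assume e: "0 < e"
    have "Cauchy (s v)" using s(2) by (rule LIMSEQ_imp_Cauchy)
    \<comment> \<open>Dividing by \<open>C + 1\<close> rather than by \<open>C\<close> covers the
      case \<open>C = 0\<close>.\<close>
    then obtain N where N: "\<And>i j. i \<ge> N \<Longrightarrow> j \<ge> N \<Longrightarrow> dist (s v i) (s v j) < e / (C + 1)"
      using metric_CauchyD[of "s v" "e / (C + 1)"] e C by auto
    have "dist (u (s v i)) (u (s v j)) < e" if "i \<ge> N" "j \<ge> N" for i j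
    proof -
      have "dist (u (s v i)) (u (s v j)) \<le> C * dist (s v i) (s v j)"
        using lip s(1) by (simp add: dist_norm)
      also have "\<dots> \<le> (C + 1) * dist (s v i) (s v j)" by (intro mult_right_mono) auto
      also have "\<dots> < e" using N[OF that] C by (simp add: field_simps)
      finally show ?thesis .
    qed
    then show "\<exists>N. \<forall>i\<ge>N. \<forall>j\<ge>N. dist (u (s v i)) (u (s v j)) < e" by blast
  qed
  then obtain g where g: "\<And>v. (\<lambda>n. u (s v n)) \<longlonglongrightarrow> g v"
    unfolding convergent_def by metis
  have g_rat: "\<bar>a * g v1 + b * g v2 - g v3\<bar> \<le> C * norm (a *\<^sub>R v1 + b *\<^sub>R v2 - v3)"
    if "a \<in> \<rat>" "b \<in> \<rat>" for a b v1 v2 v3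
  proof (rule LIMSEQ_le)
    show "(\<lambda>n. \<bar>a * u (s v1 n) + b * u (s v2 n) - u (s v3 n)\<bar>) \<longlonglongrightarrow> \<bar>a * g v1 + b * g v2 - g v3\<bar>"
      by (intro tendsto_intros g)
    show "(\<lambda>n. C * norm (a *\<^sub>R s v1 n + b *\<^sub>R s v2 n - s v3 n)) \<longlonglongrightarrow> C * norm (a *\<^sub>R v1 + b *\<^sub>R v2 - v3)"
      by (intro tendsto_intros s)
  qed (use bd that s(1) in auto)
  \<comment> \<open>The vectors were freed from \<open>D\<close> by the first limit; a second limit
    frees the coefficients from the rationals.\<close>
  have g_real: "\<bar>a * g v1 + b * g v2 - g v3\<bar> \<le> C * norm (a *\<^sub>R v1 + b *\<^sub>R v2 - v3)" for a b v1 v2 v3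
  proof -
    obtain p q where p: "\<And>n. p n \<in> \<rat>" "p \<longlonglongrightarrow> a" and q: "\<And>n. q n \<in> \<rat>" "q \<longlonglongrightarrow> b"
      using closure_sequential[of a \<rat>] closure_sequential[of b \<rat>] Rats_closure_real by auto
    show ?thesis
    proof (rule LIMSEQ_le)
      show "(\<lambda>n. \<bar>p n * g v1 + q n * g v2 - g v3\<bar>) \<longlonglongrightarrow> \<bar>a * g v1 + b * g v2 - g v3\<bar>"
        by (intro tendsto_intros p q)
      show "(\<lambda>n. C * norm (p n *\<^sub>R v1 + q n *\<^sub>R v2 - v3)) \<longlonglongrightarrow> C * norm (a *\<^sub>R v1 + b *\<^sub>R v2 - v3)"
        by (intro tendsto_intros p q)
    qed (use g_rat p q in auto)
  qed
  \<comment> \<open>Taking the combination itself as third vector makes the right-hand side zero,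
    which is exact linearity.\<close>
  have g_lin: "g (a *\<^sub>R v1 + b *\<^sub>R v2) = a * g v1 + b * g v2" for a b v1 v2
    using g_real[of a v1 b v2 "a *\<^sub>R v1 + b *\<^sub>R v2"] by simp
  have g_bound: "\<bar>g v\<bar> \<le> C * norm v" for v
    using g_real[of 0 v 0 v v] by simp
  have "bounded_linear g"
    using g_lin[of 1 _ 1] g_lin[of _ _ 0] g_bound
    by (intro bounded_linear_intro[of g C]) (auto simp: mult.commute)
  then have F: "blinfun_apply (Blinfun g) = g" by (rule bounded_linear_Blinfun_apply)
  show thesis
  proof (rule that)
    fix d assume d: "d \<in> D"
    have "(\<lambda>n. u (s d n)) \<longlonglongrightarrow> u d"
    proof (rule LIM_zero_cancel, rule Lim_null_comparison)
      show "\<forall>\<^sub>F n in sequentially. norm (u (s d n) - u d) \<le> C * norm (s d n - d)"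
        using lip s(1) d by (intro always_eventually) simp
      show "(\<lambda>n. C * norm (s d n - d)) \<longlonglongrightarrow> 0"
        by (intro tendsto_mult_right_zero tendsto_norm_zero LIM_zero s)
    qed
    then show "Blinfun g d = u d"
      unfolding F using g LIMSEQ_unique by blast
  next
    show "norm (Blinfun g) \<le> C"
      using C g_bound by (intro norm_blinfun_bound) (simp_all add: F)
  qed
qed

text \<open>The points where the countably many inequalities hold form a measurable set, and there
  the values \<open>U d w\<close> extend to a functional. Elsewhere any measurable bounded default
  will do.\<close>

lemma dual_valued_selection:
  fixes U :: "'v::{real_normed_vector, second_countable_topology} \<Rightarrow> 'w \<Rightarrow> real"
  assumes D: "countable D" "closure D = UNIV" and C: "0 \<le> C"
    and U: "\<And>d. d \<in> D \<Longrightarrow> U d \<in> borel_measurable N"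
  obtains h :: "'w \<Rightarrow> 'v \<Rightarrow>\<^sub>L real" where "\<And>v. (\<lambda>w. h w v) \<in> borel_measurable N" "\<And>w. norm (h w) \<le> C"
    "\<And>w. \<forall>a\<in>\<rat>. \<forall>b\<in>\<rat>. \<forall>v1\<in>D. \<forall>v2\<in>D. \<forall>v3\<in>D.
      \<bar>a * U v1 w + b * U v2 w - U v3 w\<bar> \<le> C * norm (a *\<^sub>R v1 + b *\<^sub>R v2 - v3) \<Longrightarrow>
      \<forall>d\<in>D. h w d = U d w"
proof -
  define good where "good w \<longleftrightarrow> (\<forall>a\<in>\<rat>. \<forall>b\<in>\<rat>. \<forall>v1\<in>D. \<forall>v2\<in>D. \<forall>v3\<in>D.
    \<bar>a * U v1 w + b * U v2 w - U v3 w\<bar> \<le> C * norm (a *\<^sub>R v1 + b *\<^sub>R v2 - v3))" for w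
  have good_meas [measurable]: "Measurable.pred N good"
    unfolding good_def
    by (intro pred_Ball_countable D countable_rat) (use U in measurable)
  have "\<exists>F :: 'v \<Rightarrow>\<^sub>L real. norm F \<le> C \<and> (good w \<longrightarrow> (\<forall>d\<in>D. blinfun_apply F d = U d w))" for w
  proof (cases "good w")
    case True
    have "\<bar>a * U v1 w + b * U v2 w - U v3 w\<bar> \<le> C * norm (a *\<^sub>R v1 + b *\<^sub>R v2 - v3)"
      if "a \<in> \<rat>" "b \<in> \<rat>" "v1 \<in> D" "v2 \<in> D" "v3 \<in> D" for a b v1 v2 v3
      using True that by (simp add: good_def)
    then obtain F :: "'v \<Rightarrow>\<^sub>L real" where "\<And>d. d \<in> D \<Longrightarrow> F d = U d w" "norm F \<le> C"
      by (rule dense_functional_extension[OF D(2) C, of "\<lambda>v. U v w"]) metis+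
    then show ?thesis by metis
  qed (use C in \<open>auto intro: exI[of _ 0]\<close>)
  then obtain h0 :: "'w \<Rightarrow> 'v \<Rightarrow>\<^sub>L real" where h0: "\<And>w. norm (h0 w) \<le> C" "\<And>w d. good w \<Longrightarrow> d \<in> D \<Longrightarrow> h0 w d = U d w"
    by metis
  \<comment> \<open>\<open>h0\<close> comes from a bare choice. On the good set its values are
    forced by \<open>U\<close> and a limit; off it they are replaced by 0, which restores
    measurability and keeps the bound.\<close>
  define h where "h w = (if good w then h0 w else 0)" for w
  show thesis
  proof (rule that)
    show "norm (h w) \<le> C" for w using h0(1) C by (simp add: h_def)
    show "\<forall>d\<in>D. h w d = U d w"
      if "\<forall>a\<in>\<rat>. \<forall>b\<in>\<rat>. \<forall>v1\<in>D. \<forall>v2\<in>D. \<forall>v3\<in>D.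
        \<bar>a * U v1 w + b * U v2 w - U v3 w\<bar> \<le> C * norm (a *\<^sub>R v1 + b *\<^sub>R v2 - v3)" for w
      using h0(2) that by (simp add: h_def good_def)
    fix v
    obtain s where s: "\<And>n. s n \<in> D" "s \<longlonglongrightarrow> v"
      using D(2) closure_sequential[of v D] by auto
    show "(\<lambda>w. h w v) \<in> borel_measurable N"
    proof (rule borel_measurable_LIMSEQ_real)
      show "(\<lambda>w. if good w then U (s n) w else 0) \<in> borel_measurable N" for n
        using U[OF s(1)[of n]] by measurable
      show "(\<lambda>n. if good w then U (s n) w else 0) \<longlonglongrightarrow> h w v" for w
      proof (cases "good w")
        case True
        have "(\<lambda>n. h0 w (s n)) \<longlonglongrightarrow> h0 w v" by (intro tendsto_intros s)
        then show ?thesis using True h0(2) s(1) by (simp add: h_def)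
      qed (simp add: h_def)
    qed
  qed
qed

text \<open>A function measurable in the point and continuous in the vector may be evaluated along a
  measurable vector: simple functions take countably many values, and continuity passes to the
  limit. It is needed for the action, which evaluates a cochain at the moving vector
  \<open>Lb (ginv G g) v\<close>.\<close>

lemma borel_measurable_dual_apply:
  fixes f :: "'w \<Rightarrow> 'v::{real_normed_vector, second_countable_topology} \<Rightarrow>\<^sub>L real"
  assumes f: "\<And>v. (\<lambda>w. f w v) \<in> borel_measurable N" and g: "g \<in> borel_measurable N"
  shows "(\<lambda>w. f w (g w)) \<in> borel_measurable N"
proof -
  obtain F where F: "\<And>i. simple_function N (F i)" "\<And>x. x \<in> space N \<Longrightarrow> (\<lambda>i. F i x) \<longlonglongrightarrow> g x"
    using borel_measurable_implies_sequence_metric[OF g, of 0] by blast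
  show ?thesis
  proof (rule borel_measurable_LIMSEQ_real)
    show "(\<lambda>i. f w (F i w)) \<longlonglongrightarrow> f w (g w)" if "w \<in> space N" for w
      by (intro tendsto_intros F that)
    fix i
    have fin: "finite (F i ` space N)" using F(1) simple_functionD by blast
    have "F i \<in> N \<rightarrow>\<^sub>M count_space (F i ` space N)"
      using simple_functionD(2)[OF F(1)] by (simp add: measurable_count_space_eq2 fin)
    then show "(\<lambda>w. f w (F i w)) \<in> borel_measurable N"
      by (rule measurable_compose_countable'[where f="\<lambda>v w. f w v", OF f _ countable_finite[OF fin]])
  qed
qed

lemma pred_dual_eq:
  fixes f g :: "'w \<Rightarrow> 'v::{real_normed_vector, second_countable_topology} \<Rightarrow>\<^sub>L real"
  assumes f: "\<And>v. (\<lambda>w. f w v) \<in> borel_measurable N" and g: "\<And>v. (\<lambda>w. g w v) \<in> borel_measurable N"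
  shows "Measurable.pred N (\<lambda>w. f w = g w)"
proof -
  obtain D :: "'v set" where D: "countable D" "closure D = UNIV"
    by (rule countable_dense_subset)
  have "(\<lambda>w. f w = g w) = (\<lambda>w. \<forall>d\<in>D. f w d = g w d)"
    using blinfun_eq_dense[OF D(2)] by (auto simp: fun_eq_iff)
  moreover have "Measurable.pred N (\<lambda>w. \<forall>d\<in>D. f w d = g w d)"
    by (intro pred_Ball_countable D) (use f g in measurable)
  ultimately show ?thesis by simp
qed

text \<open>The dual need not be separable in norm, so the norm is tested on a countable dense set
  of vectors of the predual.\<close>

lemma pred_dual_norm_le:
  fixes f :: "'w \<Rightarrow> 'v::{real_normed_vector, second_countable_topology} \<Rightarrow>\<^sub>L real"
  assumes f: "\<And>v. (\<lambda>w. f w v) \<in> borel_measurable N" and "0 \<le> C"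
  shows "Measurable.pred N (\<lambda>w. norm (f w) \<le> C)"
proof -
  obtain D :: "'v set" where D: "countable D" "closure D = UNIV"
    by (rule countable_dense_subset)
  have "norm (f w) \<le> C \<longleftrightarrow> (\<forall>d\<in>D. \<bar>f w d\<bar> \<le> C * norm d)" for w
    using abs_blinfun_apply_le blinfun_le_dense[OF D(2) _ \<open>0 \<le> C\<close>] by metis
  moreover have "Measurable.pred N (\<lambda>w. \<forall>d\<in>D. \<bar>f w d\<bar> \<le> C * norm d)"
    by (intro pred_Ball_countable D) (use f in measurable)
  ultimately show ?thesis by simp
qed

subsection \<open>Finite products\<close>

text \<open>Takes a pair, not two arguments, so that it is a map on the product space and can push
  forward the product measure. With \<open>i = 0\<close> it prefixes an entry.\<close>

definition insert_at :: "nat \<Rightarrow> nat \<Rightarrow> 'a \<times> (nat \<Rightarrow> 'a) \<Rightarrow> nat \<Rightarrow> 'a" where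
  "insert_at n i p = (\<lambda>j\<in>{..<Suc n}. if j < i then snd p j else if j = i then fst p else snd p (j - 1))"

lemma measurable_insert_at:
  assumes "i \<le> n"
  shows "insert_at n i \<in> M \<Otimes>\<^sub>M PiM {..<n} (\<lambda>_. M) \<rightarrow>\<^sub>M PiM {..<Suc n} (\<lambda>_. M)"
  unfolding insert_at_def[abs_def]
proof (rule measurable_restrict)
  fix j assume "j \<in> {..<Suc n}"
  then consider "j < i" "j < n" | "j = i" | "i < j" "j - 1 < n" using assms by force
  then show "(\<lambda>p. if j < i then snd p j else if j = i then fst p else snd p (j - 1))
    \<in> M \<Otimes>\<^sub>M PiM {..<n} (\<lambda>_. M) \<rightarrow>\<^sub>M M"
    by cases (simp_all add: measurable_compose[OF measurable_snd measurable_component_singleton])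
qed

lemma bij_betw_skip:
  assumes "i \<le> n"
  shows "bij_betw (\<lambda>j. if j < i then j else Suc j) {..<n} ({..<Suc n} - {i})"
  using assms by (intro bij_betw_byWitness[where f'="\<lambda>j. if j < i then j else j - 1"]) auto

text \<open>A box pulls back to the product of its side \<open>i\<close> with the box of the other
  sides, so both measures have the same product of factors on boxes.\<close>

lemma distr_insert_at:
  assumes N: "prob_space N" and i: "i \<le> n"
  shows "distr (N \<Otimes>\<^sub>M PiM {..<n} (\<lambda>_. N)) (PiM {..<Suc n} (\<lambda>_. N)) (insert_at n i) = PiM {..<Suc n} (\<lambda>_. N)"
proof -
  interpret N: prob_space N by (rule N)
  interpret P: product_prob_space "\<lambda>_ :: nat. N" by standard
  interpret F: finite_product_sigma_finite "\<lambda>_ :: nat. N" "{..<n}" by standard simp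
  show ?thesis
  proof (rule P.PiM_eqI)
    fix A :: "nat \<Rightarrow> 'a set" assume A: "\<And>j. j \<in> {..<Suc n} \<Longrightarrow> A j \<in> sets N"
    \<comment> \<open>The sides left after removing side \<open>i\<close>, with the later ones moved
      down by one.\<close>
    let ?B = "\<lambda>j. A (if j < i then j else Suc j)"
    have B: "?B j \<in> sets N" if "j < n" for j using A that by auto
    have space: "A j \<subseteq> space N" if "j < Suc n" for j using A[of j] that sets.sets_into_space by auto
    have pre: "insert_at n i -` Pi\<^sub>E {..<Suc n} A \<inter> space (N \<Otimes>\<^sub>M PiM {..<n} (\<lambda>_. N)) = A i \<times> Pi\<^sub>E {..<n} ?B"
    proof (intro equalityI subsetI)
      fix p assume p: "p \<in> insert_at n i -` Pi\<^sub>E {..<Suc n} A \<inter> space (N \<Otimes>\<^sub>M PiM {..<n} (\<lambda>_. N))"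
      then have ext: "snd p \<in> extensional {..<n}"
        by (auto simp: space_pair_measure space_PiM PiE_def)
      have *: "insert_at n i p j \<in> A j" if "j < Suc n" for j using p that by auto
      have "fst p \<in> A i" using *[of i] i by (simp add: insert_at_def)
      moreover have "snd p j \<in> ?B j" if "j < n" for j
        using *[of j] *[of "Suc j"] that by (auto simp: insert_at_def split: if_splits)
      ultimately show "p \<in> A i \<times> Pi\<^sub>E {..<n} ?B" using ext by (cases p) (auto simp: PiE_def)
    next
      fix p assume "p \<in> A i \<times> Pi\<^sub>E {..<n} ?B"
      then obtain u w where p: "p = (u, w)" "u \<in> A i" "w \<in> Pi\<^sub>E {..<n} ?B" by (cases p) blast
      have w: "w j \<in> ?B j" if "j < n" for j using PiE_mem[OF p(3)] that by blast
      have "insert_at n i p j \<in> A j" if "j < Suc n" for j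
      proof -
        consider "j < i" | "j = i" | "i < j" by linarith
        then show ?thesis
        proof cases
          case 1
          then show ?thesis using w[of j] that i by (simp add: insert_at_def p(1))
        next
          case 2
          then show ?thesis using p(2) that by (simp add: insert_at_def p(1))
        next
          case 3
          then obtain j' where j': "j = Suc j'" by (cases j) auto
          then have "i \<le> j'" "j' < n" using 3 that by auto
          then show ?thesis using w[of j'] by (simp add: insert_at_def p(1) j')
        qed
      qed
      moreover have "w j \<in> space N" if "j < n" for j
        using w[OF that] B[OF that] sets.sets_into_space by blast
      ultimately show "p \<in> insert_at n i -` Pi\<^sub>E {..<Suc n} A \<inter> space (N \<Otimes>\<^sub>M PiM {..<n} (\<lambda>_. N))"
        using p space[of i] i by (auto simp: space_pair_measure space_PiM PiE_def insert_at_def)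
    qed
    have "emeasure (distr (N \<Otimes>\<^sub>M PiM {..<n} (\<lambda>_. N)) (PiM {..<Suc n} (\<lambda>_. N)) (insert_at n i)) (Pi\<^sub>E {..<Suc n} A)
      = emeasure (N \<Otimes>\<^sub>M PiM {..<n} (\<lambda>_. N)) (A i \<times> Pi\<^sub>E {..<n} ?B)"
      unfolding pre[symmetric]
      by (rule emeasure_distr[OF measurable_insert_at[OF i] sets_PiM_I_finite[OF finite_lessThan A]])
    also have "\<dots> = emeasure N (A i) * (\<Prod>j<n. emeasure N (?B j))"
    proof -
      have "Pi\<^sub>E {..<n} ?B \<in> sets (PiM {..<n} (\<lambda>_. N))"
        using B by (intro sets_PiM_I_finite) simp_all
      moreover have "emeasure (PiM {..<n} (\<lambda>_. N)) (Pi\<^sub>E {..<n} ?B) = (\<Prod>j<n. emeasure N (?B j))"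
        using B by (intro P.emeasure_PiM) simp_all
      ultimately show ?thesis
        using F.emeasure_pair_measure_Times[of "A i" N "Pi\<^sub>E {..<n} ?B"] A[of i] i by simp
    qed
    also have "(\<Prod>j<n. emeasure N (?B j)) = (\<Prod>j\<in>{..<Suc n} - {i}. emeasure N (A j))"
      using bij_betw_skip[OF i] by (rule prod.reindex_bij_betw)
    also have "emeasure N (A i) * \<dots> = (\<Prod>j<Suc n. emeasure N (A j))"
      using i by (subst prod.remove[of "{..<Suc n}" i]) auto
    finally show "emeasure (distr (N \<Otimes>\<^sub>M PiM {..<n} (\<lambda>_. N)) (PiM {..<Suc n} (\<lambda>_. N)) (insert_at n i)) (Pi\<^sub>E {..<Suc n} A)
      = (\<Prod>j<Suc n. emeasure N (A j))" .
  qed simp_all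
qed

lemma omit_insert_at:
  assumes "w \<in> extensional {..<Suc k}"
  shows "omit k i (insert_at (Suc k) i (u, w)) = w"
  using assms by (auto simp: omit_def insert_at_def fun_eq_iff extensional_def)

text \<open>The simplicial identity behind the contracting homotopy: deleting a later entry commutes
  with prefixing one, with the index shifted by one.\<close>

lemma omit_Suc_insert_at_0:
  "omit (Suc k) (Suc i) (insert_at (Suc (Suc k)) 0 (u, w)) = insert_at (Suc k) 0 (u, omit k i w)"
  by (auto simp: omit_def insert_at_def fun_eq_iff)

lemma measurable_omit: "omit k i \<in> PiM {..<Suc (Suc k)} (\<lambda>_. M) \<rightarrow>\<^sub>M PiM {..<Suc k} (\<lambda>_. M)"
  unfolding omit_def[abs_def] by (intro measurable_restrict measurable_If) auto

lemma distr_omit: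
  assumes "prob_space N"
  shows "distr (PiM {..<Suc (Suc k)} (\<lambda>_. N)) (PiM {..<Suc k} (\<lambda>_. N)) (omit k i) = PiM {..<Suc k} (\<lambda>_. N)"
proof -
  have eq: "omit k i = (\<lambda>w. \<lambda>j\<in>{..<Suc k}. w (if j < i then j else Suc j))"
    by (auto simp: omit_def fun_eq_iff)
  show ?thesis
    unfolding eq
    by (rule distr_PiM_reindex[OF assms]) (auto simp: inj_on_def)
qed

text \<open>Deleted entry \<open>i\<close> occurs only in the indicator, so Fubini integrates it
  out. The price is a test function on the smaller product that is no longer an indicator.\<close>

lemma integral_omit:
  fixes F :: "(nat \<Rightarrow> 'a) \<Rightarrow> real"
  assumes N: "prob_space N" and i: "i \<le> Suc k"
    and F: "F \<in> borel_measurable (PiM {..<Suc k} (\<lambda>_. N))" and F_bound: "\<And>w. \<bar>F w\<bar> \<le> c"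
    and A: "A \<in> sets (PiM {..<Suc (Suc k)} (\<lambda>_. N))"
  shows "(\<integral>w. F (omit k i w) * indicator A w \<partial>PiM {..<Suc (Suc k)} (\<lambda>_. N)) =
    (\<integral>w. F w * (\<integral>u. indicator A (insert_at (Suc k) i (u, w)) \<partial>N) \<partial>PiM {..<Suc k} (\<lambda>_. N))"
    (is "?lhs = ?rhs")
    "integrable (PiM {..<Suc k} (\<lambda>_. N)) (\<lambda>w. (\<integral>u. indicator A (insert_at (Suc k) i (u, w)) \<partial>N) :: real)"
proof -
  let ?P = "PiM {..<Suc k} (\<lambda>_. N)"
  interpret N: prob_space N by (rule N)
  interpret P: prob_space ?P by (intro prob_space_PiM N)
  interpret NP: pair_prob_space N ?P by standard
  note measurable_insert_at[OF i, measurable] and F[measurable] and A[measurable] and measurable_omit[measurable]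
  have int: "integrable (N \<Otimes>\<^sub>M ?P) (\<lambda>(u, w). F w * indicator A (insert_at (Suc k) i (u, w)))"
  proof (rule NP.P.integrable_const_bound[where B=c])
    show "AE p in N \<Otimes>\<^sub>M ?P. norm (case p of (u, w) \<Rightarrow> F w * indicator A (insert_at (Suc k) i (u, w))) \<le> c"
      using F_bound order_trans[OF abs_ge_zero F_bound] by (auto simp: indicator_def split: prod.splits)
  qed measurable
  have "?lhs = (\<integral>p. F (omit k i (insert_at (Suc k) i p)) * indicator A (insert_at (Suc k) i p) \<partial>(N \<Otimes>\<^sub>M ?P))"
    by (subst distr_insert_at[OF N i, symmetric], rule integral_distr) measurable
  also have "\<dots> = (\<integral>p. (case p of (u, w) \<Rightarrow> F w * indicator A (insert_at (Suc k) i (u, w))) \<partial>(N \<Otimes>\<^sub>M ?P))"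
    by (rule Bochner_Integration.integral_cong)
      (auto simp: space_pair_measure space_PiM PiE_def omit_insert_at)
  also have "\<dots> = (\<integral>w. \<integral>u. F w * indicator A (insert_at (Suc k) i (u, w)) \<partial>N \<partial>?P)"
    by (rule NP.integral_snd[OF int, symmetric])
  also have "\<dots> = ?rhs" by simp
  finally show "?lhs = ?rhs" .
  show "integrable ?P (\<lambda>w. (\<integral>u. indicator A (insert_at (Suc k) i (u, w)) \<partial>N) :: real)"
  proof (rule P.integrable_const_bound[where B=1])
    have "\<bar>\<integral>u. indicator A (insert_at (Suc k) i (u, w)) \<partial>N\<bar> \<le> (1::real)" for w
    proof -
      have "\<bar>\<integral>u. indicator A (insert_at (Suc k) i (u, w)) \<partial>N\<bar> \<le> (\<integral>u. \<bar>indicator A (insert_at (Suc k) i (u, w)) :: real\<bar> \<partial>N)"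
        by (rule integral_abs_bound)
      \<comment> \<open>\<open>w\<close> is arbitrary here, possibly outside the space; this form of
        monotonicity asks for integrability of the upper bound only.\<close>
      also have "\<dots> \<le> (\<integral>u. 1 \<partial>N)"
        by (rule integral_mono_AE') (auto simp: indicator_def)
      finally show ?thesis by (simp add: N.prob_space)
    qed
    then show "AE w in ?P. norm (\<integral>u. indicator A (insert_at (Suc k) i (u, w)) \<partial>N :: real) \<le> 1" by simp
    show "(\<lambda>w. (\<integral>u. indicator A (insert_at (Suc k) i (u, w)) \<partial>N) :: real) \<in> borel_measurable ?P"
      by (rule N.borel_measurable_lebesgue_integral) measurable
  qed
qed

lemma PiM_density:
  assumes M: "prob_space M" and N: "prob_space N" and I: "finite I"
    and f: "f \<in> borel_measurable M" and eq: "N = density M f"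
  shows "PiM I (\<lambda>_. N) = density (PiM I (\<lambda>_. M)) (\<lambda>w. \<Prod>i\<in>I. f (w i))"
proof -
  interpret M: prob_space M by (rule M)
  interpret N: prob_space N by (rule N)
  interpret PM: product_prob_space "\<lambda>_. M" by standard
  interpret PN: product_prob_space "\<lambda>_. N" by standard
  note f [measurable]
  have sets: "sets N = sets M" using eq by simp
  show ?thesis
  proof (rule PN.PiM_eqI[symmetric, OF I])
    show "sets (density (PiM I (\<lambda>_. M)) (\<lambda>w. \<Prod>i\<in>I. f (w i))) = sets (PiM I (\<lambda>_. N))"
      using sets by (simp cong: sets_PiM_cong)
    fix A :: "'b \<Rightarrow> 'a set" assume A: "\<And>i. i \<in> I \<Longrightarrow> A i \<in> sets N"
    have "emeasure (density (PiM I (\<lambda>_. M)) (\<lambda>w. \<Prod>i\<in>I. f (w i))) (Pi\<^sub>E I A)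
      = (\<integral>\<^sup>+w. (\<Prod>i\<in>I. f (w i)) * indicator (Pi\<^sub>E I A) w \<partial>PiM I (\<lambda>_. M))"
      using A sets I by (intro emeasure_density sets_PiM_I_finite) auto
    also have "\<dots> = (\<integral>\<^sup>+w. (\<Prod>i\<in>I. f (w i) * indicator (A i) (w i)) \<partial>PiM I (\<lambda>_. M))"
    proof (rule nn_integral_cong)
      fix w assume w: "w \<in> space (PiM I (\<lambda>_. M))"
      show "(\<Prod>i\<in>I. f (w i)) * indicator (Pi\<^sub>E I A) w = (\<Prod>i\<in>I. f (w i) * indicator (A i) (w i))"
      proof (cases "\<forall>i\<in>I. w i \<in> A i")
        case True
        then have "w \<in> Pi\<^sub>E I A" using w by (auto simp: space_PiM PiE_def)
        with True show ?thesis by (simp cong: prod.cong)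
      next
        case False
        then have "w \<notin> Pi\<^sub>E I A" "(\<Prod>i\<in>I. f (w i) * indicator (A i) (w i)) = 0"
          using I by (auto simp: indicator_def intro!: prod_zero)
        then show ?thesis by simp
      qed
    qed
    also have "\<dots> = (\<Prod>i\<in>I. \<integral>\<^sup>+x. f x * indicator (A i) x \<partial>M)"
      using A sets by (intro PM.product_nn_integral_prod I) auto
    also have "\<dots> = (\<Prod>i\<in>I. emeasure N (A i))"
      using A sets by (intro prod.cong refl) (simp add: eq emeasure_density)
    finally show "emeasure (density (PiM I (\<lambda>_. M)) (\<lambda>w. \<Prod>i\<in>I. f (w i))) (Pi\<^sub>E I A) = (\<Prod>i\<in>I. emeasure N (A i))" .
  qed
qed

text \<open>The product of the densities is a density of the product. Finiteness of \<open>I\<close>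
  matters: infinite products of mutually absolutely continuous measures can be singular.\<close>

lemma absolutely_continuous_PiM:
  assumes M: "prob_space M" and N: "prob_space N" and I: "finite I"
    and sets: "sets N = sets M" and ac: "absolutely_continuous M N"
  shows "absolutely_continuous (PiM I (\<lambda>_. M)) (PiM I (\<lambda>_. N))"
proof -
  interpret M: prob_space M by (rule M)
  obtain f where f: "f \<in> borel_measurable M" "density M f = N"
    using M.Radon_Nikodym[OF ac sets] by blast
  then have "PiM I (\<lambda>_. N) = density (PiM I (\<lambda>_. M)) (\<lambda>w. \<Prod>i\<in>I. f (w i))"
    by (intro PiM_density N I M) auto
  then show ?thesis
    using f(1) by (simp add: absolutely_continuousI_density)
qed

subsection \<open>Measurability on a measured groupoid\<close>

context groupoid
begin

lemma composable_iff: "(g, h) \<in> composable G \<longleftrightarrow> g \<in> arrows G \<and> h \<in> arrows G \<and> src G g = tgt G h"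
  by (auto simp: composable_def)

lemma tgt_closed: "g \<in> arrows G \<Longrightarrow> tgt G g \<in> arrows G"
  using mult_closed[of g "ginv G g"] by (simp add: composable_iff inv_closed tgt_inv tgt_def[of G g])

lemma unit_space_subset: "unit_space G \<subseteq> arrows G"
  by (auto simp: unit_space_def tgt_closed)

lemma tgt_in_unit_space: "g \<in> arrows G \<Longrightarrow> tgt G g \<in> unit_space G"
  by (simp add: unit_space_def)

lemma src_in_unit_space: "g \<in> arrows G \<Longrightarrow> src G g \<in> unit_space G"
  using tgt_in_unit_space[OF inv_closed] by (simp add: tgt_inv)

lemma inv_mult_cancel:
  assumes "g \<in> arrows G" "h \<in> arrows G" "src G g = tgt G h"
  shows "gmult G (ginv G g) (gmult G g h) = h"
  using mult_assoc[of "ginv G g" g h] assms tgt_unit[of h]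
  by (simp add: composable_iff inv_closed src_inv src_def[of G g, symmetric])

lemma mult_in_fibre:
  assumes "g \<in> arrows G" "h \<in> fibre G (src G g)"
  shows "gmult G g h \<in> fibre G (tgt G g)"
  using assms mult_closed[of g h] tgt_mult[of g h] by (simp add: fibre_def composable_iff)

end

context borel_groupoid
begin

lemma pred_eq_borel:
  assumes [measurable]: "f \<in> N \<rightarrow>\<^sub>M M" "g \<in> N \<rightarrow>\<^sub>M M"
  shows "Measurable.pred N (\<lambda>x. f x = g x)"
proof -
  have "(\<lambda>x. (f x, g x)) \<in> N \<rightarrow>\<^sub>M M \<Otimes>\<^sub>M M" by measurable
  from measurable_sets[OF this standard_borel_diagonal[OF standard]]
  have "{x \<in> space N. f x = g x} \<in> sets N"
    by (rule back_subst[of "\<lambda>A. A \<in> sets N"])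
      (use measurable_space[OF assms(1)] measurable_space[OF assms(2)] in \<open>auto simp: space_pair_measure\<close>)
  then show ?thesis by (simp add: pred_def)
qed

text \<open>Composition is Borel only on composable pairs, so composability is demanded at every
  point of the source space.\<close>

lemma measurable_gmult:
  assumes f: "f \<in> N \<rightarrow>\<^sub>M M" and g: "g \<in> N \<rightarrow>\<^sub>M M"
    and comp: "\<And>x. x \<in> space N \<Longrightarrow> (f x, g x) \<in> composable G"
  shows "(\<lambda>x. gmult G (f x) (g x)) \<in> N \<rightarrow>\<^sub>M M"
proof -
  have "(\<lambda>x. (f x, g x)) \<in> N \<rightarrow>\<^sub>M restrict_space (M \<Otimes>\<^sub>M M) (composable G)"
    using f g comp by (intro measurable_restrict_space2) auto
  from measurable_compose[OF this mult_borel] show ?thesis by simp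
qed

lemma measurable_tgt: "tgt G \<in> M \<rightarrow>\<^sub>M M"
  unfolding tgt_def[abs_def]
  by (intro measurable_gmult inv_borel measurable_ident)
    (auto simp: composable_iff inv_closed tgt_inv space_eq)

lemma sets_fibre: "x \<in> arrows G \<Longrightarrow> fibre G x \<in> sets M"
  using pred_eq_borel[OF measurable_tgt, of "\<lambda>_. x"] unfolding pred_def fibre_def
  by (simp add: space_eq)

end

section \<open>Fibre measures, their powers, and the measure on tuples with common target\<close>

context measured_groupoid
begin

lemma space_unit_borel: "space (unit_borel G) = unit_space G"
  using unit_space_subset by (auto simp: unit_borel_def space_restrict_space space_eq)

lemma measurable_tgt_unit: "tgt G \<in> nu G \<rightarrow>\<^sub>M unit_borel G"
  unfolding unit_borel_def
  by (intro measurable_restrict_space2 measurable_tgt) (auto simp: space_eq tgt_in_unit_space)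

lemma sets_mu [measurable_cong]: "sets (mu G) = sets (unit_borel G)"
  by (simp add: mu_def)

lemma space_mu: "space (mu G) = unit_space G"
  by (simp add: mu_def space_unit_borel)

lemma prob_space_mu: "prob_space (mu G)"
  unfolding mu_def by (rule prob_space.prob_space_distr[OF nu_prob measurable_tgt_unit])

lemma prob_space_nufib: "x \<in> unit_space G \<Longrightarrow> prob_space (nufib G x)"
  and sets_nufib: "x \<in> unit_space G \<Longrightarrow> sets (nufib G x) = sets (nu G)"
  using measurable_space[OF nufib_kernel, of x] by (auto simp: space_unit_borel space_prob_algebra)

lemma space_nufib: "x \<in> unit_space G \<Longrightarrow> space (nufib G x) = arrows G"
  using sets_eq_imp_space_eq[OF sets_nufib] by (simp add: space_eq)

lemma AE_nufib_fibre:
  assumes "x \<in> unit_space G"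
  shows "AE g in nufib G x. g \<in> fibre G x"
proof -
  interpret prob_space "nufib G x" by (rule prob_space_nufib[OF assms])
  have "fibre G x \<in> sets (nufib G x)"
    using sets_fibre unit_space_subset assms by (auto simp: sets_nufib)
  then show ?thesis
    using nufib_support[OF assms] by (intro AE_prob_1) (simp add: measure_def)
qed

abbreviation tuple_borel :: "nat \<Rightarrow> (nat \<Rightarrow> 'a) measure" where
  "tuple_borel n \<equiv> PiM {..<n} (\<lambda>_. nu G)"

abbreviation fibre_prod :: "nat \<Rightarrow> 'a \<Rightarrow> (nat \<Rightarrow> 'a) measure" where
  "fibre_prod n x \<equiv> PiM {..<n} (\<lambda>_. nufib G x)"

lemma prob_space_fibre_prod: "x \<in> unit_space G \<Longrightarrow> prob_space (fibre_prod n x)"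
  by (intro prob_space_PiM prob_space_nufib)

lemma sets_fibre_prod: "x \<in> unit_space G \<Longrightarrow> sets (fibre_prod n x) = sets (tuple_borel n)"
  by (intro sets_PiM_cong refl sets_nufib)

lemma space_fibre_prod: "x \<in> unit_space G \<Longrightarrow> space (fibre_prod n x) = space (tuple_borel n)"
  by (rule sets_eq_imp_space_eq[OF sets_fibre_prod])

text \<open>Boxes generate the sigma-algebra and are closed under intersection, and on a box the
  measure is a finite product of measurable functions of \<open>x\<close>.\<close>

lemma fibre_prod_kernel: "fibre_prod n \<in> unit_borel G \<rightarrow>\<^sub>M prob_algebra (tuple_borel n)"
proof (rule measurable_prob_algebra_generated[OF sets_PiM_finite])
  let ?E = "{\<Pi>\<^sub>E i\<in>{..<n}. X i | X. (\<forall>i. X i \<in> sets (nu G)) \<and> finite {i. X i \<noteq> space (nu G)}}"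
  show "Int_stable ?E"
  proof (rule Int_stableI, clarify)
    fix X Y :: "nat \<Rightarrow> 'a set"
    assume X: "\<forall>i. X i \<in> sets (nu G)" "finite {i. X i \<noteq> space (nu G)}"
      and Y: "\<forall>i. Y i \<in> sets (nu G)" "finite {i. Y i \<noteq> space (nu G)}"
    have "{i. X i \<inter> Y i \<noteq> space (nu G)} \<subseteq> {i. X i \<noteq> space (nu G)} \<union> {i. Y i \<noteq> space (nu G)}" by auto
    then have "finite {i. X i \<inter> Y i \<noteq> space (nu G)}" using X(2) Y(2) finite_subset by blast
    then show "\<exists>Z. Pi\<^sub>E {..<n} X \<inter> Pi\<^sub>E {..<n} Y = Pi\<^sub>E {..<n} Z \<and>
        (\<forall>i. Z i \<in> sets (nu G)) \<and> finite {i. Z i \<noteq> space (nu G)}"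
      using X(1) Y(1) by (intro exI[of _ "\<lambda>i. X i \<inter> Y i"]) (auto simp: PiE_Int)
  qed
  show "?E \<subseteq> Pow (\<Pi>\<^sub>E i\<in>{..<n}. space (nu G))"
  proof clarify
    fix X x i assume X: "\<forall>i. X i \<in> sets (nu G)" and x: "x \<in> Pi\<^sub>E {..<n} X"
    have "X i \<subseteq> space (nu G)" for i using X sets.sets_into_space by blast
    then show "x \<in> (\<Pi>\<^sub>E i\<in>{..<n}. space (nu G))"
      using PiE_mono[of "{..<n}" X "\<lambda>_. space (nu G)"] x by blast
  qed
  show "prob_space (fibre_prod n x)" if "x \<in> space (unit_borel G)" for x
    using that by (intro prob_space_fibre_prod) (simp add: space_unit_borel)
  show "sets (fibre_prod n x) = sets (tuple_borel n)" if "x \<in> space (unit_borel G)" for x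
    using that by (intro sets_fibre_prod) (simp add: space_unit_borel)
  fix A assume "A \<in> ?E"
  then obtain X where A: "A = Pi\<^sub>E {..<n} X" and X: "\<forall>i. X i \<in> sets (nu G)" by blast
  have "emeasure (fibre_prod n x) A = (\<Prod>i<n. emeasure (nufib G x) (X i))" if x: "x \<in> unit_space G" for x
  proof -
    interpret prob_space "nufib G x" by (rule prob_space_nufib[OF x])
    interpret product_prob_space "\<lambda>_ :: nat. nufib G x" by standard
    show ?thesis unfolding A using X x by (intro emeasure_PiM) (simp_all add: sets_nufib)
  qed
  moreover have "(\<lambda>x. \<Prod>i<n. emeasure (nufib G x) (X i)) \<in> borel_measurable (unit_borel G)"
  proof (rule borel_measurable_prod_ennreal)
    show "(\<lambda>x. emeasure (nufib G x) (X i)) \<in> borel_measurable (unit_borel G)" for i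
      using X by (intro measurable_emeasure_kernel[OF measurable_prob_algebraD[OF nufib_kernel]]) simp
  qed
  ultimately show "(\<lambda>x. emeasure (fibre_prod n x) A) \<in> borel_measurable (unit_borel G)"
    using measurable_cong[of "unit_borel G" "\<lambda>x. emeasure (fibre_prod n x) A"] by (simp add: space_unit_borel)
qed

lemma fibre_prod_subprob_kernel: "fibre_prod n \<in> unit_borel G \<rightarrow>\<^sub>M subprob_algebra (tuple_borel n)"
  by (rule measurable_prob_algebraD[OF fibre_prod_kernel])

lemma fibre_prod_kernel_mu: "fibre_prod n \<in> mu G \<rightarrow>\<^sub>M subprob_algebra (tuple_borel n)"
  using fibre_prod_subprob_kernel by (simp add: measurable_cong_sets[OF sets_mu refl])

lemma nufib_kernel_mu: "nufib G \<in> mu G \<rightarrow>\<^sub>M subprob_algebra (nu G)"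
  using measurable_prob_algebraD[OF nufib_kernel] by (simp add: measurable_cong_sets[OF sets_mu refl])

lemma AE_fibre_prod_fibre:
  assumes x: "x \<in> unit_space G"
  shows "AE w in fibre_prod n x. \<forall>i<n. w i \<in> fibre G x"
proof -
  have "AE w in fibre_prod n x. w i \<in> fibre G x" if "i < n" for i
    using that x by (intro AE_PiM_component prob_space_nufib AE_nufib_fibre) auto
  then have "AE w in fibre_prod n x. \<forall>i\<in>{..<n}. w i \<in> fibre G x"
    by (intro AE_finite_allI) auto
  then show ?thesis by (simp only: Ball_def lessThan_iff)
qed

lemma tuples_subset: "tuples G n \<subseteq> space (tuple_borel n)"
  by (auto simp: tuples_def space_PiM space_eq)

lemma in_tuplesI:
  "w \<in> space (tuple_borel n) \<Longrightarrow> \<forall>i<n. w i \<in> fibre G x \<Longrightarrow> w \<in> tuples G n"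
  by (auto simp: tuples_def space_PiM space_eq fibre_def)

lemma AE_fibre_prod_tuples:
  assumes x: "x \<in> unit_space G"
  shows "AE w in fibre_prod n x. w \<in> tuples G n"
  using AE_fibre_prod_fibre[OF x, of n] AE_space
  by eventually_elim (rule in_tuplesI, simp_all add: space_fibre_prod x)

lemma sets_tuples: "tuples G n \<in> sets (tuple_borel n)"
proof -
  have "Measurable.pred (tuple_borel n) (\<lambda>w. tgt G (w i) = tgt G (w j))" if "i < n" "j < n" for i j
  proof (rule pred_eq_borel)
    have comp: "(\<lambda>w. w i) \<in> tuple_borel n \<rightarrow>\<^sub>M nu G" if "i < n" for i
      using that by (intro measurable_component_singleton) simp
    show "(\<lambda>w. tgt G (w i)) \<in> tuple_borel n \<rightarrow>\<^sub>M nu G"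
      by (rule measurable_compose[OF comp[OF that(1)] measurable_tgt])
    show "(\<lambda>w. tgt G (w j)) \<in> tuple_borel n \<rightarrow>\<^sub>M nu G"
      by (rule measurable_compose[OF comp[OF that(2)] measurable_tgt])
  qed
  then have "Measurable.pred (tuple_borel n) (\<lambda>w. \<forall>i\<in>{..<n}. \<forall>j\<in>{..<n}. tgt G (w i) = tgt G (w j))"
    by (intro pred_Ball_countable) auto
  moreover have "tuples G n = {w \<in> space (tuple_borel n). \<forall>i\<in>{..<n}. \<forall>j\<in>{..<n}. tgt G (w i) = tgt G (w j)}"
    by (auto simp: tuples_def space_PiM space_eq)
  ultimately show ?thesis by (simp add: pred_def)
qed

lemma space_mu_nonempty: "space (mu G) \<noteq> {}"
  by (rule prob_space.not_empty[OF prob_space_mu])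

lemma sets_bind_fibre_prod: "sets (mu G \<bind> fibre_prod n) = sets (tuple_borel n)"
  by (rule sets_bind[OF sets_kernel[OF fibre_prod_kernel_mu] space_mu_nonempty])

lemma sets_nu_tuples: "sets (nu_tuples G n) = sets (restrict_space (tuple_borel n) (tuples G n))"
  unfolding nu_tuples_def by (intro sets_restrict_space_cong sets_bind_fibre_prod)

lemma space_nu_tuples: "space (nu_tuples G n) = tuples G n"
  using sets_eq_imp_space_eq[OF sets_nu_tuples, of n] tuples_subset[of n] by (auto simp: space_restrict_space)

lemma AE_nu_tuples_iff: "(AE w in nu_tuples G n. P w) \<longleftrightarrow> (AE w in mu G \<bind> fibre_prod n. w \<in> tuples G n \<longrightarrow> P w)"
  unfolding nu_tuples_def
  using sets_tuples[of n] tuples_subset[of n] sets_eq_imp_space_eq[OF sets_bind_fibre_prod, of n]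
  by (intro AE_restrict_space_iff) (simp add: sets_bind_fibre_prod Int_absorb2)

text \<open>\<open>P\<close> itself may fail to be measurable, while the passage to fibres works for
  measurable predicates; \<open>S\<close> is the complement of a measurable null set containing all
  exceptions.\<close>

lemma AE_nu_tuplesE:
  assumes "AE w in nu_tuples G n. P w"
  obtains S where "S \<in> sets (tuple_borel n)" "\<And>w. w \<in> tuples G n \<Longrightarrow> w \<in> S \<Longrightarrow> P w"
    "AE x in mu G. AE w in fibre_prod n x. w \<in> S"
proof -
  obtain N where N: "{w \<in> space (mu G \<bind> fibre_prod n). \<not> (w \<in> tuples G n \<longrightarrow> P w)} \<subseteq> N"
    "emeasure (mu G \<bind> fibre_prod n) N = 0" "N \<in> sets (mu G \<bind> fibre_prod n)"
    using assms unfolding AE_nu_tuples_iff by (rule AE_E)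
  have sp: "space (mu G \<bind> fibre_prod n) = space (tuple_borel n)"
    by (rule sets_eq_imp_space_eq[OF sets_bind_fibre_prod])
  let ?S = "space (tuple_borel n) - N"
  have S: "?S \<in> sets (tuple_borel n)" using N(3) sets_bind_fibre_prod by auto
  have "AE w in mu G \<bind> fibre_prod n. w \<in> ?S"
    using N(2,3) sp by (intro AE_I'[of N]) (auto simp: null_sets_def)
  then have "AE x in mu G. AE w in fibre_prod n x. w \<in> ?S"
    by (subst (asm) AE_bind[OF fibre_prod_kernel_mu]) (use S in \<open>simp_all add: pred_def Collect_mem_eq Collect_conj_eq del: Diff_iff\<close>)
  then show thesis
    using N(1) sp tuples_subset[of n] S by (intro that[of ?S]) auto
qed

lemma AE_nu_tuplesD:
  assumes "AE w in nu_tuples G n. P w"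
  shows "AE x in mu G. AE w in fibre_prod n x. P w"
proof -
  obtain S where S: "S \<in> sets (tuple_borel n)" "\<And>w. w \<in> tuples G n \<Longrightarrow> w \<in> S \<Longrightarrow> P w"
    "AE x in mu G. AE w in fibre_prod n x. w \<in> S"
    using assms by (rule AE_nu_tuplesE) blast
  from S(3) AE_space show ?thesis
  proof eventually_elim
    case (elim x)
    from elim(1) AE_fibre_prod_tuples[of x n] elim(2) show ?case
      unfolding space_mu by (auto intro: S(2))
  qed
qed

lemma sets_tuples_Collect:
  assumes "Measurable.pred (nu_tuples G n) P"
  shows "{w \<in> tuples G n. P w} \<in> sets (tuple_borel n)"
proof -
  have "{w \<in> tuples G n. P w} \<in> sets (nu_tuples G n)"
    using assms by (simp add: pred_def space_nu_tuples)
  then show ?thesis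
    using sets_tuples[of n] tuples_subset[of n]
    by (simp add: sets_nu_tuples sets_restrict_space_iff Int_absorb2)
qed

text \<open>Null sets given fibre by fibre need not fit together to a measurable set, so this
  direction asks for measurability of \<open>P\<close>.\<close>

lemma AE_nu_tuplesI:
  assumes "AE x in mu G. AE w in fibre_prod n x. P w" and P: "Measurable.pred (nu_tuples G n) P"
  shows "AE w in nu_tuples G n. P w"
proof -
  have "{w \<in> tuples G n. P w} \<union> (space (tuple_borel n) - tuples G n) \<in> sets (tuple_borel n)"
    using sets_tuples sets_tuples_Collect[OF P] by auto
  moreover have "{w \<in> tuples G n. P w} \<union> (space (tuple_borel n) - tuples G n)
    = {w \<in> space (tuple_borel n). w \<in> tuples G n \<longrightarrow> P w}"
    using tuples_subset by auto
  ultimately have "Measurable.pred (tuple_borel n) (\<lambda>w. w \<in> tuples G n \<longrightarrow> P w)"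
    by (simp add: pred_def)
  moreover have "AE x in mu G. AE w in fibre_prod n x. w \<in> tuples G n \<longrightarrow> P w"
    using assms(1) by (auto elim!: eventually_mono)
  ultimately show ?thesis
    unfolding AE_nu_tuples_iff by (subst AE_bind[OF fibre_prod_kernel_mu])
qed

lemma AE_tgt:
  assumes "AE x in mu G. P x"
  shows "AE g in nu G. P (tgt G g)"
  using assms unfolding mu_def by (rule AE_distrD[OF measurable_tgt_unit])

text \<open>The source is the target of the inverse, and symmetry of \<open>nu G\<close> gives it
  the same law as the target.\<close>

lemma AE_src:
  assumes "AE x in mu G. P x"
  shows "AE g in nu G. P (src G g)"
proof -
  have "AE g in distr (nu G) (nu G) (ginv G). P (tgt G g)"
    unfolding nu_symmetric by (rule AE_tgt[OF assms])
  then have "AE g in nu G. P (tgt G (ginv G g))"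
    by (rule AE_distrD[OF inv_borel])
  then show ?thesis
    using AE_space by eventually_elim (simp add: tgt_inv space_eq)
qed

lemma AE_nu_iff:
  assumes "Measurable.pred (nu G) P"
  shows "(AE g in nu G. P g) \<longleftrightarrow> (AE x in mu G. AE g in nufib G x. P g)"
  by (subst disintegration, rule AE_bind[OF nufib_kernel_mu assms])

end

text \<open>Holding almost everywhere means that the measure of the exceptional set vanishes, and
  this measure is a measurable function of \<open>x\<close>.\<close>

lemma pred_AE_kernel:
  assumes K: "K \<in> M \<rightarrow>\<^sub>M subprob_algebra N"
    and P: "Measurable.pred (M \<Otimes>\<^sub>M N) (\<lambda>p. P (fst p) (snd p))"
  shows "Measurable.pred M (\<lambda>x. AE w in K x. P x w)"
proof -
  have "(\<lambda>(x, w). indicator {w. \<not> P x w} w :: ennreal) = indicator {p. \<not> P (fst p) (snd p)}"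
    by (auto simp: fun_eq_iff indicator_def)
  also have "\<dots> \<in> borel_measurable (M \<Otimes>\<^sub>M N)"
    using P by (intro borel_measurable_indicator') (auto simp: pred_def)
  finally have "(\<lambda>x. \<integral>\<^sup>+w. indicator {w. \<not> P x w} w \<partial>K x) \<in> borel_measurable M"
    by (rule nn_integral_measurable_subprob_algebra2[OF _ K])
  then have "Measurable.pred M (\<lambda>x. (\<integral>\<^sup>+w. indicator {w. \<not> P x w} w \<partial>K x) = 0)"
    by measurable
  moreover have "(AE w in K x. P x w) \<longleftrightarrow> (\<integral>\<^sup>+w. indicator {w. \<not> P x w} w \<partial>K x) = 0" if x: "x \<in> space M" for x
  proof (rule AE_iff_nn_integral)
    have sets: "sets (K x) = sets N" by (rule sets_kernel[OF K x])
    have "Measurable.pred N (P x)"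
      using measurable_compose[OF measurable_Pair1'[OF x] P] by simp
    then show "{w \<in> space (K x). P x w} \<in> sets (K x)"
      using sets sets_eq_imp_space_eq[OF sets] by (simp add: pred_def)
  qed
  ultimately show ?thesis by (subst measurable_cong)
qed

text \<open>Pushing \<open>L x\<close> forward along \<open>Pair x\<close> moves the dependence on
  \<open>x\<close> from the integrand into the measure, where the integral of a fixed function is
  measurable.\<close>

lemma integral_measurable_subprob_algebra2:
  fixes f :: "'a \<Rightarrow> 'b \<Rightarrow> real"
  assumes f: "(\<lambda>(x, y). f x y) \<in> borel_measurable (M \<Otimes>\<^sub>M N)"
    and L: "L \<in> M \<rightarrow>\<^sub>M subprob_algebra N"
  shows "(\<lambda>x. \<integral>y. f x y \<partial>L x) \<in> borel_measurable M"
proof -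
  have "(\<lambda>x. distr (L x) (M \<Otimes>\<^sub>M N) (Pair x)) \<in> M \<rightarrow>\<^sub>M subprob_algebra (M \<Otimes>\<^sub>M N)"
    by (rule measurable_distr2[OF _ L]) simp
  from measurable_compose[OF this integral_measurable_subprob_algebra[OF f]]
  have "(\<lambda>x. \<integral>p. (case p of (x, y) \<Rightarrow> f x y) \<partial>distr (L x) (M \<Otimes>\<^sub>M N) (Pair x)) \<in> borel_measurable M" .
  moreover have "(\<integral>p. (case p of (x, y) \<Rightarrow> f x y) \<partial>distr (L x) (M \<Otimes>\<^sub>M N) (Pair x)) = (\<integral>y. f x y \<partial>L x)"
    if x: "x \<in> space M" for x
  proof -
    have "Pair x \<in> L x \<rightarrow>\<^sub>M M \<Otimes>\<^sub>M N"
      unfolding measurable_cong_sets[OF sets_kernel[OF L x] refl] by (rule measurable_Pair1'[OF x])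
    from integral_distr[OF this f] show ?thesis by simp
  qed
  ultimately show ?thesis by (subst (asm) measurable_cong)
qed

section \<open>Splitting off the first entry of a tuple\<close>

context measured_groupoid
begin

lemma measurable_tuple_component: "i < n \<Longrightarrow> (\<lambda>w. w i) \<in> tuple_borel n \<rightarrow>\<^sub>M nu G"
  by (intro measurable_component_singleton) simp

lemma fibre_prod_tgt_kernel: "(\<lambda>g. fibre_prod n (tgt G g)) \<in> nu G \<rightarrow>\<^sub>M subprob_algebra (tuple_borel n)"
  by (rule measurable_compose[OF measurable_tgt_unit fibre_prod_subprob_kernel])

lemma sets_nufib_fibre_prod:
  "x \<in> unit_space G \<Longrightarrow> sets (nufib G x \<Otimes>\<^sub>M fibre_prod n x) = sets (nu G \<Otimes>\<^sub>M tuple_borel n)"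
  by (intro sets_pair_measure_cong sets_nufib sets_fibre_prod)

lemma distr_insert_at_fibre:
  assumes "x \<in> unit_space G" "i \<le> n"
  shows "distr (nufib G x \<Otimes>\<^sub>M fibre_prod n x) (fibre_prod (Suc n) x) (insert_at n i) = fibre_prod (Suc n) x"
  by (rule distr_insert_at[OF prob_space_nufib[OF assms(1)] assms(2)])

lemma AE_fibre_prod_SucD:
  assumes x: "x \<in> unit_space G" and P: "AE w in fibre_prod (Suc n) x. P w"
  shows "AE g in nufib G x. AE w in fibre_prod n x. P (insert_at n 0 (g, w))"
proof -
  interpret N: prob_space "nufib G x" by (rule prob_space_nufib[OF x])
  interpret P: prob_space "fibre_prod n x" by (rule prob_space_fibre_prod[OF x])
  interpret NP: pair_prob_space "nufib G x" "fibre_prod n x" by standard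
  have "AE w in distr (nufib G x \<Otimes>\<^sub>M fibre_prod n x) (fibre_prod (Suc n) x) (insert_at n 0). P w"
    unfolding distr_insert_at_fibre[OF x le0] by (rule P)
  then have "AE p in nufib G x \<Otimes>\<^sub>M fibre_prod n x. P (insert_at n 0 p)"
    by (rule AE_distrD[OF measurable_insert_at[OF le0]])
  then show ?thesis by (rule NP.AE_pair)
qed

lemma AE_fibre_prod_SucI:
  assumes x: "x \<in> unit_space G" and S: "S \<in> sets (tuple_borel (Suc n))"
    and ae: "AE g in nufib G x. AE w in fibre_prod n x. insert_at n 0 (g, w) \<in> S"
  shows "AE w in fibre_prod (Suc n) x. w \<in> S"
proof -
  interpret N: prob_space "nufib G x" by (rule prob_space_nufib[OF x])
  interpret P: prob_space "fibre_prod n x" by (rule prob_space_fibre_prod[OF x])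
  interpret NP: pair_prob_space "nufib G x" "fibre_prod n x" by standard
  have S': "S \<in> sets (fibre_prod (Suc n) x)" using S by (simp only: sets_fibre_prod[OF x])
  have ins: "insert_at n 0 \<in> nufib G x \<Otimes>\<^sub>M fibre_prod n x \<rightarrow>\<^sub>M fibre_prod (Suc n) x"
    by (rule measurable_insert_at) simp
  have eq: "{w \<in> space (fibre_prod (Suc n) x). w \<in> S} = S"
    using sets.sets_into_space[OF S'] by auto
  have "AE p in nufib G x \<Otimes>\<^sub>M fibre_prod n x. insert_at n 0 p \<in> S"
  proof (rule NP.AE_pair_measure[OF _ ae])
    have "insert_at n 0 -` S \<inter> space (nufib G x \<Otimes>\<^sub>M fibre_prod n x) = {p \<in> space (nufib G x \<Otimes>\<^sub>M fibre_prod n x). insert_at n 0 p \<in> S}"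
      by auto
    then show "{p \<in> space (nufib G x \<Otimes>\<^sub>M fibre_prod n x). insert_at n 0 p \<in> S} \<in> sets (nufib G x \<Otimes>\<^sub>M fibre_prod n x)"
      using measurable_sets[OF ins S'] by simp
  qed
  then have "AE w in distr (nufib G x \<Otimes>\<^sub>M fibre_prod n x) (fibre_prod (Suc n) x) (insert_at n 0). w \<in> S"
    by (subst AE_distr_iff[OF ins]) (simp_all only: eq S')
  then show ?thesis
    unfolding distr_insert_at_fibre[OF x le0] .
qed

lemma pred_AE_insert_at:
  assumes S: "S \<in> sets (tuple_borel (Suc n))"
  shows "Measurable.pred (nu G) (\<lambda>g. AE w in fibre_prod n (tgt G g). insert_at n 0 (g, w) \<in> S)"
proof (rule pred_AE_kernel[OF fibre_prod_tgt_kernel])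
  have "insert_at n 0 \<in> nu G \<Otimes>\<^sub>M tuple_borel n \<rightarrow>\<^sub>M tuple_borel (Suc n)"
    by (rule measurable_insert_at) simp
  from pred_sets2[OF S this]
  show "Measurable.pred (nu G \<Otimes>\<^sub>M tuple_borel n) (\<lambda>p. insert_at n 0 (fst p, snd p) \<in> S)" by simp
qed

text \<open>Disintegrating \<open>nu G\<close> needs predicates of the arrow alone; since almost
  every arrow of the fibre has target \<open>x\<close>, the base point may be written either
  way.\<close>

lemma AE_nufib_tgt_cong:
  assumes x: "x \<in> unit_space G"
  shows "(AE g in nufib G x. P (tgt G g) g) \<longleftrightarrow> (AE g in nufib G x. P x g)"
proof -
  have tgt: "AE g in nufib G x. tgt G g = x"
    using AE_nufib_fibre[OF x] by eventually_elim (simp add: fibre_def)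
  show ?thesis
  proof
    assume "AE g in nufib G x. P (tgt G g) g"
    with tgt show "AE g in nufib G x. P x g" by eventually_elim simp
  next
    assume "AE g in nufib G x. P x g"
    with tgt show "AE g in nufib G x. P (tgt G g) g" by eventually_elim simp
  qed
qed

lemma insert_at_in_tuples:
  assumes "g \<in> fibre G x" "w \<in> space (tuple_borel n)" "\<forall>i<n. w i \<in> fibre G x"
  shows "insert_at n 0 (g, w) \<in> tuples G (Suc n)"
  using assms
  by (auto simp: tuples_def insert_at_def fibre_def less_Suc_eq_0_disj)

lemma AE_insert_at_in_tuples:
  assumes g: "g \<in> arrows G"
  shows "AE w in fibre_prod n (tgt G g). insert_at n 0 (g, w) \<in> tuples G (Suc n)"
  using AE_fibre_prod_fibre[OF tgt_in_unit_space[OF g], of n] AE_space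
proof eventually_elim
  case (elim w)
  then show ?case
    using g by (intro insert_at_in_tuples[of g "tgt G g"])
      (auto simp: fibre_def space_fibre_prod tgt_in_unit_space)
qed

text \<open>The invariance condition concerns tuples whose entry 0 acts on the others. Here that
  entry is distributed by \<open>nu G\<close> and the others lie over its target, so the arrow can
  be fixed first.\<close>

lemma AE_nu_tuples_SucD:
  assumes "AE w in nu_tuples G (Suc n). P w"
  shows "AE g in nu G. AE w in fibre_prod n (tgt G g). P (insert_at n 0 (g, w))"
proof -
  obtain S where S: "S \<in> sets (tuple_borel (Suc n))" "\<And>w. w \<in> tuples G (Suc n) \<Longrightarrow> w \<in> S \<Longrightarrow> P w"
    "AE x in mu G. AE w in fibre_prod (Suc n) x. w \<in> S"
    using assms by (rule AE_nu_tuplesE) blast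
  have "AE x in mu G. AE g in nufib G x. AE w in fibre_prod n (tgt G g). insert_at n 0 (g, w) \<in> S"
    using S(3) AE_space
  proof eventually_elim
    case (elim x)
    then have x: "x \<in> unit_space G" by (simp add: space_mu)
    have "AE g in nufib G x. AE w in fibre_prod n x. insert_at n 0 (g, w) \<in> S"
      using x elim(1) by (rule AE_fibre_prod_SucD)
    then show ?case
      using AE_nufib_tgt_cong[OF x, of "\<lambda>y g. AE w in fibre_prod n y. insert_at n 0 (g, w) \<in> S"] by simp
  qed
  then have "AE g in nu G. AE w in fibre_prod n (tgt G g). insert_at n 0 (g, w) \<in> S"
    by (subst AE_nu_iff[OF pred_AE_insert_at[OF S(1)]])
  with AE_space show ?thesis
  proof eventually_elim
    case (elim g)
    then have g: "g \<in> arrows G" by (simp add: space_eq)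
    from AE_insert_at_in_tuples[OF g, of n] elim(2) show ?case
      by eventually_elim (rule S(2))
  qed
qed

lemma AE_nu_tuples_SucI:
  assumes ae: "AE g in nu G. AE w in fibre_prod n (tgt G g). P (insert_at n 0 (g, w))"
    and P: "Measurable.pred (nu_tuples G (Suc n)) P"
  shows "AE w in nu_tuples G (Suc n). P w"
proof (rule AE_nu_tuplesI[OF _ P])
  let ?S = "{w \<in> tuples G (Suc n). P w}"
  have S: "?S \<in> sets (tuple_borel (Suc n))" by (rule sets_tuples_Collect[OF P])
  have "AE g in nu G. AE w in fibre_prod n (tgt G g). insert_at n 0 (g, w) \<in> ?S"
    using ae AE_space
  proof eventually_elim
    case (elim g)
    then have g: "g \<in> arrows G" by (simp add: space_eq)
    from AE_insert_at_in_tuples[OF g, of n] elim(1) show ?case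
      by eventually_elim simp
  qed
  then have "AE x in mu G. AE g in nufib G x. AE w in fibre_prod n (tgt G g). insert_at n 0 (g, w) \<in> ?S"
    by (subst (asm) AE_nu_iff[OF pred_AE_insert_at[OF S]])
  then show "AE x in mu G. AE w in fibre_prod (Suc n) x. P w"
    using AE_space
  proof eventually_elim
    case (elim x)
    then have x: "x \<in> unit_space G" by (simp add: space_mu)
    have "AE g in nufib G x. AE w in fibre_prod n x. insert_at n 0 (g, w) \<in> ?S"
      using elim(1) AE_nufib_tgt_cong[OF x, of "\<lambda>y g. AE w in fibre_prod n y. insert_at n 0 (g, w) \<in> ?S"] by simp
    then have "AE w in fibre_prod (Suc n) x. w \<in> ?S"
      by (rule AE_fibre_prod_SucI[OF x S])
    then show ?case by eventually_elim simp
  qed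
qed

lemma integrable_indicator_fibre_prod:
  assumes x: "x \<in> unit_space G" and A: "A \<in> sets (tuple_borel n)"
  shows "integrable (fibre_prod n x) (indicator A :: _ \<Rightarrow> real)"
proof -
  interpret prob_space "fibre_prod n x" by (rule prob_space_fibre_prod[OF x])
  show ?thesis
    using A by (intro integrable_real_indicator) (simp_all add: sets_fibre_prod x less_top[symmetric])
qed

lemma countable_pi_system_tuple_borel:
  obtains C where "countable C" "Int_stable C" "C \<subseteq> Pow (space (tuple_borel n))"
    "space (tuple_borel n) \<in> C" "sets (tuple_borel n) = sigma_sets (space (tuple_borel n)) C"
proof -
  obtain B where "countable B" "Int_stable B" "B \<subseteq> Pow (space (nu G))" "space (nu G) \<in> B"
    "sets (nu G) = sigma_sets (space (nu G)) B"
    using standard by (rule standard_borel_countable_pi_system)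
  then show thesis
    by (rule countable_pi_system_PiM[OF _ _ _ _ _ finite_lessThan]) (rule that)
qed

end

section \<open>Means of fibrewise integrals\<close>

locale measured_groupoid_means = measured_groupoid G for G :: "'a measured_groupoid_data" +
  fixes m :: "'a \<Rightarrow> ('a \<Rightarrow> real) \<Rightarrow> real"
  assumes means: "invariant_system_of_means G m"
begin

definition fibre_mean :: "nat \<Rightarrow> ((nat \<Rightarrow> 'a) \<Rightarrow> real) \<Rightarrow> 'a \<Rightarrow> ((nat \<Rightarrow> 'a) \<Rightarrow> real) \<Rightarrow> real" where
  "fibre_mean n f x \<phi> = m x (\<lambda>g. \<integral>w. f (insert_at n 0 (g, w)) * \<phi> w \<partial>fibre_prod n x)"

lemma mean_space: "x \<in> unit_space G \<Longrightarrow> mean_space (nufib G x) (m x)"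
  using means by (intro mean_space.intro mean_space_axioms.intro prob_space_nufib)
    (auto simp: invariant_system_of_means_def)

lemma mean_product:
  assumes x: "x \<in> unit_space G" and f: "f \<in> borel_measurable (tuple_borel (Suc n))" "\<And>w. \<bar>f w\<bar> \<le> c"
  shows "mean_product (nufib G x) (m x) (fibre_prod n x) (\<lambda>p. f (insert_at n 0 p)) c"
proof (intro mean_product.intro mean_product_axioms.intro mean_space x prob_space_fibre_prod f)
  have "insert_at n 0 \<in> nu G \<Otimes>\<^sub>M tuple_borel n \<rightarrow>\<^sub>M tuple_borel (Suc n)"
    by (rule measurable_insert_at) simp
  from measurable_compose[OF this f(1)]
  show "(\<lambda>p. f (insert_at n 0 p)) \<in> borel_measurable (nufib G x \<Otimes>\<^sub>M fibre_prod n x)"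
    by (simp only: measurable_cong_sets[OF sets_nufib_fibre_prod[OF x] refl])
qed

lemma fibre_mean_eq_pairing:
  assumes x: "x \<in> unit_space G" and f: "f \<in> borel_measurable (tuple_borel (Suc n))" "\<And>w. \<bar>f w\<bar> \<le> c"
  shows "fibre_mean n f x \<phi> = m x (mean_product.pairing (fibre_prod n x) (\<lambda>p. f (insert_at n 0 p)) \<phi>)"
  unfolding fibre_mean_def mean_product.pairing_def[OF mean_product[OF assms], abs_def] by simp

text \<open>Integration is over the fibre of \<open>tgt G g\<close>, so one function on the groupoid
  serves all base points. Measurability and invariance of the means are available only for
  restrictions of such a global function.\<close>

definition section_integral :: "nat \<Rightarrow> ((nat \<Rightarrow> 'a) \<Rightarrow> real) \<Rightarrow> (nat \<Rightarrow> 'a) set \<Rightarrow> 'a \<Rightarrow> real" where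
  "section_integral n f A g = (\<integral>w. f (insert_at n 0 (g, w)) * indicator A w \<partial>fibre_prod n (tgt G g))"

context
  fixes n :: nat and f :: "(nat \<Rightarrow> 'a) \<Rightarrow> real" and c :: real and A :: "(nat \<Rightarrow> 'a) set"
  assumes f: "f \<in> borel_measurable (tuple_borel (Suc n))" "\<And>w. \<bar>f w\<bar> \<le> c"
    and A: "A \<in> sets (tuple_borel n)"
begin

lemma abs_section_integral_le:
  assumes g: "g \<in> arrows G"
  shows "\<bar>section_integral n f A g\<bar> \<le> c"
proof -
  note y = tgt_in_unit_space[OF g]
  interpret mean_product "nufib G (tgt G g)" "m (tgt G g)" "fibre_prod n (tgt G g)" "\<lambda>p. f (insert_at n 0 p)" c
    by (rule mean_product[OF y f])
  have "\<bar>pairing (indicator A) g\<bar> \<le> c * (\<integral>w. \<bar>indicator A w\<bar> \<partial>fibre_prod n (tgt G g))"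
    using g by (intro pairing_bound integrable_indicator_fibre_prod A y) (simp add: space_nufib y)
  also have "\<dots> = c * measure (fibre_prod n (tgt G g)) A"
    using sets.sets_into_space[OF A] by (simp add: space_fibre_prod[OF y] Int_absorb2)
  also have "\<dots> \<le> c * 1"
    by (intro mult_left_mono c_nonneg) simp
  finally show ?thesis by (simp add: section_integral_def pairing_def)
qed

lemma section_integral_bounded_borel: "section_integral n f A \<in> bounded_borel_fun (nu G)"
proof -
  have "section_integral n f A \<in> borel_measurable (nu G)"
    unfolding section_integral_def[abs_def]
  proof (rule integral_measurable_subprob_algebra2[OF _ fibre_prod_tgt_kernel])
    have ins: "insert_at n 0 \<in> nu G \<Otimes>\<^sub>M tuple_borel n \<rightarrow>\<^sub>M tuple_borel (Suc n)"
      by (rule measurable_insert_at) simp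
    note measurable_compose[OF ins f(1), measurable] A [measurable]
    show "(\<lambda>(g, w). f (insert_at n 0 (g, w)) * indicator A w) \<in> borel_measurable (nu G \<Otimes>\<^sub>M tuple_borel n)"
      by (simp add: case_prod_unfold) measurable
  qed
  then show ?thesis
    using abs_section_integral_le unfolding bounded_borel_fun_def by (auto simp: space_eq)
qed

text \<open>The two integrands agree on the fibre over \<open>x\<close>, which carries the whole of
  \<open>nufib G x\<close>, and a mean ignores null sets.\<close>

lemma fibre_mean_eq_fibre_restrict:
  assumes x: "x \<in> unit_space G"
  shows "fibre_mean n f x (indicator A) = m x (fibre_restrict G (section_integral n f A) x)"
proof -
  let ?l = "section_integral n f A"
  interpret mean_product "nufib G x" "m x" "fibre_prod n x" "\<lambda>p. f (insert_at n 0 p)" c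
    by (rule mean_product[OF x f])
  have "fibre G x \<in> sets (nufib G x)"
    using sets_fibre unit_space_subset x by (auto simp: sets_nufib)
  then have meas: "fibre_restrict G ?l x \<in> borel_measurable (nufib G x)"
    using section_integral_bounded_borel unfolding fibre_restrict_def bounded_borel_fun_def
    by (intro measurable_If_set) (auto simp: measurable_cong_sets[OF sets_nufib[OF x] refl])
  have bound: "\<exists>C. AE g in nufib G x. \<bar>fibre_restrict G ?l x g\<bar> \<le> C"
  proof (intro exI AE_I2)
    fix g assume "g \<in> space (nufib G x)"
    then show "\<bar>fibre_restrict G ?l x g\<bar> \<le> c"
      using abs_section_integral_le c_nonneg x by (auto simp: fibre_restrict_def space_nufib)
  qed
  have "AE g in nufib G x. pairing (indicator A) g = fibre_restrict G ?l x g"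
    using AE_nufib_fibre[OF x]
    by eventually_elim (simp add: fibre_restrict_def pairing_def section_integral_def fibre_def)
  then show ?thesis
    unfolding fibre_mean_eq_pairing[OF x f]
    using meas bound
    by (intro mean_cong pairing_ess_bounded integrable_indicator_fibre_prod A x) (simp add: ess_bounded_fun_def)
qed

text \<open>The measurability clause of an invariant system of means enters here.\<close>

lemma borel_measurable_fibre_mean:
  "(\<lambda>x. fibre_mean n f x (indicator A)) \<in> borel_measurable (unit_borel G)"
proof -
  have "(\<lambda>x. m x (fibre_restrict G (section_integral n f A) x)) \<in> borel_measurable (unit_borel G)"
    using means section_integral_bounded_borel by (simp add: invariant_system_of_means_def)
  then show ?thesis
    by (subst measurable_cong[of "unit_borel G" _ "\<lambda>x. m x (fibre_restrict G (section_integral n f A) x)"])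
      (simp_all add: space_unit_borel fibre_mean_eq_fibre_restrict)
qed

end

end

subsection \<open>The contracting homotopy\<close>

type_synonym ('a, 'v) cochain = "(nat \<Rightarrow> 'a) \<Rightarrow> 'v \<Rightarrow>\<^sub>L real"

text \<open>All averages of \<open>f\<close> lie in the closed interval from \<open>-c\<close> to
  \<open>c\<close>, hence so do almost all of its values.\<close>

lemma (in finite_measure) AE_abs_le_of_integral_le:
  fixes f :: "'a \<Rightarrow> real"
  assumes f: "integrable M f"
    and le: "\<And>A. A \<in> sets M \<Longrightarrow> \<bar>\<integral>x. f x * indicator A x \<partial>M\<bar> \<le> c * measure M A"
  shows "AE x in M. \<bar>f x\<bar> \<le> c"
proof -
  have "AE x in M. f x \<in> {-c..c}"
  proof (rule averaging_theorem[OF f])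
    fix A assume A: "A \<in> sets M" "0 < measure M A"
    have "\<bar>(1 / measure M A) * (\<integral>x. f x * indicator A x \<partial>M)\<bar> \<le> (1 / measure M A) * (c * measure M A)"
      unfolding abs_mult using le[OF A(1)] A(2) by (intro mult_mono) auto
    also have "\<dots> = c" using A(2) by simp
    finally have "(1 / measure M A) * (\<integral>x. f x * indicator A x \<partial>M) \<in> {-c..c}"
      unfolding abs_le_iff by simp
    then show "(1 / measure M A) *\<^sub>R set_lebesgue_integral M A f \<in> {-c..c}"
      by (simp only: set_lebesgue_integral_def real_scaleR_def mult.commute[of "indicator A _"])
  qed auto
  then show ?thesis by eventually_elim auto
qed

section \<open>Densities of the fibre means\<close>

context measured_groupoid_means
begin

text \<open>The constant term survives because a mean fixes constants. This permits rescaling a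
  bounded cochain into the unit interval.\<close>

lemma fibre_mean_affine:
  assumes x: "x \<in> unit_space G" and f: "f \<in> borel_measurable (tuple_borel (Suc n))" "\<And>w. \<bar>f w\<bar> \<le> c"
    and \<phi>: "integrable (fibre_prod n x) \<phi>"
  shows "fibre_mean n (\<lambda>w. a * f w + b) x \<phi> = a * fibre_mean n f x \<phi> + b * (\<integral>w. \<phi> w \<partial>fibre_prod n x)"
proof -
  interpret F: mean_product "nufib G x" "m x" "fibre_prod n x" "\<lambda>p. f (insert_at n 0 p)" c
    by (rule mean_product[OF x f])
  have f': "(\<lambda>w. a * f w + b) \<in> borel_measurable (tuple_borel (Suc n))" "\<And>w. \<bar>a * f w + b\<bar> \<le> \<bar>a\<bar> * c + \<bar>b\<bar>"
    using f(1) f(2) by (auto intro!: abs_triangle_ineq[THEN order_trans] add_mono mult_left_mono simp: abs_mult)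
  interpret F': mean_product "nufib G x" "m x" "fibre_prod n x" "\<lambda>p. a * f (insert_at n 0 p) + b" "\<bar>a\<bar> * c + \<bar>b\<bar>"
    by (rule mean_product[OF x f'])
  let ?I = "\<integral>w. \<phi> w \<partial>fibre_prod n x"
  have "AE g in nufib G x. F'.pairing \<phi> g = a * F.pairing \<phi> g + b * ?I"
  proof (rule AE_I2)
    fix g assume g: "g \<in> space (nufib G x)"
    have "F'.pairing \<phi> g = (\<integral>w. a * (f (insert_at n 0 (g, w)) * \<phi> w) + b * \<phi> w \<partial>fibre_prod n x)"
      unfolding F'.pairing_def by (intro Bochner_Integration.integral_cong refl) (simp add: algebra_simps)
    also have "\<dots> = a * F.pairing \<phi> g + b * ?I"
      using F.section_integrable[OF g \<phi>] \<phi> by (simp add: F.pairing_def)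
    finally show "F'.pairing \<phi> g = a * F.pairing \<phi> g + b * ?I" .
  qed
  then have "m x (F'.pairing \<phi>) = m x (\<lambda>g. a * F.pairing \<phi> g + b * ?I)"
    by (intro F.mean_cong F'.pairing_ess_bounded \<phi> ess_bounded_fun_add ess_bounded_fun_cmult
        ess_bounded_fun_const F.pairing_ess_bounded)
  also have "\<dots> = a * m x (F.pairing \<phi>) + b * ?I"
    by (simp add: F.mean_add F.mean_cmult F.mean_const ess_bounded_fun_cmult ess_bounded_fun_const
        F.pairing_ess_bounded \<phi>)
  finally show ?thesis
    unfolding fibre_mean_eq_pairing[OF x f] fibre_mean_eq_pairing[OF x f'] .
qed

lemma fibre_mean_add:
  assumes x: "x \<in> unit_space G"
    and f: "f \<in> borel_measurable (tuple_borel (Suc n))" "\<And>w. \<bar>f w\<bar> \<le> c"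
    and g: "g \<in> borel_measurable (tuple_borel (Suc n))" "\<And>w. \<bar>g w\<bar> \<le> d"
    and \<phi>: "integrable (fibre_prod n x) \<phi>"
  shows "fibre_mean n (\<lambda>w. f w + g w) x \<phi> = fibre_mean n f x \<phi> + fibre_mean n g x \<phi>"
proof -
  interpret F: mean_product "nufib G x" "m x" "fibre_prod n x" "\<lambda>p. f (insert_at n 0 p)" c
    by (rule mean_product[OF x f])
  interpret H: mean_product "nufib G x" "m x" "fibre_prod n x" "\<lambda>p. g (insert_at n 0 p)" d
    by (rule mean_product[OF x g])
  have fg: "(\<lambda>w. f w + g w) \<in> borel_measurable (tuple_borel (Suc n))" "\<And>w. \<bar>f w + g w\<bar> \<le> c + d"
    using f g by (auto intro!: abs_triangle_ineq[THEN order_trans] add_mono)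
  interpret FH: mean_product "nufib G x" "m x" "fibre_prod n x" "\<lambda>p. f (insert_at n 0 p) + g (insert_at n 0 p)" "c + d"
    by (rule mean_product[OF x fg])
  have "AE h in nufib G x. FH.pairing \<phi> h = F.pairing \<phi> h + H.pairing \<phi> h"
    using F.section_integrable[OF _ \<phi>] H.section_integrable[OF _ \<phi>]
    by (intro AE_I2) (simp add: F.pairing_def H.pairing_def FH.pairing_def distrib_right)
  then have "m x (FH.pairing \<phi>) = m x (\<lambda>h. F.pairing \<phi> h + H.pairing \<phi> h)"
    by (intro F.mean_cong ess_bounded_fun_add FH.pairing_ess_bounded F.pairing_ess_bounded H.pairing_ess_bounded \<phi>)
  also have "\<dots> = m x (F.pairing \<phi>) + m x (H.pairing \<phi>)"
    by (intro F.mean_add F.pairing_ess_bounded H.pairing_ess_bounded \<phi>)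
  finally show ?thesis
    unfolding fibre_mean_eq_pairing[OF x f] fibre_mean_eq_pairing[OF x g] fibre_mean_eq_pairing[OF x fg] .
qed

lemma fibre_mean_bound:
  assumes x: "x \<in> unit_space G" and f: "f \<in> borel_measurable (tuple_borel (Suc n))" "\<And>w. \<bar>f w\<bar> \<le> c"
    and \<phi>: "integrable (fibre_prod n x) \<phi>"
  shows "\<bar>fibre_mean n f x \<phi>\<bar> \<le> c * (\<integral>w. \<bar>\<phi> w\<bar> \<partial>fibre_prod n x)"
  unfolding fibre_mean_eq_pairing[OF x f] by (rule mean_product.mean_pairing_bound[OF mean_product[OF x f] \<phi>])

lemma integral_indicator_fibre_prod:
  assumes x: "x \<in> unit_space G" and A: "A \<in> sets (tuple_borel n)"
  shows "(\<integral>w. indicator A w \<partial>fibre_prod n x) = measure (fibre_prod n x) A"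
  using sets.sets_into_space[OF A] by (simp add: space_fibre_prod[OF x] Int_absorb2)

text \<open>\<open>H\<close> comes without a pointwise bound, so integrability is part of the
  condition. Only the measure refers to \<open>x\<close>: the same function \<open>H\<close> must
  serve every fibre.\<close>

definition mean_density :: "nat \<Rightarrow> ((nat \<Rightarrow> 'a) \<Rightarrow> real) \<Rightarrow> ((nat \<Rightarrow> 'a) \<Rightarrow> real) \<Rightarrow> 'a \<Rightarrow> bool" where
  "mean_density n f H x \<longleftrightarrow> (\<forall>A\<in>sets (tuple_borel n).
    has_bochner_integral (fibre_prod n x) (\<lambda>w. H w * indicator A w) (fibre_mean n f x (indicator A)))"

text \<open>Says that \<open>h\<close> is the fibrewise average of \<open>f\<close> over its first
  variable in the weak sense, against all integrable test functions, as integrating out an entry and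
  changing variables by a density both require.\<close>

definition dual_mean_density :: "nat \<Rightarrow> ('a, 'v::real_normed_vector) cochain \<Rightarrow> ('a, 'v) cochain \<Rightarrow> 'a \<Rightarrow> bool" where
  "dual_mean_density n f h x \<longleftrightarrow> (\<forall>v \<phi>. integrable (fibre_prod n x) \<phi> \<longrightarrow>
    fibre_mean n (\<lambda>w. f w v) x \<phi> = (\<integral>w. h w v * \<phi> w \<partial>fibre_prod n x))"

text \<open>In the unit interval the set functions are measures below the fibre products, so the
  Radon-Nikodym theorem for kernels applies.\<close>

lemma scalar_homotopy_unit_interval:
  assumes f: "f \<in> borel_measurable (tuple_borel (Suc (Suc k)))" and f0: "\<And>w. 0 \<le> f w" and f1: "\<And>w. f w \<le> 1"
  obtains H where "H \<in> borel_measurable (tuple_borel (Suc k))"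
    "AE x in mu G. mean_density (Suc k) f H x"
proof -
  have fb: "\<bar>f w\<bar> \<le> 1" for w using f0[of w] f1[of w] by simp
  let ?n = "Suc k"
  let ?B = "tuple_borel ?n" and ?Q = "fibre_prod ?n" and ?M = "fibre_mean ?n"
  have ex: "\<exists>\<kappa>. sets \<kappa> = sets (?B) \<and>
      (\<forall>A\<in>sets (?B). emeasure \<kappa> A = ennreal (?M f x (indicator A)) \<and>
        emeasure \<kappa> A \<le> emeasure (?Q x) A)" if x: "x \<in> unit_space G" for x
  proof -
    interpret mean_product "nufib G x" "m x" "?Q x" "\<lambda>p. f (insert_at ?n 0 p)" 1
      by (rule mean_product[OF x f fb])
    obtain \<kappa> where "sets \<kappa> = sets (?Q x)"
      "\<And>A. A \<in> sets (?Q x) \<Longrightarrow> emeasure \<kappa> A = ennreal (m x (pairing (indicator A)))"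
      "\<And>A. A \<in> sets (?Q x) \<Longrightarrow> emeasure \<kappa> A \<le> emeasure (?Q x) A"
      by (rule kernel_measure) (simp_all add: f0)
    then show ?thesis
      using fibre_mean_eq_pairing[OF x f fb] sets_fibre_prod[OF x, of ?n] by (intro exI[of _ \<kappa>]) simp
  qed
  then obtain K where K_sets: "\<And>x. x \<in> unit_space G \<Longrightarrow> sets (K x) = sets (?B)"
    and K_eq: "\<And>x A. x \<in> unit_space G \<Longrightarrow> A \<in> sets (?B) \<Longrightarrow>
      emeasure (K x) A = ennreal (?M f x (indicator A))"
    and K_le: "\<And>x A. x \<in> unit_space G \<Longrightarrow> A \<in> sets (?B) \<Longrightarrow>
      emeasure (K x) A \<le> emeasure (?Q x) A"
    by metis
  \<comment> \<open>\<open>K\<close> was chosen separately for each \<open>x\<close>, but its values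
    on sets are prescribed, so measurability in \<open>x\<close> is that of the fibre means.\<close>
  have K_kernel: "K \<in> mu G \<rightarrow>\<^sub>M subprob_algebra (?B)"
  proof (rule measurable_subprob_algebra)
    fix x assume "x \<in> space (mu G)"
    then have x: "x \<in> unit_space G" by (simp add: space_mu)
    interpret prob_space "?Q x" by (rule prob_space_fibre_prod[OF x])
    have sp: "space (K x) = space (?B)" by (rule sets_eq_imp_space_eq[OF K_sets[OF x]])
    show "subprob_space (K x)"
    proof
      show "emeasure (K x) (space (K x)) \<le> 1"
        using K_le[OF x sets.top] emeasure_space_1 by (simp add: sp space_fibre_prod[OF x])
      show "space (K x) \<noteq> {}" using not_empty by (simp add: sp space_fibre_prod[OF x])
    qed
    show "sets (K x) = sets (?B)" by (rule K_sets[OF x])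
  next
    fix A assume A: "A \<in> sets (?B)"
    have "(\<lambda>x. ennreal (?M f x (indicator A))) \<in> borel_measurable (unit_borel G)"
      using borel_measurable_fibre_mean[OF f fb A] by simp
    then have "(\<lambda>x. emeasure (K x) A) \<in> borel_measurable (unit_borel G)"
      by (subst measurable_cong[of "unit_borel G" _ "\<lambda>x. ennreal (?M f x (indicator A))"])
        (simp_all add: space_unit_borel K_eq A)
    then show "(\<lambda>x. emeasure (K x) A) \<in> borel_measurable (mu G)"
      by (simp only: measurable_cong_sets[OF sets_mu refl])
  qed
  obtain C where C: "countable C" "Int_stable C" "C \<subseteq> Pow (space (?B))"
    "space (?B) \<in> C" "sets (?B) = sigma_sets (space (?B)) C"
    by (rule countable_pi_system_tuple_borel)
  obtain H0 where H0: "H0 \<in> borel_measurable (mu G \<Otimes>\<^sub>M ?B)"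
    and H0_eq: "AE x in mu G. K x = density (?Q x) (\<lambda>w. H0 (x, w))"
  proof (rule kernel_Radon_Nikodym[OF prob_space.finite_measure[OF prob_space_mu] fibre_prod_kernel_mu K_kernel _ C])
    show "emeasure (K x) A \<le> emeasure (?Q x) A" if "x \<in> space (mu G)" "A \<in> sets (?B)" for x A
      using that by (intro K_le) (simp_all add: space_mu)
  qed blast
  \<comment> \<open>The base point is read off from entry 0, which exists because the tuples have
    \<open>Suc k\<close> entries. Infinite density values become 0; they occur on null sets only, as
    the total masses are finite.\<close>
  define H where "H w = enn2real (H0 (tgt G (w 0), w))" for w
  have "(\<lambda>w. tgt G (w 0)) \<in> ?B \<rightarrow>\<^sub>M mu G"
    using measurable_compose[OF measurable_tuple_component[of 0 ?n] measurable_tgt_unit]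
    by (simp add: measurable_cong_sets[OF refl sets_mu])
  from measurable_compose[OF measurable_Pair[OF this measurable_ident] H0]
  have H_meas: "H \<in> borel_measurable (?B)" unfolding H_def[abs_def] by simp
  have "AE x in mu G. mean_density ?n f H x"
    using H0_eq AE_space
  proof eventually_elim
    case (elim x)
    then have x: "x \<in> unit_space G" by (simp add: space_mu)
    note sf = sets_fibre_prod[OF x, of ?n]
    interpret P: prob_space "?Q x" by (rule prob_space_fibre_prod[OF x])
    have H0x [measurable]: "(\<lambda>w. H0 (x, w)) \<in> borel_measurable (?Q x)"
      unfolding measurable_cong_sets[OF sf refl]
      by (rule measurable_compose[OF measurable_Pair1' H0]) (simp add: space_mu x)
    have int: "(\<integral>\<^sup>+w. H0 (x, w) * indicator A w \<partial>?Q x) = ennreal (?M f x (indicator A))"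
      if A: "A \<in> sets (?B)" for A
      using K_eq[OF x A] A sf unfolding elim(1) by (simp add: emeasure_density)
    have "(\<integral>\<^sup>+w. H0 (x, w) \<partial>?Q x) = (\<integral>\<^sup>+w. H0 (x, w) * indicator (space (?B)) w \<partial>?Q x)"
      by (intro nn_integral_cong) (simp add: space_fibre_prod[OF x])
    then have "(\<integral>\<^sup>+w. H0 (x, w) \<partial>?Q x) \<noteq> \<infinity>"
      using int[OF sets.top] by simp
    then have fin: "AE w in ?Q x. H0 (x, w) \<noteq> \<infinity>"
      by (intro nn_integral_PInf_AE) auto
    have tgt: "AE w in ?Q x. tgt G (w 0) = x"
      using AE_fibre_prod_fibre[OF x, of ?n] by eventually_elim (auto simp: fibre_def)
    show ?case
      unfolding mean_density_def
    proof
      fix A assume A: "A \<in> sets (?B)"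
      show "has_bochner_integral (?Q x) (\<lambda>w. H w * indicator A w) (?M f x (indicator A))"
      proof (rule has_bochner_integral_nn_integral)
        show "(\<lambda>w. H w * indicator A w) \<in> borel_measurable (?Q x)"
          unfolding measurable_cong_sets[OF sf refl] using H_meas A by simp
        show "AE w in ?Q x. 0 \<le> H w * indicator A w" by (simp add: H_def)
        show "0 \<le> ?M f x (indicator A)"
        proof -
          interpret mean_product "nufib G x" "m x" "?Q x" "\<lambda>p. f (insert_at ?n 0 p)" 1
            by (rule mean_product[OF x f fb])
          show ?thesis
            unfolding fibre_mean_eq_pairing[OF x f fb] using f0
            by (intro mean_nonneg pairing_ess_bounded integrable_indicator_fibre_prod x A) (auto simp: pairing_def)
        qed
        have "(\<integral>\<^sup>+w. ennreal (H w * indicator A w) \<partial>?Q x) = (\<integral>\<^sup>+w. H0 (x, w) * indicator A w \<partial>?Q x)"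
        proof (rule nn_integral_cong_AE)
          show "AE w in ?Q x. ennreal (H w * indicator A w) = H0 (x, w) * indicator A w"
            using fin tgt by eventually_elim (auto simp: H_def indicator_def less_top)
        qed
        then show "(\<integral>\<^sup>+w. ennreal (H w * indicator A w) \<partial>?Q x) = ennreal (?M f x (indicator A))"
          using int[OF A] by simp
      qed
    qed
  qed
  with H_meas show thesis by (rule that)
qed

lemma scalar_homotopy:
  assumes f: "f \<in> borel_measurable (tuple_borel (Suc (Suc k)))" and fb: "\<And>w. \<bar>f w\<bar> \<le> c"
  obtains H where "H \<in> borel_measurable (tuple_borel (Suc k))"
    "AE x in mu G. mean_density (Suc k) f H x"
proof -
  have c: "0 \<le> c" using fb[of undefined] by linarith
  \<comment> \<open>Shifting and dividing with \<open>c + 1\<close> instead of \<open>c\<close>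
    keeps the denominator positive when \<open>c = 0\<close>.\<close>
  define f0 where "f0 w = (f w + (c + 1)) / (2 * (c + 1))" for w
  have f_le: "f w \<le> c" "- c \<le> f w" for w using fb[of w] by (simp_all add: abs_le_iff)
  have f0: "f0 \<in> borel_measurable (tuple_borel (Suc (Suc k)))" "0 \<le> f0 w" "f0 w \<le> 1" for w
    using f f_le[of w] c by (auto simp: f0_def[abs_def] field_simps)
  then have f0b: "\<bar>f0 w\<bar> \<le> 1" for w by simp
  have f_eq: "f = (\<lambda>w. 2 * (c + 1) * f0 w + (- (c + 1)))"
    using c by (auto simp: f0_def field_simps)
  obtain H where H: "H \<in> borel_measurable (tuple_borel (Suc k))"
    and H_int: "AE x in mu G. mean_density (Suc k) f0 H x"
    by (rule scalar_homotopy_unit_interval[OF f0])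
  show thesis
  proof (rule that)
    show "(\<lambda>w. 2 * (c + 1) * H w + (- (c + 1))) \<in> borel_measurable (tuple_borel (Suc k))"
      using H by simp
    show "AE x in mu G. mean_density (Suc k) f (\<lambda>w. 2 * (c + 1) * H w + (- (c + 1))) x"
      using H_int AE_space
    proof eventually_elim
      case (elim x)
      then have x: "x \<in> unit_space G" by (simp add: space_mu)
      show ?case
        unfolding mean_density_def
      proof
        fix A assume A: "A \<in> sets (tuple_borel (Suc k))"
        note int = integrable_indicator_fibre_prod[OF x A]
        have "has_bochner_integral (fibre_prod (Suc k) x)
            (\<lambda>w. 2 * (c + 1) * (H w * indicator A w) + (- (c + 1)) * indicator A w)
            (2 * (c + 1) * fibre_mean (Suc k) f0 x (indicator A) + (- (c + 1)) * (\<integral>w. indicator A w \<partial>fibre_prod (Suc k) x))"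
          using elim(1)[unfolded mean_density_def] A int
          by (intro has_bochner_integral_add has_bochner_integral_mult_right has_bochner_integral_integrable) auto
        moreover have "fibre_mean (Suc k) f x (indicator A) =
          2 * (c + 1) * fibre_mean (Suc k) f0 x (indicator A) + (- (c + 1)) * (\<integral>w. indicator A w \<partial>fibre_prod (Suc k) x)"
          by (subst f_eq) (rule fibre_mean_affine[OF x f0(1) f0b int])
        ultimately show "has_bochner_integral (fibre_prod (Suc k) x)
            (\<lambda>w. (2 * (c + 1) * H w + (- (c + 1))) * indicator A w) (fibre_mean (Suc k) f x (indicator A))"
          by (simp only: distrib_right mult.assoc)
      qed
    qed
  qed
qed

text \<open>The densities \<open>U v\<close> are found independently for each \<open>v\<close>. The
  means are linear in the vector, which forces the inequalities of
  \<open>dual_valued_selection\<close> almost everywhere; the selected functional then represents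
  the means first on \<open>D\<close>, next for all vectors, and last for all integrable test
  functions.\<close>

lemma dual_homotopy:
  fixes f :: "('a, 'v::{real_normed_vector, second_countable_topology}) cochain"
  assumes f: "\<And>v. (\<lambda>w. f w v) \<in> borel_measurable (tuple_borel (Suc (Suc k)))"
    and f_bound: "\<And>w. norm (f w) \<le> C"
  obtains h :: "('a, 'v) cochain"
  where "\<And>v. (\<lambda>w. h w v) \<in> borel_measurable (tuple_borel (Suc k))" "\<And>w. norm (h w) \<le> C"
    "AE x in mu G. dual_mean_density (Suc k) f h x"
proof -
  let ?n = "Suc k"
  let ?B = "tuple_borel ?n" and ?Q = "fibre_prod ?n" and ?M = "fibre_mean ?n"
  have C: "0 \<le> C" using norm_ge_zero f_bound order_trans by blast
  note fv_bound = abs_blinfun_apply_le[OF f_bound]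
  obtain D :: "'v set" where D: "countable D" "closure D = UNIV"
    by (rule countable_dense_subset)
  let ?P = "\<lambda>v H. H \<in> borel_measurable (?B) \<and> (AE x in mu G. mean_density ?n (\<lambda>w. f w v) H x)"
  have "\<forall>v. \<exists>H. ?P v H"
  proof
    fix v
    obtain H where "H \<in> borel_measurable (?B)" "AE x in mu G. mean_density ?n (\<lambda>w. f w v) H x"
      by (rule scalar_homotopy[OF f fv_bound])
    then show "\<exists>H. ?P v H" by (intro exI conjI)
  qed
  then have "\<exists>U. \<forall>v. ?P v (U v)" by (rule choice)
  then obtain U where U_all: "\<forall>v. ?P v (U v)" ..
  have U: "U v \<in> borel_measurable (?B)" for v
    using U_all[rule_format, of v] by (rule conjunct1)
  have U_int: "AE x in mu G. mean_density ?n (\<lambda>w. f w v) (U v) x" for v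
    using U_all[rule_format, of v] by (rule conjunct2)
  obtain h :: "('a, 'v) cochain" where h: "\<And>v. (\<lambda>w. h w v) \<in> borel_measurable (?B)" "\<And>w. norm (h w) \<le> C"
    and h_eq: "\<And>w. \<forall>a\<in>\<rat>. \<forall>b\<in>\<rat>. \<forall>v1\<in>D. \<forall>v2\<in>D. \<forall>v3\<in>D.
      \<bar>a * U v1 w + b * U v2 w - U v3 w\<bar> \<le> C * norm (a *\<^sub>R v1 + b *\<^sub>R v2 - v3) \<Longrightarrow>
      \<forall>d\<in>D. h w d = U d w"
    by (rule dual_valued_selection[of D C U "?B", OF D C U]) (rule that)
  have "AE x in mu G. \<forall>v\<in>D. mean_density ?n (\<lambda>w. f w v) (U v) x"
    by (subst AE_ball_countable[OF D(1)]) (simp add: U_int)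
  then have "AE x in mu G. dual_mean_density ?n f h x"
    using AE_space
  proof eventually_elim
    case (elim x)
    then have x: "x \<in> unit_space G" by (simp add: space_mu)
    note sf = sets_fibre_prod[OF x, of ?n]
    interpret P: prob_space "?Q x" by (rule prob_space_fibre_prod[OF x])
    have Ux: "has_bochner_integral (?Q x) (\<lambda>w. U v w * indicator A w) (?M (\<lambda>w. f w v) x (indicator A))"
      if "v \<in> D" "A \<in> sets (?B)" for v A
      using elim(1) that unfolding mean_density_def by blast
    have lin: "?M (\<lambda>w. f w (a *\<^sub>R v1 + b *\<^sub>R v2 - v3)) x \<phi> =
        a * ?M (\<lambda>w. f w v1) x \<phi> + b * ?M (\<lambda>w. f w v2) x \<phi> - ?M (\<lambda>w. f w v3) x \<phi>"
      if \<phi>: "integrable (?Q x) \<phi>" for a b v1 v2 v3 \<phi>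
    proof -
      have scale: "?M (\<lambda>w. f w (a *\<^sub>R v)) x \<phi> = a * ?M (\<lambda>w. f w v) x \<phi>" for a v
        using fibre_mean_affine[OF x f fv_bound \<phi>, of a v 0] by (simp add: blinfun.scaleR_right)
      have add: "?M (\<lambda>w. f w (v + v')) x \<phi> = ?M (\<lambda>w. f w v) x \<phi> + ?M (\<lambda>w. f w v') x \<phi>" for v v'
        using fibre_mean_add[OF x f fv_bound f fv_bound \<phi>, of v v'] by (simp add: blinfun.add_right)
      have "a *\<^sub>R v1 + b *\<^sub>R v2 - v3 = (a *\<^sub>R v1 + b *\<^sub>R v2) + (-1) *\<^sub>R v3" by simp
      then show ?thesis by (simp only: add scale)
    qed
    \<comment> \<open>Over any \<open>A\<close> the combination integrates to the mean belonging to
      \<open>a *\<^sub>R v1 + b *\<^sub>R v2 - v3\<close>, which is at most \<open>C\<close> times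
      its norm times the measure of \<open>A\<close>.\<close>
    have "AE w in ?Q x. \<bar>a * U v1 w + b * U v2 w - U v3 w\<bar> \<le> C * norm (a *\<^sub>R v1 + b *\<^sub>R v2 - v3)"
      if v: "v1 \<in> D" "v2 \<in> D" "v3 \<in> D" for a b v1 v2 v3
    proof (rule P.AE_abs_le_of_integral_le)
      have hb: "has_bochner_integral (?Q x) (\<lambda>w. (a * U v1 w + b * U v2 w - U v3 w) * indicator A w)
          (?M (\<lambda>w. f w (a *\<^sub>R v1 + b *\<^sub>R v2 - v3)) x (indicator A))"
        if A: "A \<in> sets (?B)" for A
      proof -
        have "has_bochner_integral (?Q x)
          (\<lambda>w. a * (U v1 w * indicator A w) + b * (U v2 w * indicator A w) - U v3 w * indicator A w)
          (a * ?M (\<lambda>w. f w v1) x (indicator A) + b * ?M (\<lambda>w. f w v2) x (indicator A)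
            - ?M (\<lambda>w. f w v3) x (indicator A))"
          by (intro has_bochner_integral_add has_bochner_integral_diff has_bochner_integral_mult_right Ux v A)
        then show ?thesis
          unfolding lin[OF integrable_indicator_fibre_prod[OF x A]] by (simp add: algebra_simps)
      qed
      have "integrable (?Q x) (\<lambda>w. (a * U v1 w + b * U v2 w - U v3 w) * indicator (space (?B)) w)"
        using hb[OF sets.top] by (rule integrable.intros)
      then show "integrable (?Q x) (\<lambda>w. a * U v1 w + b * U v2 w - U v3 w)"
        by (rule Bochner_Integration.integrable_cong[OF refl, THEN iffD1, rotated]) (simp add: space_fibre_prod[OF x])
      fix A assume "A \<in> sets (?Q x)"
      then have A: "A \<in> sets (?B)" by (simp only: sf)
      have "\<bar>?M (\<lambda>w. f w (a *\<^sub>R v1 + b *\<^sub>R v2 - v3)) x (indicator A)\<bar>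
        \<le> C * norm (a *\<^sub>R v1 + b *\<^sub>R v2 - v3) * (\<integral>w. \<bar>indicator A w\<bar> \<partial>?Q x)"
        by (rule fibre_mean_bound[OF x f fv_bound integrable_indicator_fibre_prod[OF x A]])
      then show "\<bar>\<integral>w. (a * U v1 w + b * U v2 w - U v3 w) * indicator A w \<partial>?Q x\<bar>
          \<le> C * norm (a *\<^sub>R v1 + b *\<^sub>R v2 - v3) * measure (?Q x) A"
        using has_bochner_integral_integral_eq[OF hb[OF A]] integral_indicator_fibre_prod[OF x A] by simp
    qed
    then have "AE w in ?Q x. \<forall>a\<in>\<rat>. \<forall>b\<in>\<rat>. \<forall>v1\<in>D. \<forall>v2\<in>D. \<forall>v3\<in>D.
        \<bar>a * U v1 w + b * U v2 w - U v3 w\<bar> \<le> C * norm (a *\<^sub>R v1 + b *\<^sub>R v2 - v3)"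
      by (simp add: AE_ball_countable D countable_rat)
    then have h_U: "AE w in ?Q x. \<forall>d\<in>D. h w d = U d w"
      by eventually_elim (rule h_eq)
    have h_meas: "(\<lambda>w. h w v) \<in> borel_measurable (?Q x)" for v
      unfolding measurable_cong_sets[OF sf refl] by (rule h)
    have int_hv: "integrable (?Q x) (\<lambda>w. h w v * indicator A w)" if "A \<in> sets (?B)" for v A
    proof (rule P.integrable_const_bound[where B="C * norm v"])
      show "AE w in ?Q x. norm (h w v * indicator A w) \<le> C * norm v"
        using abs_blinfun_apply_le[OF h(2), of _ v] C by (auto simp: indicator_def)
      show "(\<lambda>w. h w v * indicator A w) \<in> borel_measurable (?Q x)"
        using that by (intro borel_measurable_times h_meas borel_measurable_indicator) (simp only: sf)
    qed
    have D_eq: "?M (\<lambda>w. f w d) x (indicator A) = (\<integral>w. h w d * indicator A w \<partial>?Q x)"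
      if d: "d \<in> D" and A: "A \<in> sets (?B)" for d A
    proof -
      have "(\<integral>w. h w d * indicator A w \<partial>?Q x) = (\<integral>w. U d w * indicator A w \<partial>?Q x)"
      proof (rule integral_cong_AE)
        show "AE w in ?Q x. h w d * indicator A w = U d w * indicator A w"
          using h_U by eventually_elim (simp add: d)
        show "(\<lambda>w. U d w * indicator A w) \<in> borel_measurable (?Q x)"
          unfolding measurable_cong_sets[OF sf refl] using U A by simp
      qed (use int_hv[OF A] in auto)
      then show ?thesis using has_bochner_integral_integral_eq[OF Ux[OF d A]] by simp
    qed
    \<comment> \<open>Both sides are Lipschitz in \<open>v\<close> with constant \<open>C\<close>,
      since \<open>A\<close> has measure at most 1; hence equality passes from \<open>D\<close> to
      its closure.\<close>
    have ind_eq: "?M (\<lambda>w. f w v) x (indicator A) = (\<integral>w. h w v * indicator A w \<partial>?Q x)"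
      if A: "A \<in> sets (?B)" for v A
    proof -
      obtain s where s: "\<And>i. s i \<in> D" "s \<longlonglongrightarrow> v"
        using D(2) closure_sequential[of v D] by auto
      have conv: "(\<lambda>i. T (s i)) \<longlonglongrightarrow> (T v :: real)"
        if T: "\<And>v v'. \<bar>T v - T v'\<bar> \<le> C * norm (v - v')" for T
      proof (rule LIM_zero_cancel, rule Lim_null_comparison)
        show "\<forall>\<^sub>F i in sequentially. norm (T (s i) - T v) \<le> C * norm (s i - v)"
          using T by (intro always_eventually) simp
        show "(\<lambda>i. C * norm (s i - v)) \<longlonglongrightarrow> 0"
          by (intro tendsto_mult_right_zero tendsto_norm_zero LIM_zero s)
      qed
      have prob_A: "(\<integral>w. \<bar>indicator A w :: real\<bar> \<partial>?Q x) \<le> 1"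
        using integral_indicator_fibre_prod[OF x A] by simp
      have "\<bar>?M (\<lambda>w. f w v) x (indicator A) - ?M (\<lambda>w. f w v') x (indicator A)\<bar> \<le> C * norm (v - v')" for v v'
      proof -
        have "\<bar>?M (\<lambda>w. f w (1 *\<^sub>R v + 0 *\<^sub>R v - v')) x (indicator A)\<bar>
          \<le> C * norm (1 *\<^sub>R v + 0 *\<^sub>R v - v') * (\<integral>w. \<bar>indicator A w\<bar> \<partial>?Q x)"
          by (rule fibre_mean_bound[OF x f fv_bound integrable_indicator_fibre_prod[OF x A]])
        also have "\<dots> \<le> C * norm (1 *\<^sub>R v + 0 *\<^sub>R v - v') * 1"
          by (intro mult_left_mono prob_A mult_nonneg_nonneg C norm_ge_zero)
        finally show ?thesis
          unfolding lin[OF integrable_indicator_fibre_prod[OF x A]] by simp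
      qed
      note 1 = conv[OF this]
      have "\<bar>(\<integral>w. h w v * indicator A w \<partial>?Q x) - (\<integral>w. h w v' * indicator A w \<partial>?Q x)\<bar> \<le> C * norm (v - v')" for v v'
      proof -
        have "(\<integral>w. h w v * indicator A w \<partial>?Q x) - (\<integral>w. h w v' * indicator A w \<partial>?Q x)
          = (\<integral>w. h w (v - v') * indicator A w \<partial>?Q x)"
          by (simp add: int_hv A blinfun.diff_right left_diff_distrib)
        also have "\<bar>\<dots>\<bar> \<le> (\<integral>w. \<bar>h w (v - v') * indicator A w\<bar> \<partial>?Q x)"
          by (rule integral_abs_bound)
        also have "\<dots> \<le> (\<integral>w. C * norm (v - v') \<partial>?Q x)"
          using abs_blinfun_apply_le[OF h(2), of _ "v - v'"] C
          by (intro integral_mono integrable_abs int_hv A) (auto simp: indicator_def)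
        finally show ?thesis by (simp add: P.prob_space)
      qed
      note 2 = conv[OF this]
      show ?thesis
        using 1 2 D_eq[OF s(1) A] LIMSEQ_unique by simp
    qed
    show ?case
      unfolding dual_mean_density_def
    proof (intro allI impI)
      fix v :: 'v and \<phi> :: "(nat \<Rightarrow> 'a) \<Rightarrow> real" assume \<phi>: "integrable (?Q x) \<phi>"
      interpret mean_product "nufib G x" "m x" "?Q x" "\<lambda>p. f (insert_at ?n 0 p) v" "C * norm v"
        by (rule mean_product[OF x f fv_bound])
      show "?M (\<lambda>w. f w v) x \<phi> = (\<integral>w. h w v * \<phi> w \<partial>?Q x)"
        unfolding fibre_mean_eq_pairing[OF x f fv_bound]
      proof (rule mean_pairing_L1[OF h_meas abs_blinfun_apply_le[OF h(2)] _ \<phi>])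
        fix A assume "A \<in> sets (?Q x)"
        then show "m x (pairing (indicator A)) = (\<integral>w. h w v * indicator A w \<partial>?Q x)"
          using ind_eq[of A v] unfolding fibre_mean_eq_pairing[OF x f fv_bound] by (simp only: sf)
      qed
    qed
  qed
  with h show thesis by (rule that)
qed

end

section \<open>The homotopy identity\<close>

lemma (in finite_measure) AE_eq_of_integral_indicator:
  fixes u u' :: "'a \<Rightarrow> real"
  assumes u: "integrable M u" "integrable M u'"
    and eq: "\<And>A. A \<in> sets M \<Longrightarrow> (\<integral>x. u x * indicator A x \<partial>M) = (\<integral>x. u' x * indicator A x \<partial>M)"
  shows "AE x in M. u x = u' x"
proof -
  have "AE x in M. \<bar>u x - u' x\<bar> \<le> 0"
  proof (rule AE_abs_le_of_integral_le)
    show "integrable M (\<lambda>x. u x - u' x)" using u by simp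
    fix A assume A: "A \<in> sets M"
    have int: "integrable M (\<lambda>x. v x * indicator A x)" if "integrable M v" for v :: "'a \<Rightarrow> real"
      using integrable_mult_indicator[OF A that] by (simp add: mult.commute)
    show "\<bar>\<integral>x. (u x - u' x) * indicator A x \<partial>M\<bar> \<le> 0 * measure M A"
      using eq[OF A] int u by (simp add: left_diff_distrib)
  qed
  then show ?thesis by eventually_elim simp
qed

text \<open>The exceptional null set depends on \<open>v\<close>; a countable dense set of vectors
  gives one that serves all.\<close>

lemma (in finite_measure) AE_dual_eq_of_integral_indicator:
  fixes u u' :: "'a \<Rightarrow> 'v::{real_normed_vector, second_countable_topology} \<Rightarrow>\<^sub>L real"
  assumes u: "\<And>v. integrable M (\<lambda>x. u x v)" and u': "\<And>v. integrable M (\<lambda>x. u' x v)"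
    and eq: "\<And>v A. A \<in> sets M \<Longrightarrow> (\<integral>x. u x v * indicator A x \<partial>M) = (\<integral>x. u' x v * indicator A x \<partial>M)"
  shows "AE x in M. u x = u' x"
proof -
  obtain D :: "'v set" where D: "countable D" "closure D = UNIV"
    by (rule countable_dense_subset)
  have "AE x in M. u x v = u' x v" for v
    by (rule AE_eq_of_integral_indicator[OF u u' eq])
  then have "AE x in M. \<forall>v\<in>D. u x v = u' x v"
    by (subst AE_ball_countable[OF D(1)]) simp
  then show ?thesis
    by eventually_elim (rule blinfun_eq_dense[OF D(2)], simp)
qed

lemma sum_blinfun_apply: "blinfun_apply (\<Sum>i\<in>I. F i) v = (\<Sum>i\<in>I. blinfun_apply (F i) v)"
  by (induction I rule: infinite_finite_induct) (simp_all add: blinfun.add_left)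

lemma coboundary_fun_apply:
  "blinfun_apply (coboundary_fun k f w) v = (\<Sum>i<Suc (Suc k). (-1) ^ i * f (omit k i w) v)"
  by (simp add: coboundary_fun_def sum_blinfun_apply blinfun.scaleR_left del: sum.lessThan_Suc)

text \<open>Term 0 deletes the prefixed entry; all other terms keep it and change sign. For a
  cocycle this writes \<open>f w\<close> as an alternating sum in which a free entry
  \<open>u\<close> has appeared, ready to be averaged.\<close>

lemma coboundary_fun_insert_at_0:
  assumes "w \<in> extensional {..<Suc (Suc k)}"
  shows "coboundary_fun (Suc k) f (insert_at (Suc (Suc k)) 0 (u, w)) =
    f w - (\<Sum>i<Suc (Suc k). (-1) ^ i *\<^sub>R f (insert_at (Suc k) 0 (u, omit k i w)))"
  unfolding coboundary_fun_def
  by (subst sum.lessThan_Suc_shift)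
    (simp add: omit_insert_at[OF assms] omit_Suc_insert_at_0 sum_negf del: sum.lessThan_Suc)

lemma measurable_coboundary_fun:
  fixes f :: "('a, 'v::real_normed_vector) cochain"
  assumes "\<And>v. (\<lambda>w. f w v) \<in> borel_measurable (PiM {..<Suc k} (\<lambda>_. M))"
  shows "(\<lambda>w. coboundary_fun k f w v) \<in> borel_measurable (PiM {..<Suc (Suc k)} (\<lambda>_. M))"
  unfolding coboundary_fun_apply
  by (intro borel_measurable_sum borel_measurable_times borel_measurable_const measurable_compose[OF measurable_omit assms])

lemma norm_coboundary_fun_le:
  fixes f :: "('a, 'v::real_normed_vector) cochain"
  assumes "\<And>w. norm (f w) \<le> C"
  shows "norm (coboundary_fun k f w) \<le> real (Suc (Suc k)) * C"
proof -
  have "norm (coboundary_fun k f w) \<le> (\<Sum>i<Suc (Suc k). norm ((-1) ^ i *\<^sub>R f (omit k i w)))"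
    unfolding coboundary_fun_def by (rule norm_sum)
  also have "\<dots> \<le> (\<Sum>i<Suc (Suc k). C)"
    using assms by (intro sum_mono) simp
  finally show ?thesis by simp
qed

context measured_groupoid
begin

lemma measurable_nu_tuples: "f \<in> tuple_borel n \<rightarrow>\<^sub>M N \<Longrightarrow> f \<in> nu_tuples G n \<rightarrow>\<^sub>M N"
  unfolding measurable_cong_sets[OF sets_nu_tuples refl] by (rule measurable_restrict_space1)

lemma integrable_fibre_prod_bounded:
  fixes f :: "(nat \<Rightarrow> 'a) \<Rightarrow> real"
  assumes x: "x \<in> unit_space G" and f: "f \<in> borel_measurable (tuple_borel n)" "\<And>w. \<bar>f w\<bar> \<le> c"
  shows "integrable (fibre_prod n x) f"
proof -
  interpret prob_space "fibre_prod n x" by (rule prob_space_fibre_prod[OF x])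
  show ?thesis
  proof (rule integrable_const_bound[where B=c])
    show "f \<in> borel_measurable (fibre_prod n x)"
      unfolding measurable_cong_sets[OF sets_fibre_prod[OF x] refl] by (rule f(1))
  qed (use f(2) in auto)
qed

end

context measured_groupoid_means
begin

text \<open>Integrated against a set, the cocycle identity expresses a number independent of
  \<open>g\<close> as an alternating sum of pairings that depend on \<open>g\<close>. Applying the
  mean keeps the number and turns each pairing into an integral of \<open>h\<close>.\<close>

lemma coboundary_homotopy:
  fixes f h :: "('a, 'v::{real_normed_vector, second_countable_topology}) cochain"
  assumes f: "\<And>v. (\<lambda>w. f w v) \<in> borel_measurable (tuple_borel (Suc (Suc k)))" "\<And>w. norm (f w) \<le> C"
    and h: "\<And>v. (\<lambda>w. h w v) \<in> borel_measurable (tuple_borel (Suc k))" "\<And>w. norm (h w) \<le> C"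
    and homotopy: "AE x in mu G. dual_mean_density (Suc k) f h x"
    and cocycle: "AE w in nu_tuples G (Suc (Suc (Suc k))). coboundary_fun (Suc k) f w = 0"
  shows "AE w in nu_tuples G (Suc (Suc k)). coboundary_fun k h w = f w"
proof (rule AE_nu_tuplesI)
  note cob_h = measurable_coboundary_fun[OF h(1)]
  have "Measurable.pred (tuple_borel (Suc (Suc k))) (\<lambda>w. coboundary_fun k h w = f w)"
    by (rule pred_dual_eq[OF cob_h f(1)])
  then show "Measurable.pred (nu_tuples G (Suc (Suc k))) (\<lambda>w. coboundary_fun k h w = f w)"
    by (rule measurable_nu_tuples)
  show "AE x in mu G. AE w in fibre_prod (Suc (Suc k)) x. coboundary_fun k h w = f w"
    using homotopy AE_nu_tuplesD[OF cocycle] AE_space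
  proof eventually_elim
    case (elim x)
    then have x: "x \<in> unit_space G" by (simp add: space_mu)
    let ?n = "Suc k"
    let ?Q1 = "fibre_prod ?n x" and ?Q2 = "fibre_prod (Suc ?n) x"
    interpret N: prob_space "nufib G x" by (rule prob_space_nufib[OF x])
    interpret Q1: prob_space ?Q1 by (rule prob_space_fibre_prod[OF x])
    interpret Q2: prob_space ?Q2 by (rule prob_space_fibre_prod[OF x])
    note fv = f(1) abs_blinfun_apply_le[OF f(2)] and hv = h(1) abs_blinfun_apply_le[OF h(2)]
    note sf1 = sets_fibre_prod[OF x, of ?n] and sf2 = sets_fibre_prod[OF x, of "Suc ?n"]
    have f_eq: "AE g in nufib G x. AE w in ?Q2.
        f w = (\<Sum>i<Suc ?n. (-1) ^ i *\<^sub>R f (insert_at ?n 0 (g, omit k i w)))"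
      using AE_fibre_prod_SucD[OF x elim(2)]
    proof eventually_elim
      case (elim g)
      from elim AE_space show ?case
      proof eventually_elim
        case (elim w)
        then have "w \<in> extensional {..<Suc (Suc k)}"
          by (simp add: space_PiM PiE_def)
        then show ?case using elim(1) by (simp only: coboundary_fun_insert_at_0) (simp del: sum.lessThan_Suc)
      qed
    qed
    have omit_int: "integrable ?Q2 (\<lambda>w. F (omit k i w) * indicator A w)"
      if F: "F \<in> borel_measurable (tuple_borel ?n)" "\<And>w. \<bar>F w\<bar> \<le> c" and A: "A \<in> sets (tuple_borel (Suc ?n))"
      for F :: "(nat \<Rightarrow> 'a) \<Rightarrow> real" and c A i
    proof (rule integrable_fibre_prod_bounded[OF x])
      show "(\<lambda>w. F (omit k i w) * indicator A w) \<in> borel_measurable (tuple_borel (Suc ?n))"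
        by (intro borel_measurable_times measurable_compose[OF measurable_omit F(1)] borel_measurable_indicator A)
      show "\<bar>F (omit k i w) * indicator A w\<bar> \<le> c" for w
        using F(2)[of "omit k i w"] by (auto simp: indicator_def)
    qed
    show ?case
    proof (rule Q2.AE_dual_eq_of_integral_indicator)
      show "integrable ?Q2 (\<lambda>w. coboundary_fun k h w v)" for v
        by (rule integrable_fibre_prod_bounded[OF x cob_h abs_blinfun_apply_le[OF norm_coboundary_fun_le[OF h(2)]]])
      show "integrable ?Q2 (\<lambda>w. f w v)" for v
        by (rule integrable_fibre_prod_bounded[OF x fv])
      fix v A assume "A \<in> sets ?Q2"
      then have A: "A \<in> sets (tuple_borel (Suc ?n))" by (simp only: sf2)
      \<comment> \<open>Integrating variable \<open>i\<close> out of the indicator of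
        \<open>A\<close> gives the adjoint of deleting entry \<open>i\<close>; it is the test
        function on the smaller product.\<close>
      define \<phi> where "\<phi> i w = (\<integral>u. indicator A (insert_at ?n i (u, w)) \<partial>nufib G x :: real)" for i w
      have A': "A \<in> sets (PiM {..<Suc (Suc k)} (\<lambda>_. nufib G x))" using A by (simp only: sf2)
      have omit_eq: "(\<integral>w. F (omit k i w) * indicator A w \<partial>?Q2) = (\<integral>w. F w * \<phi> i w \<partial>?Q1)"
        and \<phi>_int: "integrable ?Q1 (\<phi> i)"
        if i: "i \<le> ?n" and F: "F \<in> borel_measurable (tuple_borel ?n)" "\<And>w. \<bar>F w\<bar> \<le> c"
        for F :: "(nat \<Rightarrow> 'a) \<Rightarrow> real" and c i
      proof -
        have "F \<in> borel_measurable ?Q1"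
          unfolding measurable_cong_sets[OF sf1 refl] by (rule F(1))
        from integral_omit[OF prob_space_nufib[OF x] i this F(2) A']
        show "(\<integral>w. F (omit k i w) * indicator A w \<partial>?Q2) = (\<integral>w. F w * \<phi> i w \<partial>?Q1)" "integrable ?Q1 (\<phi> i)"
          unfolding \<phi>_def[abs_def] .
      qed
      interpret P: mean_product "nufib G x" "m x" ?Q1 "\<lambda>p. f (insert_at ?n 0 p) v" "C * norm v"
        by (rule mean_product[OF x fv])
      \<comment> \<open>Integrability was stated together with \<open>omit_eq\<close> and shares its
        function argument; \<open>hv\<close> supplies one.\<close>
      have \<phi>: "integrable ?Q1 (\<phi> i)" if "i < Suc ?n" for i
        using \<phi>_int[OF _ hv] that by simp
      let ?I = "\<integral>w. f w v * indicator A w \<partial>?Q2"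
      have ins: "insert_at ?n 0 \<in> nu G \<Otimes>\<^sub>M tuple_borel ?n \<rightarrow>\<^sub>M tuple_borel (Suc ?n)"
        by (rule measurable_insert_at) simp
      have sum_eq: "AE g in nufib G x. ?I = (\<Sum>i<Suc ?n. (-1) ^ i * P.pairing (\<phi> i) g)"
        using f_eq AE_space
      proof eventually_elim
        case (elim g)
        then have g: "g \<in> space (nu G)" using space_nufib[OF x] by (simp add: space_eq)
        let ?F = "\<lambda>w. f (insert_at ?n 0 (g, w)) v"
        have F: "?F \<in> borel_measurable (tuple_borel ?n)"
          by (rule measurable_compose[OF measurable_compose[OF measurable_Pair1'[OF g] ins] f(1)])
        have "?I = (\<integral>w. (\<Sum>i<Suc ?n. (-1) ^ i * (?F (omit k i w) * indicator A w)) \<partial>?Q2)"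
        proof (rule integral_cong_AE)
          show "(\<lambda>w. f w v * indicator A w) \<in> borel_measurable ?Q2"
            unfolding measurable_cong_sets[OF sf2 refl]
            by (intro borel_measurable_times borel_measurable_indicator f(1) A)
          show "(\<lambda>w. \<Sum>i<Suc ?n. (-1) ^ i * (?F (omit k i w) * indicator A w)) \<in> borel_measurable ?Q2"
            unfolding measurable_cong_sets[OF sf2 refl]
            by (intro borel_measurable_sum borel_measurable_times borel_measurable_indicator borel_measurable_const
                measurable_compose[OF measurable_omit F] A)
          show "AE w in ?Q2. f w v * indicator A w = (\<Sum>i<Suc ?n. (-1) ^ i * (?F (omit k i w) * indicator A w))"
            using elim(1)
          proof eventually_elim
            case (elim w)
            have "f w v = (\<Sum>i<Suc ?n. (-1) ^ i * ?F (omit k i w))"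
              by (subst elim) (simp add: sum_blinfun_apply blinfun.scaleR_left del: sum.lessThan_Suc)
            then show ?case by (simp add: sum_distrib_right mult.assoc del: sum.lessThan_Suc)
          qed
        qed
        also have "\<dots> = (\<Sum>i<Suc ?n. (-1) ^ i * (\<integral>w. ?F (omit k i w) * indicator A w \<partial>?Q2))"
          using omit_int[OF F fv(2) A]
          by (subst Bochner_Integration.integral_sum) (simp_all del: sum.lessThan_Suc)
        also have "\<dots> = (\<Sum>i<Suc ?n. (-1) ^ i * P.pairing (\<phi> i) g)"
          using omit_eq[OF _ F fv(2)] by (intro sum.cong refl) (simp add: P.pairing_def)
        finally show ?case .
      qed
      have ess: "(\<lambda>g. (-1) ^ i * P.pairing (\<phi> i) g) \<in> ess_bounded_fun (nufib G x)" if "i < Suc ?n" for i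
        by (intro ess_bounded_fun_cmult P.pairing_ess_bounded \<phi> that)
      \<comment> \<open>The left-hand side of \<open>sum_eq\<close> is constant in \<open>g\<close>,
        so it equals its own mean.\<close>
      have "?I = m x (\<lambda>_. ?I)" by (simp add: P.mean_const)
      also have "\<dots> = m x (\<lambda>g. \<Sum>i<Suc ?n. (-1) ^ i * P.pairing (\<phi> i) g)"
        using P.mean_sum[of "{..<Suc ?n}" "\<lambda>i g. (-1) ^ i * P.pairing (\<phi> i) g"] ess
        by (intro P.mean_cong ess_bounded_fun_const sum_eq) simp
      also have "\<dots> = (\<Sum>i<Suc ?n. m x (\<lambda>g. (-1) ^ i * P.pairing (\<phi> i) g))"
        using P.mean_sum[of "{..<Suc ?n}" "\<lambda>i g. (-1) ^ i * P.pairing (\<phi> i) g"] ess by simp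
      also have "\<dots> = (\<Sum>i<Suc ?n. (-1) ^ i * (\<integral>w. h (omit k i w) v * indicator A w \<partial>?Q2))"
      proof (rule sum.cong[OF refl])
        fix i assume "i \<in> {..<Suc ?n}"
        then have i: "i < Suc ?n" by simp
        have "m x (\<lambda>g. (-1) ^ i * P.pairing (\<phi> i) g) = (-1) ^ i * fibre_mean ?n (\<lambda>w. f w v) x (\<phi> i)"
          unfolding fibre_mean_eq_pairing[OF x fv] by (intro P.mean_cmult P.pairing_ess_bounded \<phi> i)
        also have "fibre_mean ?n (\<lambda>w. f w v) x (\<phi> i) = (\<integral>w. h w v * \<phi> i w \<partial>?Q1)"
          using elim(1) \<phi>[OF i] unfolding dual_mean_density_def by blast
        also have "\<dots> = (\<integral>w. h (omit k i w) v * indicator A w \<partial>?Q2)"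
          using omit_eq[OF _ hv] i by simp
        finally show "m x (\<lambda>g. (-1) ^ i * P.pairing (\<phi> i) g) =
          (-1) ^ i * (\<integral>w. h (omit k i w) v * indicator A w \<partial>?Q2)" .
      qed
      also have "\<dots> = (\<integral>w. (\<Sum>i<Suc ?n. (-1) ^ i * (h (omit k i w) v * indicator A w)) \<partial>?Q2)"
        using omit_int[OF hv A]
        by (subst Bochner_Integration.integral_sum) (simp_all del: sum.lessThan_Suc)
      also have "\<dots> = (\<integral>w. coboundary_fun k h w v * indicator A w \<partial>?Q2)"
        by (simp add: coboundary_fun_apply sum_distrib_right mult.assoc del: sum.lessThan_Suc)
      finally show "(\<integral>w. coboundary_fun k h w v * indicator A w \<partial>?Q2) = ?I" ..
    qed
  qed
qed

end

subsection \<open>Equivariance of the homotopy\<close>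

context measured_groupoid
begin

text \<open>Off the fibre over \<open>src G g\<close> the product is junk, so it is replaced by an arbitrary arrow
  in order to obtain an everywhere measurable map.\<close>

definition left_mult :: "'a \<Rightarrow> 'a \<Rightarrow> 'a" where
  "left_mult g h = (if h \<in> fibre G (src G g) then gmult G g h else g)"

lemma measurable_left_mult:
  assumes g: "g \<in> arrows G"
  shows "left_mult g \<in> nu G \<rightarrow>\<^sub>M nu G"
proof -
  have fib: "fibre G (src G g) \<in> sets (nu G)"
    using src_in_unit_space[OF g] unit_space_subset by (intro sets_fibre) auto
  have "(\<lambda>h. gmult G g h) \<in> restrict_space (nu G) {h. h \<in> fibre G (src G g)} \<rightarrow>\<^sub>M nu G"
    using g by (intro measurable_gmult measurable_const measurable_restrict_space1 measurable_ident)
      (auto simp: space_restrict_space composable_iff fibre_def space_eq)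
  moreover have "{h \<in> space (nu G). h \<in> fibre G (src G g)} \<in> sets (nu G)"
    using fib by (simp add: Collect_conj_eq sets.Int_space_eq1)
  ultimately show ?thesis
    unfolding left_mult_def[abs_def] using g
    by (subst measurable_If_restrict_space_iff) (simp_all add: space_eq)
qed

lemma left_mult_ginv:
  assumes "g \<in> arrows G" "h \<in> fibre G (src G g)"
  shows "left_mult (ginv G g) (left_mult g h) = h"
  using assms mult_in_fibre[OF assms] by (simp add: left_mult_def src_inv inv_mult_cancel fibre_def)

text \<open>The total map agrees with multiplication on the fibre over \<open>src G g\<close>, which
  has full measure. Pushing forward by a total map gives access to the product formula for image
  measures.\<close>

lemma translate_eq_distr:
  assumes g: "g \<in> arrows G"
  shows "translate G g = distr (nufib G (src G g)) (nu G) (left_mult g)"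
proof (rule measure_eqI)
  let ?x = "src G g"
  have x: "?x \<in> unit_space G" by (rule src_in_unit_space[OF g])
  have fib: "fibre G ?x \<in> sets (nufib G ?x)"
    using sets_fibre unit_space_subset x by (auto simp: sets_nufib)
  have fib_sub: "fibre G ?x \<subseteq> space (nufib G ?x)" by (rule sets.sets_into_space[OF fib])
  have lm: "left_mult g \<in> nufib G ?x \<rightarrow>\<^sub>M nu G"
    unfolding measurable_cong_sets[OF sets_nufib[OF x] refl] by (rule measurable_left_mult[OF g])
  have "left_mult g \<in> restrict_space (nufib G ?x) (fibre G ?x) \<rightarrow>\<^sub>M nu G"
    by (rule measurable_restrict_space1[OF lm])
  then have gm: "gmult G g \<in> restrict_space (nufib G ?x) (fibre G ?x) \<rightarrow>\<^sub>M nu G"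
    by (rule measurable_cong[THEN iffD1, rotated]) (auto simp: left_mult_def space_restrict_space)
  fix A assume "A \<in> sets (translate G g)"
  then have A: "A \<in> sets (nu G)" by (simp add: translate_def)
  have "emeasure (translate G g) A =
    emeasure (restrict_space (nufib G ?x) (fibre G ?x)) (gmult G g -` A \<inter> fibre G ?x)"
    unfolding translate_def using fib_sub
    by (simp add: emeasure_distr[OF gm A] space_restrict_space Int_absorb2)
  also have "\<dots> = emeasure (nufib G ?x) (gmult G g -` A \<inter> fibre G ?x)"
    using fib fib_sub by (intro emeasure_restrict_space) (auto simp: Int_absorb2)
  also have "\<dots> = emeasure (nufib G ?x) (left_mult g -` A \<inter> space (nufib G ?x))"
  proof (rule emeasure_eq_AE)
    show "AE h in nufib G ?x. h \<in> gmult G g -` A \<inter> fibre G ?x \<longleftrightarrow> h \<in> left_mult g -` A \<inter> space (nufib G ?x)"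
      using AE_nufib_fibre[OF x] AE_space by eventually_elim (simp add: left_mult_def)
    have "gmult G g -` A \<inter> fibre G ?x = (left_mult g -` A \<inter> space (nufib G ?x)) \<inter> fibre G ?x"
      using fib_sub by (auto simp: left_mult_def)
    then show "gmult G g -` A \<inter> fibre G ?x \<in> sets (nufib G ?x)"
      using measurable_sets[OF lm A] fib by simp
    show "left_mult g -` A \<inter> space (nufib G ?x) \<in> sets (nufib G ?x)"
      by (rule measurable_sets[OF lm A])
  qed
  also have "\<dots> = emeasure (distr (nufib G ?x) (nu G) (left_mult g)) A"
    by (rule emeasure_distr[OF lm A, symmetric])
  finally show "emeasure (translate G g) A = emeasure (distr (nufib G ?x) (nu G) (left_mult g)) A" .
qed (simp add: translate_def)

definition left_mult_tuple :: "nat \<Rightarrow> 'a \<Rightarrow> (nat \<Rightarrow> 'a) \<Rightarrow> nat \<Rightarrow> 'a" where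
  "left_mult_tuple n g = compose {..<n} (left_mult g)"

lemma measurable_left_mult_tuple:
  assumes "g \<in> arrows G"
  shows "left_mult_tuple n g \<in> tuple_borel n \<rightarrow>\<^sub>M tuple_borel n"
  unfolding left_mult_tuple_def compose_def[abs_def]
proof (rule measurable_restrict)
  fix i assume "i \<in> {..<n}"
  then show "(\<lambda>w. left_mult g (w i)) \<in> tuple_borel n \<rightarrow>\<^sub>M nu G"
    by (intro measurable_compose[OF measurable_tuple_component measurable_left_mult[OF assms]]) simp
qed

lemma left_mult_tuple_ginv:
  assumes "g \<in> arrows G" "w \<in> extensional {..<n}" "\<forall>i<n. w i \<in> fibre G (src G g)"
  shows "left_mult_tuple n (ginv G g) (left_mult_tuple n g w) = w"
  using assms by (auto simp: left_mult_tuple_def compose_def fun_eq_iff left_mult_ginv extensional_def)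

lemma insert_at_left_mult_tuple:
  assumes "h \<in> fibre G (src G g)"
  shows "insert_at n 0 (gmult G g h, left_mult_tuple n g w) = left_mult_tuple (Suc n) g (insert_at n 0 (h, w))"
  using assms by (auto simp: left_mult_tuple_def compose_def insert_at_def fun_eq_iff left_mult_def)

section \<open>Fibre products under translation by a fixed arrow\<close>

context
  fixes g assumes g: "g \<in> arrows G"
    and equiv: "equivalent_measures (translate G g) (nufib G (tgt G g))"
begin

lemma prob_space_translate: "prob_space (translate G g)"
  unfolding translate_eq_distr[OF g]
proof (rule prob_space.prob_space_distr[OF prob_space_nufib[OF src_in_unit_space[OF g]]])
  show "left_mult g \<in> nufib G (src G g) \<rightarrow>\<^sub>M nu G"
    unfolding measurable_cong_sets[OF sets_nufib[OF src_in_unit_space[OF g]] refl]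
    by (rule measurable_left_mult[OF g])
qed

lemma sets_translate: "sets (translate G g) = sets (nu G)"
  by (simp add: translate_def)

abbreviation (input) "translate_prod n \<equiv> PiM {..<n} (\<lambda>_::nat. translate G g)"

lemma sets_translate_prod: "sets (translate_prod n) = sets (tuple_borel n)"
  by (intro sets_PiM_cong refl sets_translate)

lemma distr_left_mult_tuple:
  "distr (fibre_prod n (src G g)) (tuple_borel n) (left_mult_tuple n g) = translate_prod n"
  unfolding left_mult_tuple_def translate_eq_distr[OF g]
proof (rule distr_PiM_finite_prob_space')
  show "left_mult g \<in> nufib G (src G g) \<rightarrow>\<^sub>M nu G"
    unfolding measurable_cong_sets[OF sets_nufib[OF src_in_unit_space[OF g]] refl]
    by (rule measurable_left_mult[OF g])
qed (simp_all add: prob_space_nufib src_in_unit_space g nu_prob)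

lemma measurable_left_mult_tuple_fibre:
  "left_mult_tuple n g \<in> fibre_prod n (src G g) \<rightarrow>\<^sub>M tuple_borel n"
  unfolding measurable_cong_sets[OF sets_fibre_prod[OF src_in_unit_space[OF g]] refl]
  by (rule measurable_left_mult_tuple[OF g])

lemma sets_translate_prod_fibre_prod: "sets (translate_prod n) = sets (fibre_prod n (tgt G g))"
  using sets_translate_prod sets_fibre_prod[OF tgt_in_unit_space[OF g]] by simp

text \<open>One half of quasi-invariance: null sets over the target are null for the translated
  measure, so their preimages are null over the source.\<close>

lemma AE_left_mult_tuple:
  assumes "AE w in fibre_prod n (tgt G g). P w"
  shows "AE w in fibre_prod n (src G g). P (left_mult_tuple n g w)"
proof -
  have "absolutely_continuous (fibre_prod n (tgt G g)) (translate_prod n)"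
    using equiv
    by (intro absolutely_continuous_PiM prob_space_translate prob_space_nufib tgt_in_unit_space g)
      (simp_all add: equivalent_measures_def sets_nufib sets_translate tgt_in_unit_space g)
  from absolutely_continuous_AE[OF sets_translate_prod_fibre_prod this assms]
  have "AE w in distr (fibre_prod n (src G g)) (tuple_borel n) (left_mult_tuple n g). P w"
    unfolding distr_left_mult_tuple .
  then show ?thesis by (rule AE_distrD[OF measurable_left_mult_tuple_fibre])
qed

text \<open>The other half of quasi-invariance: \<open>\<rho>\<close> is the density of the fibre
  product over the target with respect to the translated one, and this is the resulting change of
  variables. Integrability is stated explicitly because \<open>\<rho>\<close> may be
  unbounded.\<close>

lemma fibre_prod_density:
  "\<exists>\<rho>. \<forall>F c. F \<in> borel_measurable (tuple_borel n) \<longrightarrow> (\<forall>w. \<bar>F w\<bar> \<le> (c::real)) \<longrightarrow>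
    integrable (fibre_prod n (src G g)) (\<lambda>w. \<rho> (left_mult_tuple n g w) * F (left_mult_tuple n g w)) \<and>
    (\<integral>w. F w \<partial>fibre_prod n (tgt G g)) =
      (\<integral>w. \<rho> (left_mult_tuple n g w) * F (left_mult_tuple n g w) \<partial>fibre_prod n (src G g))"
proof -
  let ?y = "tgt G g"
  have y: "?y \<in> unit_space G" by (rule tgt_in_unit_space[OF g])
  interpret R: prob_space "translate_prod n" by (intro prob_space_PiM prob_space_translate)
  have ac: "absolutely_continuous (translate_prod n) (fibre_prod n ?y)"
    using equiv
    by (intro absolutely_continuous_PiM prob_space_translate prob_space_nufib y)
      (simp_all add: equivalent_measures_def sets_nufib sets_translate y)
  have fin: "finite_measure (fibre_prod n ?y)"
    using prob_space_fibre_prod[OF y] by (rule prob_space.finite_measure)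
  obtain \<rho> where \<rho>: "\<rho> \<in> borel_measurable (translate_prod n)"
    and \<rho>_eq: "AE w in translate_prod n. RN_deriv (translate_prod n) (fibre_prod n ?y) w = ennreal (\<rho> w)"
    and "AE w in fibre_prod n ?y. 0 < \<rho> w" and \<rho>_nonneg: "\<And>w. 0 \<le> \<rho> w"
    by (rule R.real_RN_deriv[OF fin ac sets_translate_prod_fibre_prod[symmetric]]) (rule that)
  have "density (translate_prod n) (\<lambda>w. ennreal (\<rho> w)) =
      density (translate_prod n) (RN_deriv (translate_prod n) (fibre_prod n ?y))"
    using \<rho> \<rho>_eq by (intro density_cong) (auto elim!: eventually_mono)
  also have "\<dots> = fibre_prod n ?y"
    by (rule R.density_RN_deriv[OF ac sets_translate_prod_fibre_prod[symmetric]])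
  finally have dens: "density (translate_prod n) (\<lambda>w. ennreal (\<rho> w)) = fibre_prod n ?y" .
  show ?thesis
  proof (intro exI allI impI conjI)
    fix F :: "(nat \<Rightarrow> 'a) \<Rightarrow> real" and c :: real
    assume F: "F \<in> borel_measurable (tuple_borel n)" and bound: "\<forall>w. \<bar>F w\<bar> \<le> c"
    have F_bound: "\<bar>F w\<bar> \<le> c" for w using bound by blast
    have FR: "F \<in> borel_measurable (translate_prod n)"
      unfolding measurable_cong_sets[OF sets_translate_prod refl] by (rule F)
    have \<rho>': "\<rho> \<in> borel_measurable (tuple_borel n)"
      using \<rho> unfolding measurable_cong_sets[OF sets_translate_prod refl] .
    have "integrable (fibre_prod n ?y) F"
      by (rule integrable_fibre_prod_bounded[OF y F F_bound])
    then have "integrable (translate_prod n) (\<lambda>w. \<rho> w * F w)"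
      unfolding dens[symmetric] using \<rho> \<rho>_nonneg FR by (simp add: integrable_density)
    then show "integrable (fibre_prod n (src G g)) (\<lambda>w. \<rho> (left_mult_tuple n g w) * F (left_mult_tuple n g w))"
      unfolding distr_left_mult_tuple[symmetric] using \<rho>' F
      by (subst (asm) integrable_distr_eq[OF measurable_left_mult_tuple_fibre]) simp_all
    have "(\<integral>w. F w \<partial>fibre_prod n ?y) = (\<integral>w. \<rho> w * F w \<partial>translate_prod n)"
      unfolding dens[symmetric] using \<rho> \<rho>_nonneg FR by (simp add: integral_density)
    also have "\<dots> = (\<integral>w. \<rho> (left_mult_tuple n g w) * F (left_mult_tuple n g w) \<partial>fibre_prod n (src G g))"
      unfolding distr_left_mult_tuple[symmetric] using \<rho>' F
      by (subst integral_distr[OF measurable_left_mult_tuple_fibre]) simp_all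
    finally show "(\<integral>w. F w \<partial>fibre_prod n ?y) =
      (\<integral>w. \<rho> (left_mult_tuple n g w) * F (left_mult_tuple n g w) \<partial>fibre_prod n (src G g))" .
  qed
qed

end

end

lemma insert_at_0_0: "insert_at n 0 (g, w) 0 = g"
  by (simp add: insert_at_def)

lemma insert_at_0_Suc: "i < n \<Longrightarrow> insert_at n 0 (g, w) (Suc i) = w i"
  by (simp add: insert_at_def)

section \<open>Invariance of the homotopy\<close>

context measured_groupoid_means
begin

text \<open>\<open>B\<close> stands for \<open>Lb (ginv G g)\<close>. A set integral of
  \<open>h\<close> over the target is a mean over the target; invariance of the means carries it to
  the source, equivariance of \<open>f\<close> replaces \<open>v\<close> by \<open>B v\<close>, and
  the change of variables returns to an integral over the target.\<close>

lemma homotopy_equivariant_fibre: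
  fixes f h :: "('a, 'v::{real_normed_vector, second_countable_topology}) cochain"
    and B :: "'v \<Rightarrow>\<^sub>L 'v"
  assumes f: "\<And>v. (\<lambda>w. f w v) \<in> borel_measurable (tuple_borel (Suc n))" "\<And>w. norm (f w) \<le> C"
    and h: "\<And>v. (\<lambda>w. h w v) \<in> borel_measurable (tuple_borel n)" "\<And>w. norm (h w) \<le> C"
    and g: "g \<in> arrows G" and equiv: "equivalent_measures (translate G g) (nufib G (tgt G g))"
    and shift: "\<forall>l\<in>bounded_borel_fun (nu G).
      m (tgt G g) (fibre_restrict G l (tgt G g)) = m (src G g) (fibre_shift G g l)"
    and f_inv: "AE w in fibre_prod (Suc n) (src G g). f (left_mult_tuple (Suc n) g w) = f w o\<^sub>L B"
    and hom_src: "dual_mean_density n f h (src G g)"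
    and hom_tgt: "dual_mean_density n f h (tgt G g)"
  shows "AE w in fibre_prod n (tgt G g). h (left_mult_tuple n (ginv G g) w) o\<^sub>L B = h w"
proof -
  let ?x = "src G g" and ?y = "tgt G g"
  let ?Qx = "fibre_prod n ?x" and ?Qy = "fibre_prod n ?y"
  let ?T = "left_mult_tuple n g" and ?T' = "left_mult_tuple n (ginv G g)"
  have x: "?x \<in> unit_space G" and y: "?y \<in> unit_space G"
    by (simp_all add: src_in_unit_space tgt_in_unit_space g)
  interpret Qy: prob_space ?Qy by (rule prob_space_fibre_prod[OF y])
  note fv = f(1) abs_blinfun_apply_le[OF f(2)] and hv = h(1) abs_blinfun_apply_le[OF h(2)]
  have T': "?T' \<in> tuple_borel n \<rightarrow>\<^sub>M tuple_borel n"
    by (rule measurable_left_mult_tuple[OF inv_closed[OF g]])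
  have hT': "(\<lambda>w. h (?T' w) v) \<in> borel_measurable (tuple_borel n)" for v
    by (rule measurable_compose[OF T' h(1)])
  obtain \<rho> where \<rho>: "\<forall>F c. F \<in> borel_measurable (tuple_borel n) \<longrightarrow> (\<forall>w. \<bar>F w\<bar> \<le> (c::real)) \<longrightarrow>
    integrable ?Qx (\<lambda>w. \<rho> (?T w) * F (?T w)) \<and> (\<integral>w. F w \<partial>?Qy) = (\<integral>w. \<rho> (?T w) * F (?T w) \<partial>?Qx)"
    using fibre_prod_density[OF g equiv] ..
  have dens_int: "integrable ?Qx (\<lambda>w. \<rho> (?T w) * F (?T w))"
    and dens: "(\<integral>w. F w \<partial>?Qy) = (\<integral>w. \<rho> (?T w) * F (?T w) \<partial>?Qx)"
    if "F \<in> borel_measurable (tuple_borel n)" "\<And>w. \<bar>F w\<bar> \<le> c" for F and c :: real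
    using \<rho>[rule_format, OF that] by (rule conjunct1, rule conjunct2)
  show ?thesis
  proof (rule Qy.AE_dual_eq_of_integral_indicator)
    show "integrable ?Qy (\<lambda>w. (h (?T' w) o\<^sub>L B) v)" for v
      using integrable_fibre_prod_bounded[OF y hT' abs_blinfun_apply_le[OF h(2)]] by simp
    show "integrable ?Qy (\<lambda>w. h w v)" for v
      by (rule integrable_fibre_prod_bounded[OF y hv])
    fix v A assume "A \<in> sets ?Qy"
    then have A: "A \<in> sets (tuple_borel n)" by (simp only: sets_fibre_prod[OF y])
    \<comment> \<open>The test function \<open>A\<close> carried to the source together with the
      density; it is merely integrable, which \<open>dual_mean_density\<close> allows.\<close>
    define \<phi> where "\<phi> w = \<rho> (?T w) * indicator A (?T w)" for w
    have \<phi>: "integrable ?Qx \<phi>"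
      unfolding \<phi>_def[abs_def] using A by (intro dens_int[of "indicator A" 1]) (auto simp: indicator_def)
    let ?l = "section_integral n (\<lambda>w. f w v) A"
    have l: "?l \<in> bounded_borel_fun (nu G)"
      by (rule section_integral_bounded_borel[OF fv A])
    interpret P: mean_product "nufib G ?x" "m ?x" ?Qx "\<lambda>p. f (insert_at n 0 p) (B v)" "C * norm (B v)"
      by (rule mean_product[OF x fv])
    have ins: "insert_at n 0 \<in> nu G \<Otimes>\<^sub>M tuple_borel n \<rightarrow>\<^sub>M tuple_borel (Suc n)"
      by (rule measurable_insert_at) simp
    \<comment> \<open>The inner integral over the target is moved to the source by the density;
      there equivariance of \<open>f\<close> removes \<open>g\<close> from all entries at
      once.\<close>
    have shift_eq: "AE u in nufib G ?x. fibre_shift G g ?l u = P.pairing \<phi> u"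
      using AE_fibre_prod_SucD[OF x f_inv] AE_nufib_fibre[OF x] AE_space
    proof eventually_elim
      case (elim u)
      note gu = mult_in_fibre[OF g elim(2)]
      have gu_space: "gmult G g u \<in> space (nu G)" and tgt_gu: "tgt G (gmult G g u) = ?y"
        using gu by (simp_all add: fibre_def space_eq)
      let ?F = "\<lambda>w. f (insert_at n 0 (gmult G g u, w)) v * indicator A w"
      have F: "?F \<in> borel_measurable (tuple_borel n)"
        by (intro borel_measurable_times borel_measurable_indicator A
            measurable_compose[OF measurable_compose[OF measurable_Pair1'[OF gu_space] ins] f(1)])
      have F_bound: "\<bar>?F w\<bar> \<le> C * norm v" for w
        using fv(2)[of "insert_at n 0 (gmult G g u, w)" v] by (auto simp: indicator_def)
      have "fibre_shift G g ?l u = (\<integral>w. ?F w \<partial>?Qy)"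
        using elim(2) by (simp add: fibre_shift_def section_integral_def tgt_gu)
      also have "\<dots> = (\<integral>w. \<rho> (?T w) * ?F (?T w) \<partial>?Qx)"
        by (rule dens[OF F F_bound])
      also have "\<dots> = (\<integral>w. f (insert_at n 0 (u, w)) (B v) * \<phi> w \<partial>?Qx)"
      proof (rule integral_cong_AE)
        show "(\<lambda>w. \<rho> (?T w) * ?F (?T w)) \<in> borel_measurable ?Qx"
          by (rule borel_measurable_integrable[OF dens_int[OF F F_bound]])
        show "(\<lambda>w. f (insert_at n 0 (u, w)) (B v) * \<phi> w) \<in> borel_measurable ?Qx"
          by (rule borel_measurable_integrable[OF P.section_integrable[OF elim(3) \<phi>]])
        show "AE w in ?Qx. \<rho> (?T w) * ?F (?T w) = f (insert_at n 0 (u, w)) (B v) * \<phi> w"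
          using elim(1)
        proof eventually_elim
          case (elim w)
          have "f (insert_at n 0 (gmult G g u, ?T w)) v = f (insert_at n 0 (u, w)) (B v)"
            unfolding insert_at_left_mult_tuple[OF \<open>u \<in> fibre G ?x\<close>] elim by simp
          then show ?case by (simp add: \<phi>_def)
        qed
      qed
      finally show ?case by (simp add: P.pairing_def)
    qed
    have "fibre_shift G g ?l \<in> ess_bounded_fun (nufib G ?x)"
    proof -
      have fib: "fibre G ?x \<in> sets (nu G)"
        using x unit_space_subset by (intro sets_fibre) auto
      \<comment> \<open>On the fibre the total map \<open>left_mult g\<close> equals multiplication
        by \<open>g\<close>, and it is measurable on the whole space.\<close>
      have "(\<lambda>u. if u \<in> fibre G ?x then ?l (left_mult g u) else 0) \<in> borel_measurable (nu G)"
        using l fib measurable_compose[OF measurable_left_mult[OF g], of ?l borel]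
        by (intro measurable_If_set) (auto simp: bounded_borel_fun_def)
      moreover have "(\<lambda>u. if u \<in> fibre G ?x then ?l (left_mult g u) else 0) = fibre_shift G g ?l"
        by (auto simp: fibre_shift_def left_mult_def)
      ultimately have "fibre_shift G g ?l \<in> borel_measurable (nufib G ?x)"
        by (simp add: measurable_cong_sets[OF sets_nufib[OF x] refl])
      moreover have "AE u in nufib G ?x. \<bar>fibre_shift G g ?l u\<bar> \<le> C * norm v"
      proof (rule AE_I2)
        fix u
        show "\<bar>fibre_shift G g ?l u\<bar> \<le> C * norm v"
        proof (cases "u \<in> fibre G ?x")
          case True
          then have "gmult G g u \<in> arrows G" using mult_in_fibre[OF g] by (simp add: fibre_def)
          then show ?thesis
            using abs_section_integral_le[OF fv A] True by (simp add: fibre_shift_def)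
        next
          case False
          have "0 \<le> C * norm v" using fv(2)[of undefined v] by linarith
          with False show ?thesis by (simp add: fibre_shift_def)
        qed
      qed
      ultimately show ?thesis unfolding ess_bounded_fun_def by blast
    qed
    note shift_mean = P.mean_cong[OF this P.pairing_ess_bounded[OF \<phi>] shift_eq]
    have "(\<integral>w. h w v * indicator A w \<partial>?Qy) = fibre_mean n (\<lambda>w. f w v) ?y (indicator A)"
      using hom_tgt integrable_indicator_fibre_prod[OF y A] by (simp add: dual_mean_density_def)
    also have "\<dots> = m ?y (fibre_restrict G ?l ?y)"
      by (rule fibre_mean_eq_fibre_restrict[OF fv A y])
    also have "\<dots> = m ?x (fibre_shift G g ?l)" using shift l by blast
    also have "\<dots> = fibre_mean n (\<lambda>w. f w (B v)) ?x \<phi>"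
      unfolding shift_mean fibre_mean_eq_pairing[OF x fv] ..
    also have "\<dots> = (\<integral>w. h w (B v) * \<phi> w \<partial>?Qx)"
      using hom_src \<phi> by (simp add: dual_mean_density_def)
    also have "\<dots> = (\<integral>w. \<rho> (?T w) * (h (?T' (?T w)) (B v) * indicator A (?T w)) \<partial>?Qx)"
    proof (rule integral_cong_AE)
      have F: "(\<lambda>w. h (?T' w) (B v) * indicator A w) \<in> borel_measurable (tuple_borel n)"
        by (intro borel_measurable_times borel_measurable_indicator A hT')
      have F_bound: "\<bar>h (?T' w) (B v) * indicator A w\<bar> \<le> C * norm (B v)" for w
        using hv(2)[of "?T' w" "B v"] by (auto simp: indicator_def)
      show "(\<lambda>w. \<rho> (?T w) * (h (?T' (?T w)) (B v) * indicator A (?T w))) \<in> borel_measurable ?Qx"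
        by (rule borel_measurable_integrable[OF dens_int[OF F F_bound]])
      show "(\<lambda>w. h w (B v) * \<phi> w) \<in> borel_measurable ?Qx"
      proof (rule borel_measurable_times[OF _ borel_measurable_integrable[OF \<phi>]])
        show "(\<lambda>w. h w (B v)) \<in> borel_measurable ?Qx"
          unfolding measurable_cong_sets[OF sets_fibre_prod[OF x] refl] by (rule h(1))
      qed
      show "AE w in ?Qx. h w (B v) * \<phi> w = \<rho> (?T w) * (h (?T' (?T w)) (B v) * indicator A (?T w))"
        using AE_fibre_prod_fibre[OF x, of n] AE_space
      proof eventually_elim
        case (elim w)
        then have "?T' (?T w) = w"
          by (intro left_mult_tuple_ginv g) (simp_all add: space_PiM PiE_def)
        then show ?case by (simp add: \<phi>_def)
      qed
    qed
    also have "\<dots> = (\<integral>w. h (?T' w) (B v) * indicator A w \<partial>?Qy)"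
    proof (rule dens[symmetric])
      show "(\<lambda>w. h (?T' w) (B v) * indicator A w) \<in> borel_measurable (tuple_borel n)"
        by (intro borel_measurable_times borel_measurable_indicator A hT')
      show "\<bar>h (?T' w) (B v) * indicator A w\<bar> \<le> C * norm (B v)" for w
        using hv(2)[of "?T' w" "B v"] by (auto simp: indicator_def)
    qed
    finally show "(\<integral>w. (h (?T' w) o\<^sub>L B) v * indicator A w \<partial>?Qy) = (\<integral>w. h w v * indicator A w \<partial>?Qy)"
      by simp
  qed
qed

text \<open>The products are defined only when all entries share a target, so the source is the
  space of tuples and not the full product.\<close>

lemma measurable_translated_tuple:
  "(\<lambda>w. \<lambda>i\<in>{..<n}. gmult G (ginv G (w 0)) (w (Suc i))) \<in> nu_tuples G (Suc n) \<rightarrow>\<^sub>M tuple_borel n"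
proof (rule measurable_restrict)
  fix i assume i: "i \<in> {..<n}"
  show "(\<lambda>w. gmult G (ginv G (w 0)) (w (Suc i))) \<in> nu_tuples G (Suc n) \<rightarrow>\<^sub>M nu G"
  proof (rule measurable_gmult)
    show "(\<lambda>w. ginv G (w 0)) \<in> nu_tuples G (Suc n) \<rightarrow>\<^sub>M nu G"
      by (intro measurable_nu_tuples measurable_compose[OF measurable_tuple_component inv_borel]) simp
    show "(\<lambda>w. w (Suc i)) \<in> nu_tuples G (Suc n) \<rightarrow>\<^sub>M nu G"
      using i by (intro measurable_nu_tuples measurable_tuple_component) simp
    fix w assume "w \<in> space (nu_tuples G (Suc n))"
    then have w: "w \<in> tuples G (Suc n)" by (simp add: space_nu_tuples)
    then have "w 0 \<in> arrows G" "w (Suc i) \<in> arrows G" "tgt G (w 0) = tgt G (w (Suc i))"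
      using i by (auto simp: tuples_def PiE_def Pi_def)
    then show "(ginv G (w 0), w (Suc i)) \<in> composable G"
      by (simp add: composable_iff inv_closed src_inv)
  qed
qed

text \<open>\<open>l\<close> is the given invariant cochain and \<open>f\<close> its bounded Borel
  representative. Replacing \<open>l\<close> by \<open>f\<close> in the invariance condition needs
  their equality over both ends of almost every arrow, which \<open>AE_src\<close> and
  \<open>AE_tgt\<close> provide.\<close>

lemma homotopy_invariant:
  fixes f h l :: "('a, 'v::{real_normed_vector, second_countable_topology}) cochain"
    and Lb :: "'a \<Rightarrow> 'v \<Rightarrow>\<^sub>L 'v"
  assumes f: "\<And>v. (\<lambda>w. f w v) \<in> borel_measurable (tuple_borel (Suc n))" "\<And>w. norm (f w) \<le> C"
    and h: "\<And>v. (\<lambda>w. h w v) \<in> borel_measurable (tuple_borel n)" "\<And>w. norm (h w) \<le> C"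
    and homotopy: "AE x in mu G. dual_mean_density n f h x"
    and f_eq: "AE w in nu_tuples G (Suc n). f w = l w"
    and l_inv: "invariant_fun G Lb (Suc n) l"
    and Lb: "\<And>v. (\<lambda>g. Lb g v) \<in> borel_measurable (nu G)"
  shows "invariant_fun G Lb n h"
  unfolding invariant_fun_def
proof (rule AE_nu_tuples_SucI)
  let ?P = "\<lambda>w. contragredient G Lb (w 0) (h (\<lambda>i\<in>{..<n}. gmult G (ginv G (w 0)) (w (Suc i)))) =
    h (\<lambda>i\<in>{..<n}. w (Suc i))"
  show "Measurable.pred (nu_tuples G (Suc n)) ?P"
  proof (rule pred_dual_eq)
    fix v
    have "(\<lambda>w. Lb (ginv G (w 0)) v) \<in> borel_measurable (nu_tuples G (Suc n))"
      by (intro measurable_nu_tuples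
          measurable_compose[OF measurable_compose[OF measurable_tuple_component inv_borel] Lb]) simp
    then have "(\<lambda>w. h (\<lambda>i\<in>{..<n}. gmult G (ginv G (w 0)) (w (Suc i))) (Lb (ginv G (w 0)) v))
        \<in> borel_measurable (nu_tuples G (Suc n))"
      by (rule borel_measurable_dual_apply[rotated])
        (rule measurable_compose[OF measurable_translated_tuple h(1)])
    then show "(\<lambda>w. contragredient G Lb (w 0) (h (\<lambda>i\<in>{..<n}. gmult G (ginv G (w 0)) (w (Suc i)))) v)
        \<in> borel_measurable (nu_tuples G (Suc n))"
      by (simp add: contragredient_def)
    have "(\<lambda>w. \<lambda>i\<in>{..<n}. w (Suc i)) \<in> tuple_borel (Suc n) \<rightarrow>\<^sub>M tuple_borel n"
      by (intro measurable_restrict measurable_tuple_component) simp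
    then show "(\<lambda>w. h (\<lambda>i\<in>{..<n}. w (Suc i)) v) \<in> borel_measurable (nu_tuples G (Suc n))"
      by (intro measurable_nu_tuples measurable_compose[OF _ h(1)])
  qed
  have means_inv: "AE g in nu G. \<forall>l\<in>bounded_borel_fun (nu G).
      m (tgt G g) (fibre_restrict G l (tgt G g)) = m (src G g) (fibre_shift G g l)"
    using means by (simp add: invariant_system_of_means_def)
  show "AE g in nu G. AE w in fibre_prod n (tgt G g). ?P (insert_at n 0 (g, w))"
    using quasi_invariant means_inv AE_nu_tuples_SucD[OF l_inv[unfolded invariant_fun_def]]
      AE_src[OF homotopy] AE_tgt[OF homotopy] AE_src[OF AE_nu_tuplesD[OF f_eq]] AE_tgt[OF AE_nu_tuplesD[OF f_eq]]
      AE_space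
  proof eventually_elim
    case (elim g)
    then have g: "g \<in> arrows G" by (simp add: space_eq)
    have x: "src G g \<in> unit_space G" and y: "tgt G g \<in> unit_space G"
      by (simp_all add: src_in_unit_space tgt_in_unit_space g)
    let ?N = "Suc n"
    have translated: "(\<lambda>i\<in>{..<k}. gmult G (ginv G g) (w i)) = left_mult_tuple k (ginv G g) w"
      if "\<forall>i<k. w i \<in> fibre G (tgt G g)" for k w
      using that by (auto simp: left_mult_tuple_def compose_def left_mult_def src_inv g fun_eq_iff)
    have restrict_eq: "(\<lambda>i\<in>{..<k}. w i) = w" if "w \<in> space (fibre_prod k (tgt G g))" for k w
      using that by (auto simp: space_PiM PiE_def extensional_restrict)
    \<comment> \<open>Only the untranslated value is replaced by \<open>f\<close> here. The
      translated tuple lies over the source and is treated after pulling back along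
      \<open>g\<close>.\<close>
    have "AE w in fibre_prod ?N (tgt G g). contragredient G Lb g (l (left_mult_tuple ?N (ginv G g) w)) = f w"
      using elim(3) elim(7) AE_fibre_prod_fibre[OF y, of ?N] AE_space
    proof eventually_elim
      case (elim w)
      have "(\<lambda>i\<in>{..<?N}. gmult G (ginv G g) (insert_at ?N 0 (g, w) (Suc i))) = left_mult_tuple ?N (ginv G g) w"
        "(\<lambda>i\<in>{..<?N}. insert_at ?N 0 (g, w) (Suc i)) = w"
        using translated[OF elim(3)] restrict_eq[OF elim(4)] by (simp_all add: insert_at_0_Suc cong: restrict_cong)
      then show ?case using elim(1,2) by (simp add: insert_at_0_0)
    qed
    then have "AE w in fibre_prod ?N (src G g). contragredient G Lb g
        (l (left_mult_tuple ?N (ginv G g) (left_mult_tuple ?N g w))) = f (left_mult_tuple ?N g w)"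
      by (rule AE_left_mult_tuple[OF g elim(1)])
    then have "AE w in fibre_prod ?N (src G g). f (left_mult_tuple ?N g w) = f w o\<^sub>L Lb (ginv G g)"
      using elim(6) AE_fibre_prod_fibre[OF x, of ?N] AE_space
    proof eventually_elim
      case (elim w)
      then have "left_mult_tuple ?N (ginv G g) (left_mult_tuple ?N g w) = w"
        by (intro left_mult_tuple_ginv g) (simp_all add: space_PiM PiE_def)
      then show ?case using elim(1,2) by (simp add: contragredient_def)
    qed
    from homotopy_equivariant_fibre[OF f h g elim(1,2) this elim(4,5)]
    show ?case
      using AE_fibre_prod_fibre[OF y, of n] AE_space
    proof eventually_elim
      case (elim w)
      have "(\<lambda>i\<in>{..<n}. gmult G (ginv G g) (insert_at n 0 (g, w) (Suc i))) = left_mult_tuple n (ginv G g) w"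
        "(\<lambda>i\<in>{..<n}. insert_at n 0 (g, w) (Suc i)) = w"
        using translated[OF elim(2)] restrict_eq[OF elim(3)] by (simp_all add: insert_at_0_Suc cong: restrict_cong)
      then show ?case using elim(1) by (simp add: insert_at_0_0 contragredient_def)
    qed
  qed
qed

end

subsection \<open>The cohomology groups\<close>

lemma omit_omit:
  assumes "j < i"
  shows "omit k j (omit (Suc k) i w) = omit k (i - 1) (omit (Suc k) j w)"
  using assms by (auto simp: omit_def fun_eq_iff)

text \<open>Sending \<open>(i, j)\<close> with \<open>j < i\<close> to \<open>(j, i - 1)\<close>
  matches the pairs below the diagonal with the remaining ones; matched terms delete the same two
  entries and have opposite signs.\<close>

lemma coboundary_fun_coboundary_fun:
  fixes f :: "('a, 'v::real_normed_vector) cochain"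
  shows "coboundary_fun (Suc k) (coboundary_fun k f) w = 0"
proof -
  let ?n = "Suc (Suc k)"
  define a where "a p = (-1) ^ (fst p + snd p) *\<^sub>R f (omit k (snd p) (omit (Suc k) (fst p) w))" for p
  let ?S = "{..<Suc ?n} \<times> {..<?n}"
  let ?L = "{p \<in> ?S. snd p < fst p}" and ?U = "{p \<in> ?S. fst p \<le> snd p}"
  have "coboundary_fun (Suc k) (coboundary_fun k f) w = (\<Sum>i<Suc ?n. \<Sum>j<?n. a (i, j))"
    unfolding coboundary_fun_def
    by (simp add: a_def scaleR_sum_right power_add del: sum.lessThan_Suc)
  also have "\<dots> = sum a ?S"
    by (simp add: sum.cartesian_product del: sum.lessThan_Suc)
  also have "?S = ?L \<union> ?U" by auto
  also have "sum a (?L \<union> ?U) = sum a ?L + sum a ?U"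
    by (rule sum.union_disjoint) auto
  also have "sum a ?L = (\<Sum>p\<in>?U. - a p)"
  proof (rule sum.reindex_bij_witness[where i="\<lambda>(i, j). (Suc j, i)" and j="\<lambda>(i, j). (j, i - 1)"])
    fix p assume "p \<in> ?L"
    then obtain i j where p: "p = (i, j)" "j < i" by (cases p) auto
    have "(-1::real) ^ (i + j) = - ((-1) ^ (j + (i - 1)))"
      using p(2) by (cases i) (simp_all add: add.commute)
    then show "- a (case p of (i, j) \<Rightarrow> (j, i - 1)) = a p"
      by (simp add: a_def p omit_omit)
  qed auto
  finally show ?thesis by (simp add: sum_negf)
qed

lemma contragredient_add:
  fixes l l' :: "'v::real_normed_vector \<Rightarrow>\<^sub>L real"
  shows "contragredient G Lb g (l + l') = contragredient G Lb g l + contragredient G Lb g l'"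
  by (rule blinfun_eqI) (simp add: contragredient_def blinfun.add_left)

lemma contragredient_scaleR:
  fixes l :: "'v::real_normed_vector \<Rightarrow>\<^sub>L real"
  shows "contragredient G Lb g (c *\<^sub>R l) = c *\<^sub>R contragredient G Lb g l"
  by (rule blinfun_eqI) (simp add: contragredient_def blinfun.scaleR_left)

lemma contragredient_sum:
  fixes l :: "'i \<Rightarrow> 'v::real_normed_vector \<Rightarrow>\<^sub>L real"
  shows "contragredient G Lb g (\<Sum>i\<in>I. c i *\<^sub>R l i) = (\<Sum>i\<in>I. c i *\<^sub>R contragredient G Lb g (l i))"
  by (rule blinfun_eqI) (simp add: contragredient_def sum_blinfun_apply blinfun.scaleR_left)

section \<open>Cochain groups of almost-everywhere classes\<close>

context measured_groupoid
begin

lemma omit_in_tuples: "w \<in> tuples G (Suc (Suc k)) \<Longrightarrow> omit k i w \<in> tuples G (Suc k)"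
  by (auto simp: tuples_def omit_def PiE_def Pi_def)

lemma measurable_omit_nu_tuples:
  "omit k i \<in> nu_tuples G (Suc (Suc k)) \<rightarrow>\<^sub>M nu_tuples G (Suc k)"
  unfolding measurable_cong_sets[OF sets_nu_tuples sets_nu_tuples]
  by (rule measurable_restrict_space3[OF measurable_omit]) (auto intro: omit_in_tuples)

text \<open>Deleting an entry sends a power of a fibre probability to the next lower power, so null
  sets pull back to null sets. This makes the coboundary well defined on classes.\<close>

lemma AE_omit:
  assumes "AE w in nu_tuples G (Suc k). P w"
  shows "AE w in nu_tuples G (Suc (Suc k)). P (omit k i w)"
proof -
  obtain S where S: "S \<in> sets (tuple_borel (Suc k))" "\<And>w. w \<in> tuples G (Suc k) \<Longrightarrow> w \<in> S \<Longrightarrow> P w"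
    "AE x in mu G. AE w in fibre_prod (Suc k) x. w \<in> S"
    using assms by (rule AE_nu_tuplesE) blast
  have "AE x in mu G. AE w in fibre_prod (Suc (Suc k)) x. omit k i w \<in> S"
    using S(3) AE_space
  proof eventually_elim
    case (elim x)
    then have x: "x \<in> unit_space G" by (simp add: space_mu)
    have "AE w in distr (fibre_prod (Suc (Suc k)) x) (fibre_prod (Suc k) x) (omit k i). w \<in> S"
      unfolding distr_omit[OF prob_space_nufib[OF x]] by (rule elim(1))
    then show ?case by (rule AE_distrD[OF measurable_omit])
  qed
  then have "AE w in nu_tuples G (Suc (Suc k)). omit k i w \<in> S"
    by (rule AE_nu_tuplesI) (intro measurable_nu_tuples pred_sets2[OF S(1) measurable_omit])
  then show ?thesis
    using AE_space
  proof eventually_elim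
    case (elim w)
    then show ?case using S(2) omit_in_tuples by (simp add: space_nu_tuples)
  qed
qed

lemma AE_coboundary_fun_cong:
  fixes f f' :: "('a, 'v::real_normed_vector) cochain"
  assumes "AE w in nu_tuples G (Suc k). f w = f' w"
  shows "AE w in nu_tuples G (Suc (Suc k)). coboundary_fun k f w = coboundary_fun k f' w"
proof -
  have "AE w in nu_tuples G (Suc (Suc k)). \<forall>i\<in>{..<Suc (Suc k)}. f (omit k i w) = f' (omit k i w)"
    by (rule AE_finite_allI) (simp_all add: AE_omit[OF assms])
  then show ?thesis
    by eventually_elim (simp add: coboundary_fun_def del: sum.lessThan_Suc)
qed

lemma in_wstar_fun_iff:
  "f \<in> carrier (wstar_fun G n) \<longleftrightarrow>
    (\<forall>v. (\<lambda>w. blinfun_apply (f w) v) \<in> borel_measurable (nu_tuples G n)) \<and>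
    (\<exists>C. AE w in nu_tuples G n. norm (f w) \<le> C)"
  by (simp add: wstar_fun_def)

lemma wstar_fun_add:
  assumes "f \<in> carrier (wstar_fun G n)" "f' \<in> carrier (wstar_fun G n)"
  shows "(\<lambda>w. f w + f' w) \<in> carrier (wstar_fun G n)"
proof -
  obtain C C' where b: "AE w in nu_tuples G n. norm (f w) \<le> C" "AE w in nu_tuples G n. norm (f' w) \<le> C'"
    using assms unfolding in_wstar_fun_iff by blast
  from b have "AE w in nu_tuples G n. norm (f w + f' w) \<le> C + C'"
    by eventually_elim (rule norm_triangle_mono)
  moreover have "(\<lambda>w. blinfun_apply (f w + f' w) v) \<in> borel_measurable (nu_tuples G n)" for v
    using assms unfolding in_wstar_fun_iff blinfun.add_left by (intro borel_measurable_add) blast+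
  ultimately show ?thesis unfolding in_wstar_fun_iff by blast
qed

lemma wstar_fun_scaleR:
  assumes "f \<in> carrier (wstar_fun G n)"
  shows "(\<lambda>w. c *\<^sub>R f w) \<in> carrier (wstar_fun G n)"
proof -
  obtain C where b: "AE w in nu_tuples G n. norm (f w) \<le> C"
    using assms unfolding in_wstar_fun_iff by blast
  from b have "AE w in nu_tuples G n. norm (c *\<^sub>R f w) \<le> \<bar>c\<bar> * C"
    by eventually_elim (simp add: mult_left_mono)
  moreover have "(\<lambda>w. blinfun_apply (c *\<^sub>R f w) v) \<in> borel_measurable (nu_tuples G n)" for v
    using assms unfolding in_wstar_fun_iff blinfun.scaleR_left by (intro borel_measurable_scaleR) auto
  ultimately show ?thesis unfolding in_wstar_fun_iff by blast
qed

lemma wstar_fun_zero: "(\<lambda>w. 0) \<in> carrier (wstar_fun G n)"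
  unfolding in_wstar_fun_iff by (auto intro: exI[of _ 0])

lemma wstar_fun_sum:
  assumes "\<And>i. i \<in> I \<Longrightarrow> f i \<in> carrier (wstar_fun G n)"
  shows "(\<lambda>w. \<Sum>i\<in>I. f i w) \<in> carrier (wstar_fun G n)"
  using assms by (induction I rule: infinite_finite_induct) (simp_all add: wstar_fun_zero wstar_fun_add)

lemma mult_wstar_fun: "f \<otimes>\<^bsub>wstar_fun G n\<^esub> f' = (\<lambda>w. f w + f' w)"
  and one_wstar_fun: "\<one>\<^bsub>wstar_fun G n\<^esub> = (\<lambda>w. 0)"
  by (simp_all add: wstar_fun_def)

lemma comm_group_wstar_fun:
  "comm_group (wstar_fun G n :: ('a, 'v::real_normed_vector) cochain monoid)"
proof (rule comm_groupI)
  fix f :: "('a, 'v) cochain" assume f: "f \<in> carrier (wstar_fun G n)"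
  show "\<exists>f'\<in>carrier (wstar_fun G n). f' \<otimes>\<^bsub>wstar_fun G n\<^esub> f = \<one>\<^bsub>wstar_fun G n\<^esub>"
    using wstar_fun_scaleR[OF f, of "-1"]
    by (intro bexI[of _ "\<lambda>w. (-1) *\<^sub>R f w"]) (simp_all add: mult_wstar_fun one_wstar_fun)
qed (simp_all add: mult_wstar_fun one_wstar_fun wstar_fun_add wstar_fun_zero ac_simps)

lemma inv_wstar_fun:
  fixes f :: "('a, 'v::real_normed_vector) cochain"
  assumes f: "f \<in> carrier (wstar_fun G n)"
  shows "inv\<^bsub>wstar_fun G n\<^esub> f = (\<lambda>w. (-1) *\<^sub>R f w)"
proof -
  interpret comm_group "wstar_fun G n :: ('a, 'v) cochain monoid"
    by (rule comm_group_wstar_fun)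
  show ?thesis
    using wstar_fun_scaleR[OF f, of "-1"] f
    by (intro inv_equality) (simp_all add: mult_wstar_fun one_wstar_fun)
qed

lemma subgroup_null_fun:
  "subgroup (null_fun G n :: ('a, 'v::real_normed_vector) cochain set) (wstar_fun G n)"
proof (rule subgroup.intro)
  show "(null_fun G n :: ('a, 'v) cochain set) \<subseteq> carrier (wstar_fun G n)"
    by (auto simp: null_fun_def)
  show "\<one>\<^bsub>wstar_fun G n\<^esub> \<in> (null_fun G n :: ('a, 'v) cochain set)"
    by (simp add: null_fun_def one_wstar_fun wstar_fun_zero)
  fix f f' :: "('a, 'v) cochain"
  assume f: "f \<in> null_fun G n"
  then have "AE w in nu_tuples G n. (-1) *\<^sub>R f w = 0" by (auto simp: null_fun_def)
  then show "inv\<^bsub>wstar_fun G n\<^esub> f \<in> null_fun G n"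
    using f wstar_fun_scaleR[of f n "-1"] by (auto simp: null_fun_def inv_wstar_fun)
  assume f': "f' \<in> null_fun G n"
  have "AE w in nu_tuples G n. f w = 0" "AE w in nu_tuples G n. f' w = 0"
    using f f' by (simp_all add: null_fun_def)
  then have "AE w in nu_tuples G n. f w + f' w = 0" by eventually_elim simp
  then show "f \<otimes>\<^bsub>wstar_fun G n\<^esub> f' \<in> null_fun G n"
    using f f' by (simp add: null_fun_def mult_wstar_fun wstar_fun_add)
qed

lemma ae_class_eq:
  assumes f: "f \<in> carrier (wstar_fun G n)"
  shows "ae_class G n f = {f' \<in> carrier (wstar_fun G n). AE w in nu_tuples G n. f' w = f w}"
proof (intro equalityI subsetI)
  fix f' assume "f' \<in> ae_class G n f"
  then obtain z where z: "z \<in> null_fun G n" "f' = (\<lambda>w. z w + f w)"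
    by (auto simp: ae_class_def r_coset_def mult_wstar_fun)
  then have z0: "AE w in nu_tuples G n. z w = 0" by (simp add: null_fun_def)
  then have "AE w in nu_tuples G n. f' w = f w" by eventually_elim (simp add: z(2))
  then show "f' \<in> {f' \<in> carrier (wstar_fun G n). AE w in nu_tuples G n. f' w = f w}"
    using z f by (simp add: null_fun_def wstar_fun_add)
next
  fix f' assume f': "f' \<in> {f' \<in> carrier (wstar_fun G n). AE w in nu_tuples G n. f' w = f w}"
  let ?z = "\<lambda>w. f' w + (-1) *\<^sub>R f w"
  have "?z \<in> carrier (wstar_fun G n)"
    using f f' by (intro wstar_fun_add wstar_fun_scaleR) simp_all
  moreover have "AE w in nu_tuples G n. ?z w = 0"
    using f' by (auto elim: eventually_mono)
  ultimately have "?z \<in> null_fun G n" by (simp add: null_fun_def)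
  moreover have "f' = ?z \<otimes>\<^bsub>wstar_fun G n\<^esub> f" by (simp add: mult_wstar_fun)
  ultimately show "f' \<in> ae_class G n f" unfolding ae_class_def r_coset_def by blast
qed

lemma ae_class_eq_iff:
  assumes "f \<in> carrier (wstar_fun G n)" "f' \<in> carrier (wstar_fun G n)"
  shows "ae_class G n f = ae_class G n f' \<longleftrightarrow> (AE w in nu_tuples G n. f w = f' w)"
proof
  assume "ae_class G n f = ae_class G n f'"
  moreover have "f \<in> ae_class G n f" using assms by (simp add: ae_class_eq)
  ultimately show "AE w in nu_tuples G n. f w = f' w" using assms by (simp add: ae_class_eq)
next
  assume eq: "AE w in nu_tuples G n. f w = f' w"
  have "(AE w in nu_tuples G n. u w = f w) \<longleftrightarrow> (AE w in nu_tuples G n. u w = f' w)" for u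
  proof
    assume "AE w in nu_tuples G n. u w = f w"
    with eq show "AE w in nu_tuples G n. u w = f' w" by eventually_elim simp
  next
    assume "AE w in nu_tuples G n. u w = f' w"
    with eq show "AE w in nu_tuples G n. u w = f w" by eventually_elim simp
  qed
  then show "ae_class G n f = ae_class G n f'" using assms by (simp add: ae_class_eq)
qed

lemma ae_class_zero: "ae_class G n (\<lambda>w. 0) = null_fun G n"
  by (auto simp: ae_class_eq wstar_fun_zero null_fun_def)

lemma comm_group_Linf_wstar:
  "comm_group (Linf_wstar G n :: ('a, 'v::real_normed_vector) cochain set monoid)"
  unfolding Linf_wstar_def by (rule comm_group.abelian_FactGroup[OF comm_group_wstar_fun subgroup_null_fun])

lemma ae_class_mult:
  assumes "f \<in> carrier (wstar_fun G n)" "f' \<in> carrier (wstar_fun G n)"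
  shows "ae_class G n f \<otimes>\<^bsub>Linf_wstar G n\<^esub> ae_class G n f' = ae_class G n (\<lambda>w. f w + f' w)"
  using normal.rcos_sum[OF comm_group.subgroup_imp_normal[OF comm_group_wstar_fun subgroup_null_fun] assms]
  by (simp add: ae_class_def Linf_wstar_def FactGroup_def mult_wstar_fun)

lemma one_Linf_wstar: "\<one>\<^bsub>Linf_wstar G n\<^esub> = null_fun G n"
  by (simp add: Linf_wstar_def FactGroup_def)

lemma ae_class_closed:
  "f \<in> carrier (wstar_fun G n) \<Longrightarrow> ae_class G n f \<in> carrier (Linf_wstar G n)"
  by (auto simp: Linf_wstar_def FactGroup_def RCOSETS_def ae_class_def)

lemma coboundary_fun_closed:
  fixes f :: "('a, 'v::real_normed_vector) cochain"
  assumes f: "f \<in> carrier (wstar_fun G (Suc k))"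
  shows "coboundary_fun k f \<in> carrier (wstar_fun G (Suc (Suc k)))"
proof -
  have "(\<lambda>w. f (omit k i w)) \<in> carrier (wstar_fun G (Suc (Suc k)))" for i
  proof -
    obtain C where "AE w in nu_tuples G (Suc k). norm (f w) \<le> C"
      using f unfolding in_wstar_fun_iff by blast
    then have "AE w in nu_tuples G (Suc (Suc k)). norm (f (omit k i w)) \<le> C" by (rule AE_omit)
    moreover have "(\<lambda>w. f (omit k i w) v) \<in> borel_measurable (nu_tuples G (Suc (Suc k)))" for v
      using f unfolding in_wstar_fun_iff by (intro measurable_compose[OF measurable_omit_nu_tuples]) simp
    ultimately show ?thesis unfolding in_wstar_fun_iff by blast
  qed
  then show ?thesis
    unfolding coboundary_fun_def[abs_def] by (intro wstar_fun_sum wstar_fun_scaleR)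
qed

text \<open>The union in \<open>coboundary\<close> runs over sets that all coincide, because
  representatives equal almost everywhere have coboundaries equal almost everywhere.\<close>

lemma coboundary_ae_class:
  fixes f :: "('a, 'v::real_normed_vector) cochain"
  assumes f: "f \<in> carrier (wstar_fun G (Suc k))"
  shows "coboundary G k (ae_class G (Suc k) f) = ae_class G (Suc (Suc k)) (coboundary_fun k f)"
proof -
  have "ae_class G (Suc (Suc k)) (coboundary_fun k f') = ae_class G (Suc (Suc k)) (coboundary_fun k f)"
    if "f' \<in> ae_class G (Suc k) f" for f'
    using that f
    by (subst ae_class_eq_iff) (auto simp: ae_class_eq intro: coboundary_fun_closed AE_coboundary_fun_cong)
  moreover have "f \<in> ae_class G (Suc k) f" using f by (simp add: ae_class_eq)
  ultimately show ?thesis unfolding coboundary_def by blast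
qed

lemma coboundary_fun_invariant:
  fixes f :: "('a, 'v::real_normed_vector) cochain"
  assumes "invariant_fun G Lb (Suc k) f"
  shows "invariant_fun G Lb (Suc (Suc k)) (coboundary_fun k f)"
proof -
  let ?P = "\<lambda>w. contragredient G Lb (w 0) (f (\<lambda>i\<in>{..<Suc k}. gmult G (ginv G (w 0)) (w (Suc i)))) =
    f (\<lambda>i\<in>{..<Suc k}. w (Suc i))"
  \<comment> \<open>Deleting index \<open>Suc j\<close> leaves entry 0, the acting arrow, in place
    and deletes entry \<open>j\<close> of the tuple acted upon.\<close>
  have "AE w in nu_tuples G (Suc (Suc (Suc k))). \<forall>j\<in>{..<Suc (Suc k)}. ?P (omit (Suc k) (Suc j) w)"
    using assms unfolding invariant_fun_def
    by (intro AE_finite_allI AE_omit[where P="?P"]) simp_all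
  then show ?thesis
    unfolding invariant_fun_def
  proof eventually_elim
    case (elim w)
    let ?w = "\<lambda>i\<in>{..<Suc (Suc k)}. w (Suc i)"
    let ?gw = "\<lambda>i\<in>{..<Suc (Suc k)}. gmult G (ginv G (w 0)) (w (Suc i))"
    have "contragredient G Lb (w 0) (f (omit k j ?gw)) = f (omit k j ?w)" if "j < Suc (Suc k)" for j
    proof -
      have w0: "omit (Suc k) (Suc j) w 0 = w 0" by (simp add: omit_def)
      have eqs: "(\<lambda>i\<in>{..<Suc k}. gmult G (ginv G (w 0)) (omit (Suc k) (Suc j) w (Suc i))) = omit k j ?gw"
        "(\<lambda>i\<in>{..<Suc k}. omit (Suc k) (Suc j) w (Suc i)) = omit k j ?w"
        by (auto simp: omit_def fun_eq_iff)
      have "?P (omit (Suc k) (Suc j) w)" using elim that by blast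
      then show ?thesis unfolding w0 eqs .
    qed
    then show ?case
      unfolding coboundary_fun_def contragredient_sum by (intro sum.cong) simp_all
  qed
qed

lemma invariant_fun_add:
  fixes f f' :: "('a, 'v::real_normed_vector) cochain"
  assumes "invariant_fun G Lb n f" "invariant_fun G Lb n f'"
  shows "invariant_fun G Lb n (\<lambda>w. f w + f' w)"
  using assms unfolding invariant_fun_def
proof eventually_elim
  case (elim w)
  then show ?case by (simp add: contragredient_add)
qed

lemma invariant_fun_scaleR:
  fixes f :: "('a, 'v::real_normed_vector) cochain"
  assumes "invariant_fun G Lb n f"
  shows "invariant_fun G Lb n (\<lambda>w. c *\<^sub>R f w)"
  using assms unfolding invariant_fun_def
proof eventually_elim
  case (elim w)
  then show ?case by (simp add: contragredient_scaleR)
qed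

lemma invariant_fun_zero: "invariant_fun G Lb n (\<lambda>w. 0)"
  unfolding invariant_fun_def by (auto simp: contragredient_def)

lemma in_cochains_iff:
  "X \<in> carrier (cochains G Lb k) \<longleftrightarrow>
    (\<exists>f. X = ae_class G (Suc k) f \<and> f \<in> carrier (wstar_fun G (Suc k)) \<and> invariant_fun G Lb (Suc k) f)"
  by (auto simp: cochains_def)

lemma mult_cochains: "X \<otimes>\<^bsub>cochains G Lb k\<^esub> Y = X \<otimes>\<^bsub>Linf_wstar G (Suc k)\<^esub> Y"
  and one_cochains: "\<one>\<^bsub>cochains G Lb k\<^esub> = null_fun G (Suc k)"
  by (simp_all add: cochains_def one_Linf_wstar)

lemma group_cochains:
  fixes Lb :: "'a \<Rightarrow> 'v::real_normed_vector \<Rightarrow>\<^sub>L 'v"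
  shows "group (cochains G Lb k)"
proof -
  let ?S = "{ae_class G (Suc k) f | f. f \<in> carrier (wstar_fun G (Suc k)) \<and> invariant_fun G Lb (Suc k) f}"
  interpret L: comm_group "Linf_wstar G (Suc k) :: ('a, 'v) cochain set monoid"
    by (rule comm_group_Linf_wstar)
  have "subgroup ?S (Linf_wstar G (Suc k))"
  proof (rule subgroup.intro)
    show "?S \<subseteq> carrier (Linf_wstar G (Suc k))" by (auto intro: ae_class_closed)
    show "\<one>\<^bsub>Linf_wstar G (Suc k)\<^esub> \<in> ?S"
      unfolding one_Linf_wstar ae_class_zero[symmetric] using wstar_fun_zero invariant_fun_zero by blast
  next
    fix X Y assume "X \<in> ?S" "Y \<in> ?S"
    then obtain f f' where f: "X = ae_class G (Suc k) f" "f \<in> carrier (wstar_fun G (Suc k))" "invariant_fun G Lb (Suc k) f"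
      and f': "Y = ae_class G (Suc k) f'" "f' \<in> carrier (wstar_fun G (Suc k))" "invariant_fun G Lb (Suc k) f'"
      by blast
    show "X \<otimes>\<^bsub>Linf_wstar G (Suc k)\<^esub> Y \<in> ?S"
      unfolding f(1) f'(1) ae_class_mult[OF f(2) f'(2)]
      using wstar_fun_add[OF f(2) f'(2)] invariant_fun_add[OF f(3) f'(3)] by blast
  next
    fix X assume "X \<in> ?S"
    then obtain f where f: "X = ae_class G (Suc k) f" "f \<in> carrier (wstar_fun G (Suc k))" "invariant_fun G Lb (Suc k) f"
      by blast
    let ?f = "\<lambda>w. (-1) *\<^sub>R f w"
    have f': "?f \<in> carrier (wstar_fun G (Suc k))" by (rule wstar_fun_scaleR[OF f(2)])
    have "ae_class G (Suc k) ?f \<otimes>\<^bsub>Linf_wstar G (Suc k)\<^esub> X = \<one>\<^bsub>Linf_wstar G (Suc k)\<^esub>"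
      unfolding f(1) ae_class_mult[OF f' f(2)] one_Linf_wstar ae_class_zero[symmetric] by simp
    then have "inv\<^bsub>Linf_wstar G (Suc k)\<^esub> X = ae_class G (Suc k) ?f"
      using f f' by (intro L.inv_equality) (auto intro: ae_class_closed)
    then show "inv\<^bsub>Linf_wstar G (Suc k)\<^esub> X \<in> ?S"
      using f' invariant_fun_scaleR[OF f(3), of "-1"] by blast
  qed
  then show ?thesis
    unfolding cochains_def by (rule subgroup.subgroup_is_group) (rule L.group_axioms)
qed

lemma group_hom_coboundary:
  fixes Lb :: "'a \<Rightarrow> 'v::real_normed_vector \<Rightarrow>\<^sub>L 'v"
  shows "group_hom (cochains G Lb k) (cochains G Lb (Suc k)) (coboundary G k)"
proof (intro group_hom.intro group_hom_axioms.intro group_cochains homI)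
  fix X assume "X \<in> carrier (cochains G Lb k)"
  then obtain f where f: "X = ae_class G (Suc k) f" "f \<in> carrier (wstar_fun G (Suc k))" "invariant_fun G Lb (Suc k) f"
    unfolding in_cochains_iff by blast
  show "coboundary G k X \<in> carrier (cochains G Lb (Suc k))"
    unfolding f(1) coboundary_ae_class[OF f(2)] in_cochains_iff
    using coboundary_fun_closed[OF f(2)] coboundary_fun_invariant[OF f(3)] by blast
  fix Y assume "Y \<in> carrier (cochains G Lb k)"
  then obtain f' where f': "Y = ae_class G (Suc k) f'" "f' \<in> carrier (wstar_fun G (Suc k))"
    unfolding in_cochains_iff by blast
  have "coboundary_fun k (\<lambda>w. f w + f' w) = (\<lambda>w. coboundary_fun k f w + coboundary_fun k f' w)"
    by (simp add: coboundary_fun_def scaleR_add_right sum.distrib fun_eq_iff del: sum.lessThan_Suc)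
  then show "coboundary G k (X \<otimes>\<^bsub>cochains G Lb k\<^esub> Y) =
      coboundary G k X \<otimes>\<^bsub>cochains G Lb (Suc k)\<^esub> coboundary G k Y"
    unfolding mult_cochains f(1) f'(1) ae_class_mult[OF f(2) f'(2)]
      coboundary_ae_class[OF f(2)] coboundary_ae_class[OF f'(2)] coboundary_ae_class[OF wstar_fun_add[OF f(2) f'(2)]]
      ae_class_mult[OF coboundary_fun_closed[OF f(2)] coboundary_fun_closed[OF f'(2)]] by simp
qed

lemma subgroup_cocycles:
  fixes Lb :: "'a \<Rightarrow> 'v::real_normed_vector \<Rightarrow>\<^sub>L 'v"
  shows "subgroup (cocycles G Lb k) (cochains G Lb k)"
  unfolding cocycles_def by (rule group_hom.subgroup_kernel[OF group_hom_coboundary])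

lemma coboundaries_subset_cocycles:
  fixes Lb :: "'a \<Rightarrow> 'v::real_normed_vector \<Rightarrow>\<^sub>L 'v"
  shows "coboundaries G Lb (Suc k) \<subseteq> cocycles G Lb (Suc k)"
proof
  fix Y assume "Y \<in> coboundaries G Lb (Suc k)"
  then obtain X where X: "X \<in> carrier (cochains G Lb k)" "Y = coboundary G k X" by auto
  then obtain f where f: "X = ae_class G (Suc k) f" "f \<in> carrier (wstar_fun G (Suc k))"
    unfolding in_cochains_iff by blast
  have "coboundary_fun (Suc k) (coboundary_fun k f) = (\<lambda>w. 0)"
    by (simp add: coboundary_fun_coboundary_fun fun_eq_iff)
  then have "coboundary G (Suc k) Y = \<one>\<^bsub>cochains G Lb (Suc (Suc k))\<^esub>"
    unfolding X(2) f(1) coboundary_ae_class[OF f(2)] coboundary_ae_class[OF coboundary_fun_closed[OF f(2)]]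
      one_cochains ae_class_zero[symmetric] by simp
  moreover have "Y \<in> carrier (cochains G Lb (Suc k))"
    unfolding X(2) using group_hom.hom_closed[OF group_hom_coboundary X(1)] .
  ultimately show "Y \<in> cocycles G Lb (Suc k)" by (simp add: cocycles_def kernel_def)
qed

text \<open>Fibrewise means and integrals evaluate a cochain on individual fibres of the full
  product, so it is set to 0 off the tuples and where its norm exceeds the essential bound.\<close>

lemma bounded_representative:
  fixes l :: "('a, 'v::{real_normed_vector, second_countable_topology}) cochain"
  assumes l: "l \<in> carrier (wstar_fun G n)"
  obtains f :: "('a, 'v) cochain" and C where "\<And>v. (\<lambda>w. f w v) \<in> borel_measurable (tuple_borel n)" "\<And>w. norm (f w) \<le> C"
    "AE w in nu_tuples G n. f w = l w"
proof -
  obtain C0 where C0: "AE w in nu_tuples G n. norm (l w) \<le> C0"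
    using l unfolding in_wstar_fun_iff by blast
  \<comment> \<open>The maximum with 0 makes the bound valid for the default value 0 even if
    \<open>C0\<close> is negative.\<close>
  define C where "C = max C0 0"
  define f where "f w = (if w \<in> tuples G n \<and> norm (l w) \<le> C then l w else 0)" for w
  have l_meas: "(\<lambda>w. l w v) \<in> borel_measurable (nu_tuples G n)" for v
    using l unfolding in_wstar_fun_iff by blast
  show thesis
  proof (rule that)
    fix v
    have "Measurable.pred (nu_tuples G n) (\<lambda>w. norm (l w) \<le> C)"
      by (rule pred_dual_norm_le[OF l_meas]) (simp add: C_def)
    then have "(\<lambda>w. if norm (l w) \<le> C then l w v else 0) \<in> borel_measurable (nu_tuples G n)"
      by (intro measurable_If l_meas) (simp_all add: pred_def)
    then have "(\<lambda>w. indicator (tuples G n) w *\<^sub>R (if norm (l w) \<le> C then l w v else 0)) \<in> borel_measurable (tuple_borel n)"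
      unfolding measurable_cong_sets[OF sets_nu_tuples refl]
      using sets_tuples[of n] tuples_subset[of n]
      by (subst (asm) borel_measurable_restrict_space_iff) (simp_all add: Int_absorb2 mult.commute)
    moreover have "(\<lambda>w. indicator (tuples G n) w *\<^sub>R (if norm (l w) \<le> C then l w v else 0)) = (\<lambda>w. f w v)"
      by (auto simp: f_def fun_eq_iff)
    ultimately show "(\<lambda>w. f w v) \<in> borel_measurable (tuple_borel n)" by simp
  next
    show "norm (f w) \<le> C" for w by (simp add: f_def C_def)
    show "AE w in nu_tuples G n. f w = l w"
      using C0 AE_space by eventually_elim (simp add: f_def C_def space_nu_tuples le_max_iff_disj)
  qed
qed

lemma bounded_in_wstar_fun:
  assumes "\<And>v. (\<lambda>w. blinfun_apply (h w) v) \<in> borel_measurable (tuple_borel n)" "\<And>w. norm (h w) \<le> C"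
  shows "h \<in> carrier (wstar_fun G n)"
  unfolding in_wstar_fun_iff using assms by (auto intro: measurable_nu_tuples)

end

section \<open>Vanishing of the cohomology\<close>

lemma (in group) trivial_group_Mod_carrier: "trivial_group (G Mod carrier G)"
proof -
  have "carrier G #> a = carrier G" if "a \<in> carrier G" for a
    using that by (intro coset_join2 subgroup_self)
  then have "rcosets (carrier G) = {carrier G}"
    unfolding RCOSETS_def using one_closed by blast
  then show ?thesis
    unfolding trivial_group_def
    using normal.factorgroup_is_group[OF normal_self] by (simp add: FactGroup_def)
qed

text \<open>A class of degree \<open>Suc k\<close> has a representative in
  \<open>Suc (Suc k)\<close> variables. Its homotopy \<open>h\<close> has \<open>Suc k\<close> of
  them, is bounded and invariant, and so its class is a cochain of degree \<open>k\<close> with the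
  given coboundary.\<close>

lemma (in measured_groupoid_means) cocycles_subset_coboundaries:
  fixes Lb :: "'a \<Rightarrow> 'v::{real_normed_vector, second_countable_topology} \<Rightarrow>\<^sub>L 'v"
  assumes Lb: "\<And>v. (\<lambda>g. Lb g v) \<in> borel_measurable (nu G)"
  shows "cocycles G Lb (Suc k) \<subseteq> coboundaries G Lb (Suc k)"
proof
  fix X assume "X \<in> cocycles G Lb (Suc k)"
  then have X: "X \<in> carrier (cochains G Lb (Suc k))"
    and closed: "coboundary G (Suc k) X = null_fun G (Suc (Suc (Suc k)))"
    by (simp_all add: cocycles_def kernel_def one_cochains)
  then obtain l where l: "X = ae_class G (Suc (Suc k)) l" "l \<in> carrier (wstar_fun G (Suc (Suc k)))"
    and l_inv: "invariant_fun G Lb (Suc (Suc k)) l"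
    unfolding in_cochains_iff by blast
  have "AE w in nu_tuples G (Suc (Suc (Suc k))). coboundary_fun (Suc k) l w = 0"
    using closed unfolding l(1) coboundary_ae_class[OF l(2)] ae_class_zero[symmetric]
    by (simp add: ae_class_eq_iff coboundary_fun_closed l(2) wstar_fun_zero)
  obtain f :: "('a, 'v) cochain" and C where f: "\<And>v. (\<lambda>w. f w v) \<in> borel_measurable (tuple_borel (Suc (Suc k)))" "\<And>w. norm (f w) \<le> C"
    and f_eq: "AE w in nu_tuples G (Suc (Suc k)). f w = l w"
    by (rule bounded_representative[OF l(2)]) (rule that)
  have f_cocycle: "AE w in nu_tuples G (Suc (Suc (Suc k))). coboundary_fun (Suc k) f w = 0"
    using AE_coboundary_fun_cong[OF f_eq] \<open>AE w in nu_tuples G (Suc (Suc (Suc k))). coboundary_fun (Suc k) l w = 0\<close>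
    by eventually_elim simp
  obtain h :: "('a, 'v) cochain"
    where h: "\<And>v. (\<lambda>w. h w v) \<in> borel_measurable (tuple_borel (Suc k))" "\<And>w. norm (h w) \<le> C"
      and homotopy: "AE x in mu G. dual_mean_density (Suc k) f h x"
    by (rule dual_homotopy[OF f]) (rule that)
  have h_closed: "h \<in> carrier (wstar_fun G (Suc k))" by (rule bounded_in_wstar_fun[OF h])
  have h_inv: "invariant_fun G Lb (Suc k) h"
    by (rule homotopy_invariant[OF f h homotopy f_eq l_inv Lb])
  have "AE w in nu_tuples G (Suc (Suc k)). coboundary_fun k h w = l w"
    using coboundary_homotopy[OF f h homotopy f_cocycle] f_eq by eventually_elim simp
  then have "X = coboundary G k (ae_class G (Suc k) h)"
    unfolding l(1) coboundary_ae_class[OF h_closed]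
    by (subst ae_class_eq_iff) (auto simp: l(2) coboundary_fun_closed h_closed elim: eventually_mono)
  moreover have "ae_class G (Suc k) h \<in> carrier (cochains G Lb k)"
    unfolding in_cochains_iff using h_closed h_inv by blast
  ultimately show "X \<in> coboundaries G Lb (Suc k)" by simp
qed

theorem theorem4:
  fixes G :: "'a measured_groupoid_data"
    and Lb :: "'a \<Rightarrow> ('v::{banach, second_countable_topology} \<Rightarrow>\<^sub>L 'v)"
    and k :: nat
  assumes "measured_groupoid G"
    and "amenable G"
    and "coefficient_module G Lb"
    and "k \<ge> 1"
  shows "trivial_group (Hmb G Lb k)"
proof -
  interpret measured_groupoid G by (rule assms(1))
  obtain m where "invariant_system_of_means G m"
    using assms(2) unfolding amenable_def by blast
  then interpret measured_groupoid_means G m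
    by (intro measured_groupoid_means.intro measured_groupoid_means_axioms.intro assms(1))
  obtain j where k: "k = Suc j" using assms(4) by (cases k) auto
  have Lb: "(\<lambda>g. Lb g v) \<in> borel_measurable (nu G)" for v
    by (rule coefficient_module.Lb_measurable[OF assms(3)])
  \<comment> \<open>With these subgroups equal, the cohomology is a group modulo its whole
    carrier.\<close>
  have eq: "coboundaries G Lb k = cocycles G Lb k"
    unfolding k using coboundaries_subset_cocycles cocycles_subset_coboundaries[OF Lb] by (rule equalityI)
  have "group ((cochains G Lb k)\<lparr>carrier := cocycles G Lb k\<rparr>)"
    by (rule subgroup.subgroup_is_group[OF subgroup_cocycles group_cochains])
  from group.trivial_group_Mod_carrier[OF this]
  show ?thesis unfolding Hmb_def eq by simp
qed

end
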